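(* If $p \in (1, \infty) \setminus \{ 2 \}$, then the algebra $\mathbb{K}(L^p([0,1]))$ of compact operators on $L^p([0,1])$ (Lebesgue measure) is an approximately unital $L^p$-operator algebra which is not scaled.
   Context: An $L^p$-operator algebra is a (complex) Banach algebra isometrically isomorphic to a norm closed subalgebra of $B(L^p(X,\mu))$ for some measure space $(X,\mu)$. A unital Banach algebra is one with an identity of norm $1$. A cai is a contractive approximate identity (a net $(e_t)$ with $\|e_t\|\le1$, $e_ta\to a$, $ae_t\to a$ for all $a$). Approximately unital means having a cai. Multiplier unitization: for a nonunital approximately unital Banach algebra $A$, $A^1 = A + \mathbb{C}1$ with norm $\|a+\lambda 1\| = \sup\{\|ac+\lambda c\| : c \in A, \|c\|\le 1\}$. A state on a unital Banach algebra is a linear functional $\omega$ with $\|\omega\| = \omega(1)=1$. A state on a nonunital approximately unital Banach algebra $A$ is a functional of norm $1$ on $A$ which is the restriction to $A$ of a state on $A^1$. The quasistate space is $Q(A) = \{\lambda\varphi : \lambda\in[0,1],\ \varphi \text{ a state on } A\}$. A nonunital approximately unital Banach algebra $A$ is scaled if the set of restrictions to $A$ of states on $A^1$ equals $Q(A)$. *)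

theory Defs
  imports "HOL-Analysis.Analysis" "HOL-Algebra.Module" "HOL-Algebra.Algebraic_Closure_Type"
begin

section \<open>Complex normed spaces and Banach algebras with explicit carriers\<close>

text \<open>
  The exponent of an \<open>L\<^sup>p\<close> space is a term variable, so normed spaces have to live on carrier sets.
  One record serves for normed spaces and for normed algebras. The fields \<^const>\<open>mult\<close> and
  \<^const>\<open>one\<close> are inherited from \<^typ>\<open>'a ring\<close>: both are meaningless for a mere normed space,
  and no axiom constrains \<^const>\<open>one\<close> in an algebra, where it need not belong to the carrier.
\<close>

record 'a cnormed = "(complex, 'a) module" +
  nrm :: "'a \<Rightarrow> real"

abbreviation complex_ring :: "complex ring"
  where "complex_ring \<equiv> ring_of_type_algebra"

locale complex_normed_space =
  Module.module complex_ring V for V :: "('a, 'b) cnormed_scheme" (structure) +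
  assumes nrm_eq_0_iff: "x \<in> carrier V \<Longrightarrow> nrm V x = 0 \<longleftrightarrow> x = \<zero>"
    and nrm_smult: "x \<in> carrier V \<Longrightarrow> nrm V (c \<odot> x) = cmod c * nrm V x"
    and nrm_triangle: "x \<in> carrier V \<Longrightarrow> y \<in> carrier V \<Longrightarrow> nrm V (x \<oplus> y) \<le> nrm V x + nrm V y"

text \<open>
  The value 0 off the carrier is needed because the locale \<^locale>\<open>Metric_space\<close> demands
  nonnegativity and symmetry of the distance on the whole type.
\<close>

definition nrm_dist :: "('a, 'b) cnormed_scheme \<Rightarrow> 'a \<Rightarrow> 'a \<Rightarrow> real" where
  "nrm_dist V x y = (if x \<in> carrier V \<and> y \<in> carrier V then nrm V (x \<ominus>\<^bsub>V\<^esub> y) else 0)"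

abbreviation nrm_topology :: "('a, 'b) cnormed_scheme \<Rightarrow> 'a topology" where
  "nrm_topology V \<equiv> Metric_space.mtopology (carrier V) (nrm_dist V)"

definition closed_unit_ball :: "('a, 'b) cnormed_scheme \<Rightarrow> 'a set" where
  "closed_unit_ball V = {x \<in> carrier V. nrm V x \<le> 1}"

locale complex_banach_algebra =
  complex_normed_space A for A :: "('a, 'b) cnormed_scheme" (structure) +
  assumes complete: "Metric_space.mcomplete (carrier A) (nrm_dist A)"
    and mult_closed: "x \<in> carrier A \<Longrightarrow> y \<in> carrier A \<Longrightarrow> x \<otimes> y \<in> carrier A"
    and mult_assoc: "x \<in> carrier A \<Longrightarrow> y \<in> carrier A \<Longrightarrow> z \<in> carrier A
                       \<Longrightarrow> (x \<otimes> y) \<otimes> z = x \<otimes> (y \<otimes> z)"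
    and mult_distr_right: "x \<in> carrier A \<Longrightarrow> y \<in> carrier A \<Longrightarrow> z \<in> carrier A
                       \<Longrightarrow> (x \<oplus> y) \<otimes> z = x \<otimes> z \<oplus> y \<otimes> z"
    and mult_distr_left: "x \<in> carrier A \<Longrightarrow> y \<in> carrier A \<Longrightarrow> z \<in> carrier A
                       \<Longrightarrow> x \<otimes> (y \<oplus> z) = x \<otimes> y \<oplus> x \<otimes> z"
    and mult_smult_left: "x \<in> carrier A \<Longrightarrow> y \<in> carrier A \<Longrightarrow> (c \<odot> x) \<otimes> y = c \<odot> (x \<otimes> y)"
    and mult_smult_right: "x \<in> carrier A \<Longrightarrow> y \<in> carrier A \<Longrightarrow> x \<otimes> (c \<odot> y) = c \<odot> (x \<otimes> y)"
    and nrm_mult: "x \<in> carrier A \<Longrightarrow> y \<in> carrier A \<Longrightarrow> nrm A (x \<otimes> y) \<le> nrm A x * nrm A y"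

definition unital :: "('a, 'b) cnormed_scheme \<Rightarrow> bool" where
  "unital A \<longleftrightarrow> complex_banach_algebra A \<and>
     (\<exists>e\<in>carrier A. nrm A e = 1 \<and> (\<forall>a\<in>carrier A. e \<otimes>\<^bsub>A\<^esub> a = a \<and> a \<otimes>\<^bsub>A\<^esub> e = a))"

text \<open>
  Nets are given by a proper filter on the index type. In \<open>approximately_unital\<close> it costs no
  generality to index by the type of the algebra: a net can be replaced by the identity map
  together with the image of its tail filter.
\<close>

definition cai :: "('a, 'b) cnormed_scheme \<Rightarrow> ('i \<Rightarrow> 'a) \<Rightarrow> 'i filter \<Rightarrow> bool" where
  "cai A e F \<longleftrightarrow> F \<noteq> bot \<and>
     (\<forall>\<^sub>F t in F. e t \<in> carrier A \<and> nrm A (e t) \<le> 1) \<and>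
     (\<forall>a\<in>carrier A. limitin (nrm_topology A) (\<lambda>t. e t \<otimes>\<^bsub>A\<^esub> a) a F \<and>
                     limitin (nrm_topology A) (\<lambda>t. a \<otimes>\<^bsub>A\<^esub> e t) a F)"

definition approximately_unital :: "('a, 'b) cnormed_scheme \<Rightarrow> bool" where
  "approximately_unital A \<longleftrightarrow> complex_banach_algebra A \<and> (\<exists>(e :: 'a \<Rightarrow> 'a) F. cai A e F)"

definition norm_closed_subalgebra :: "'a set \<Rightarrow> ('a, 'b) cnormed_scheme \<Rightarrow> bool" where
  "norm_closed_subalgebra S A \<longleftrightarrow> submodule S complex_ring A \<and>
     (\<forall>x\<in>S. \<forall>y\<in>S. x \<otimes>\<^bsub>A\<^esub> y \<in> S) \<and> closedin (nrm_topology A) S"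


section \<open>Bounded and compact operators\<close>

text \<open>
  Operators are extensional functions, so that operators agreeing on the carrier are equal.
\<close>

definition linear_maps :: "('a, 'c) cnormed_scheme \<Rightarrow> ('b, 'd) cnormed_scheme \<Rightarrow> ('a \<Rightarrow> 'b) set" where
  "linear_maps V W = {T \<in> carrier V \<rightarrow>\<^sub>E carrier W.
     (\<forall>x\<in>carrier V. \<forall>y\<in>carrier V. T (x \<oplus>\<^bsub>V\<^esub> y) = T x \<oplus>\<^bsub>W\<^esub> T y) \<and>
     (\<forall>c. \<forall>x\<in>carrier V. T (c \<odot>\<^bsub>V\<^esub> x) = c \<odot>\<^bsub>W\<^esub> T x)}"

definition bounded_ops :: "('a, 'c) cnormed_scheme \<Rightarrow> ('b, 'd) cnormed_scheme \<Rightarrow> ('a \<Rightarrow> 'b) set" where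
  "bounded_ops V W = {T \<in> linear_maps V W. \<exists>K. \<forall>x\<in>carrier V. nrm W (T x) \<le> K * nrm V x}"

definition op_norm :: "('a, 'c) cnormed_scheme \<Rightarrow> ('b, 'd) cnormed_scheme \<Rightarrow> ('a \<Rightarrow> 'b) \<Rightarrow> real" where
  "op_norm V W T = (SUP x\<in>closed_unit_ball V. nrm W (T x))"

definition op_algebra :: "('a, 'b) cnormed_scheme \<Rightarrow> ('a \<Rightarrow> 'a) cnormed" where
  "op_algebra V = \<lparr>
     carrier = bounded_ops V V,
     monoid.mult = (\<lambda>S T. compose (carrier V) S T),
     one = (\<lambda>x\<in>carrier V. x),
     ring.zero = (\<lambda>x\<in>carrier V. \<zero>\<^bsub>V\<^esub>),
     add = (\<lambda>S T. \<lambda>x\<in>carrier V. S x \<oplus>\<^bsub>V\<^esub> T x),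
     smult = (\<lambda>c T. \<lambda>x\<in>carrier V. c \<odot>\<^bsub>V\<^esub> T x),
     nrm = op_norm V V \<rparr>"

definition compact_ops :: "('a, 'b) cnormed_scheme \<Rightarrow> ('a \<Rightarrow> 'a) set" where
  "compact_ops V = {T \<in> bounded_ops V V.
     compactin (nrm_topology V) (nrm_topology V closure_of (T ` closed_unit_ball V))}"

definition compact_op_algebra :: "('a, 'b) cnormed_scheme \<Rightarrow> ('a \<Rightarrow> 'a) cnormed" where
  "compact_op_algebra V = (op_algebra V)\<lparr>carrier := compact_ops V\<rparr>"

definition isometrically_isomorphic ::
    "('a, 'c) cnormed_scheme \<Rightarrow> ('b, 'd) cnormed_scheme \<Rightarrow> bool" where
  "isometrically_isomorphic A B \<longleftrightarrow> (\<exists>\<phi>\<in>linear_maps A B.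
     bij_betw \<phi> (carrier A) (carrier B) \<and>
     (\<forall>x\<in>carrier A. \<forall>y\<in>carrier A. \<phi> (x \<otimes>\<^bsub>A\<^esub> y) = \<phi> x \<otimes>\<^bsub>B\<^esub> \<phi> y) \<and>
     (\<forall>x\<in>carrier A. nrm B (\<phi> x) = nrm A x))"


section \<open>The spaces \<open>L\<^sup>p(M)\<close>\<close>

definition Lp_functions :: "real \<Rightarrow> 'x measure \<Rightarrow> ('x \<Rightarrow> complex) set" where
  "Lp_functions p M = {f \<in> borel_measurable M. integrable M (\<lambda>x. cmod (f x) powr p)}"

definition Lp_rel :: "real \<Rightarrow> 'x measure \<Rightarrow> (('x \<Rightarrow> complex) \<times> ('x \<Rightarrow> complex)) set" where
  "Lp_rel p M = {(f, g). f \<in> Lp_functions p M \<and> g \<in> Lp_functions p M \<and> (AE x in M. f x = g x)}"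

definition Lp_seminorm :: "real \<Rightarrow> 'x measure \<Rightarrow> ('x \<Rightarrow> complex) \<Rightarrow> real" where
  "Lp_seminorm p M f = (LINT x|M. cmod (f x) powr p) powr (1 / p)"

text \<open>
  Meant for \<open>1 \<le> p < \<infinity>\<close>. Elements are the classes of functions modulo equality almost
  everywhere; sum, multiple and norm do not depend on the chosen representatives.
\<close>

definition Lp :: "real \<Rightarrow> 'x measure \<Rightarrow> ('x \<Rightarrow> complex) set cnormed" where
  "Lp p M = \<lparr>
     carrier = Lp_functions p M // Lp_rel p M,
     monoid.mult = undefined,
     one = undefined,
     ring.zero = Lp_rel p M `` {\<lambda>_. 0},
     add = (\<lambda>F G. \<Union>f\<in>F. \<Union>g\<in>G. Lp_rel p M `` {\<lambda>x. f x + g x}),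
     smult = (\<lambda>c F. \<Union>f\<in>F. Lp_rel p M `` {\<lambda>x. c * f x}),
     nrm = (\<lambda>F. the_elem (Lp_seminorm p M ` F)) \<rparr>"

text \<open>
  HOL cannot quantify over the type underlying the measure space, so it is a parameter
  \<^typ>\<open>'x itself\<close>.
\<close>

definition Lp_operator_algebra :: "'x itself \<Rightarrow> real \<Rightarrow> ('a, 'b) cnormed_scheme \<Rightarrow> bool" where
  "Lp_operator_algebra _ p A \<longleftrightarrow> complex_banach_algebra A \<and>
     (\<exists>(M :: 'x measure) S. norm_closed_subalgebra S (op_algebra (Lp p M)) \<and>
        isometrically_isomorphic A ((op_algebra (Lp p M))\<lparr>carrier := S\<rparr>))"


section \<open>States, quasistates and scaled algebras\<close>

definition complex_space :: "complex cnormed" where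
  "complex_space = \<lparr> carrier = UNIV, monoid.mult = (*), one = 1, ring.zero = 0, add = (+),
                     smult = (*), nrm = cmod \<rparr>"

text \<open>The pair \<open>(a, \<lambda>)\<close> stands for \<open>a + \<lambda>1\<close>.\<close>

definition multiplier_unitization :: "('a, 'b) cnormed_scheme \<Rightarrow> ('a \<times> complex) cnormed" where
  "multiplier_unitization A = \<lparr>
     carrier = carrier A \<times> UNIV,
     monoid.mult = (\<lambda>(a, l) (b, m). (a \<otimes>\<^bsub>A\<^esub> b \<oplus>\<^bsub>A\<^esub> m \<odot>\<^bsub>A\<^esub> a \<oplus>\<^bsub>A\<^esub> l \<odot>\<^bsub>A\<^esub> b, l * m)),
     one = (\<zero>\<^bsub>A\<^esub>, 1),
     ring.zero = (\<zero>\<^bsub>A\<^esub>, 0),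
     add = (\<lambda>(a, l) (b, m). (a \<oplus>\<^bsub>A\<^esub> b, l + m)),
     smult = (\<lambda>c (a, l). (c \<odot>\<^bsub>A\<^esub> a, c * l)),
     nrm = (\<lambda>(a, l). SUP c\<in>closed_unit_ball A. nrm A (a \<otimes>\<^bsub>A\<^esub> c \<oplus>\<^bsub>A\<^esub> l \<odot>\<^bsub>A\<^esub> c)) \<rparr>"

text \<open>States on an algebra \<open>U\<close> whose identity is the record field \<open>\<one>\<^bsub>U\<^esub>\<close>.\<close>

definition unital_states :: "('a, 'b) cnormed_scheme \<Rightarrow> ('a \<Rightarrow> complex) set" where
  "unital_states U =
     {\<omega> \<in> bounded_ops U complex_space. op_norm U complex_space \<omega> = 1 \<and> \<omega> \<one>\<^bsub>U\<^esub> = 1}"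

definition unitization_state_restrictions :: "('a, 'b) cnormed_scheme \<Rightarrow> ('a \<Rightarrow> complex) set" where
  "unitization_state_restrictions A =
     (\<lambda>\<omega>. \<lambda>a\<in>carrier A. \<omega> (a, 0)) ` unital_states (multiplier_unitization A)"

text \<open>
  From here on, \<open>A\<close> is meant to be a nonunital approximately unital Banach algebra.
\<close>

definition states :: "('a, 'b) cnormed_scheme \<Rightarrow> ('a \<Rightarrow> complex) set" where
  "states A = {\<phi> \<in> bounded_ops A complex_space. op_norm A complex_space \<phi> = 1 \<and>
                 \<phi> \<in> unitization_state_restrictions A}"

definition quasistates :: "('a, 'b) cnormed_scheme \<Rightarrow> ('a \<Rightarrow> complex) set" where
  "quasistates A = {\<lambda>a\<in>carrier A. of_real t * \<phi> a | t \<phi>. 0 \<le> t \<and> t \<le> 1 \<and> \<phi> \<in> states A}"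

definition scaled :: "('a, 'b) cnormed_scheme \<Rightarrow> bool" where
  "scaled A \<longleftrightarrow> unitization_state_restrictions A = quasistates A"

end

(*
  A contractive approximate identity of K(L^p[0,1]) is given by the conditional expectations E_m onto
  the step functions for finer and finer partitions. E_m T converges to T because E_m converges
  strongly to the identity. For T E_m one needs that phi o E_m converges in norm to phi for each
  functional phi; this follows without duality theory from the smoothness of the norm of L^p.
  As rank one operators are compact, a left unit would be the identity of L^p, which is not compact.

  For the failure of scaling, let f_m be 1 on [0,1/2] and oscillate between 0 and 2 on [1/2,1]. Then
  f_m tends weakly to 1, but the norming functionals of f_m tend weakly to a multiple of
  g = (1, 2^(p-2)), which is not proportional to the norming functional of 1 when p is not 2. The
  vector states of f_m therefore converge to a functional psi = <. 1, g>/N on K that extends to a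
  state of K^1. If K were scaled, the normalisation phi of psi would be the restriction of a state
  as well. Let u be the unit vector with <u, g> = ||g|| and let a be the rank one contraction
  x |-> (int x) u. Then phi(a) = 1, so ||1 + a|| = 2. But ||1 + a|| < 2 by strict convexity, which a
  compactness argument in two dimensions makes uniform: the mean of x is close to its norm only if x
  puts nearly equal p-mass on the two halves of [0,1], and u does not.
*)

theory Submission
  imports Defs "HOL-Probability.Probability_Measure"
begin

section \<open>Normed spaces on carrier sets\<close>

text \<open>Norming functionals are, up to scalars, f |-> |f|^(p-2) conj f. Only for p = 2 is this
  additive, so for every other p weak limits of vectors and of their norming functionals drift
  apart. The values 0 and 2 are a simple instance: their mean is 1, while the mean of their powers
  of exponent p - 1 is 2^(p-2). The extension of phi that evaluates the same pair of vectors at the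
  identity takes a value below 1 there. But extensions to K^1 need not be unique, so the
  contradiction has to come from the norm of K^1 itself; hence the element a at which phi attains
  its norm. One device replaces the Hahn-Banach theorem: on a probability space the integral has
  norm 1 and attains it at the constant 1. So x |-> (int x) u with ||u|| = 1 is a rank one
  contraction that carries 1 to a prescribed unit vector. It serves to show that a left unit is the
  identity, to identify the norm of K^1 with the operator norm of T + lambda on L^p, and to
  construct a.\<close>

lemma complex_ring_simps [simp]:
  "carrier complex_ring = UNIV" "(x \<oplus>\<^bsub>complex_ring\<^esub> y) = x + y"
  "(x \<otimes>\<^bsub>complex_ring\<^esub> y) = x * y" "\<one>\<^bsub>complex_ring\<^esub> = 1" "\<zero>\<^bsub>complex_ring\<^esub> = 0"
  by (auto simp: ring_of_type_algebra_def)

text \<open>No inverses have to be supplied: \<open>(-1) \<odot> x\<close> is the negative of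
  \<open>x\<close>, by distributivity and \<open>0 \<odot> x = \<zero>\<close>.\<close>

lemma complex_normed_spaceI:
  fixes V :: "('a, 'b) cnormed_scheme" (structure)
  assumes add: "\<And>x y. x \<in> carrier V \<Longrightarrow> y \<in> carrier V \<Longrightarrow> x \<oplus> y \<in> carrier V"
    and zero: "\<zero> \<in> carrier V"
    and smult: "\<And>c x. x \<in> carrier V \<Longrightarrow> c \<odot> x \<in> carrier V"
    and assoc: "\<And>x y z. x \<in> carrier V \<Longrightarrow> y \<in> carrier V \<Longrightarrow> z \<in> carrier V \<Longrightarrow> (x \<oplus> y) \<oplus> z = x \<oplus> (y \<oplus> z)"
    and comm: "\<And>x y. x \<in> carrier V \<Longrightarrow> y \<in> carrier V \<Longrightarrow> x \<oplus> y = y \<oplus> x"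
    and zero_add: "\<And>x. x \<in> carrier V \<Longrightarrow> \<zero> \<oplus> x = x"
    and smult_zero: "\<And>x. x \<in> carrier V \<Longrightarrow> 0 \<odot> x = \<zero>"
    and smult_one: "\<And>x. x \<in> carrier V \<Longrightarrow> 1 \<odot> x = x"
    and smult_assoc: "\<And>c d x. x \<in> carrier V \<Longrightarrow> (c * d) \<odot> x = c \<odot> (d \<odot> x)"
    and smult_l: "\<And>c d x. x \<in> carrier V \<Longrightarrow> (c + d) \<odot> x = c \<odot> x \<oplus> d \<odot> x"
    and smult_r: "\<And>c x y. x \<in> carrier V \<Longrightarrow> y \<in> carrier V \<Longrightarrow> c \<odot> (x \<oplus> y) = c \<odot> x \<oplus> c \<odot> y"
    and nrm0: "\<And>x. x \<in> carrier V \<Longrightarrow> nrm V x = 0 \<longleftrightarrow> x = \<zero>"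
    and nrm_smult: "\<And>c x. x \<in> carrier V \<Longrightarrow> nrm V (c \<odot> x) = cmod c * nrm V x"
    and tri: "\<And>x y. x \<in> carrier V \<Longrightarrow> y \<in> carrier V \<Longrightarrow> nrm V (x \<oplus> y) \<le> nrm V x + nrm V y"
  shows "complex_normed_space V"
proof -
  have "abelian_group V"
  proof (rule abelian_groupI)
    fix x assume x: "x \<in> carrier V"
    have "(-1) \<odot> x \<oplus> x = (-1 + 1) \<odot> x" using smult_l[OF x, of "-1" 1] smult_one[OF x] by simp
    then show "\<exists>y\<in>carrier V. y \<oplus> x = \<zero>" using smult[OF x] smult_zero[OF x] by auto
  qed (use assms in auto)
  then have "Module.module complex_ring V"
    by (intro moduleI) (auto simp: assms intro: cring_from_type_algebra)
  then show ?thesis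
    unfolding complex_normed_space_def complex_normed_space_axioms_def using nrm0 nrm_smult tri by auto
qed

context complex_normed_space
begin

lemma smult_cl [simp, intro]: "x \<in> carrier V \<Longrightarrow> c \<odot> x \<in> carrier V"
  using smult_closed by simp

lemma smult_add_left: "x \<in> carrier V \<Longrightarrow> (c + d) \<odot> x = c \<odot> x \<oplus> d \<odot> x"
  using smult_l_distr[of c d x] by simp

lemma smult_add_right: "x \<in> carrier V \<Longrightarrow> y \<in> carrier V \<Longrightarrow> c \<odot> (x \<oplus> y) = c \<odot> x \<oplus> c \<odot> y"
  using smult_r_distr[of c x y] by simp

lemma smult_mult: "x \<in> carrier V \<Longrightarrow> (c * d) \<odot> x = c \<odot> (d \<odot> x)"
  using smult_assoc1[of c d x] by simp

lemma one_smult [simp]: "x \<in> carrier V \<Longrightarrow> 1 \<odot> x = x"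
  using smult_one[of x] by simp

lemma zero_smult [simp]: "x \<in> carrier V \<Longrightarrow> 0 \<odot> x = \<zero>"
  using nrm_eq_0_iff[of "0 \<odot> x"] nrm_smult[of x 0] by simp

lemma nrm_zero [simp]: "nrm V \<zero> = 0"
  using nrm_eq_0_iff by auto

lemma smult_zero_right [simp]: "c \<odot> \<zero> = \<zero>"
  using nrm_eq_0_iff[of "c \<odot> \<zero>"] nrm_smult[of "\<zero>" c] by simp

lemma uminus_eq: "x \<in> carrier V \<Longrightarrow> \<ominus> x = (-1) \<odot> x"
  using smult_add_left[of x "-1" 1] minus_equality[of "(-1) \<odot> x" x] by simp

lemma minus_eq_smult: "x \<in> carrier V \<Longrightarrow> y \<in> carrier V \<Longrightarrow> x \<ominus> y = x \<oplus> (-1) \<odot> y"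
  by (simp add: a_minus_def uminus_eq)

lemma smult_minus_right: 
  "x \<in> carrier V \<Longrightarrow> y \<in> carrier V \<Longrightarrow> c \<odot> (x \<ominus> y) = c \<odot> x \<ominus> c \<odot> y"
  by (simp add: minus_eq_smult smult_add_right flip: smult_mult)

lemma nrm_uminus: "x \<in> carrier V \<Longrightarrow> nrm V (\<ominus> x) = nrm V x"
  by (simp add: uminus_eq nrm_smult)

lemma minus_cl [simp, intro]: "x \<in> carrier V \<Longrightarrow> y \<in> carrier V \<Longrightarrow> x \<ominus> y \<in> carrier V"
  by simp

lemma nrm_minus_commute: "x \<in> carrier V \<Longrightarrow> y \<in> carrier V \<Longrightarrow> nrm V (x \<ominus> y) = nrm V (y \<ominus> x)"
  using nrm_smult[of "y \<ominus> x" "-1"]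
  by (simp add: minus_eq_smult smult_add_right a_comm flip: smult_mult)

lemma nrm_nonneg [simp]: "x \<in> carrier V \<Longrightarrow> 0 \<le> nrm V x"
  using nrm_triangle[of x "\<ominus> x"] by (simp add: nrm_uminus r_neg)

lemma minus_add_cancel: "x \<in> carrier V \<Longrightarrow> y \<in> carrier V \<Longrightarrow> (x \<ominus> y) \<oplus> y = x"
  by (simp add: a_minus_def a_assoc l_neg)

lemma nrm_triangle_minus:
  assumes "x \<in> carrier V" "y \<in> carrier V" "z \<in> carrier V"
  shows "nrm V (x \<ominus> z) \<le> nrm V (x \<ominus> y) + nrm V (y \<ominus> z)"
proof -
  have "x \<ominus> z = (x \<ominus> y) \<oplus> (y \<ominus> z)"
    using assms by (simp add: a_minus_def a_assoc) (simp add: l_neg flip: a_assoc)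
  then show ?thesis using nrm_triangle assms by simp
qed

lemma nrm_le_minus: "x \<in> carrier V \<Longrightarrow> y \<in> carrier V \<Longrightarrow> nrm V x \<le> nrm V (x \<ominus> y) + nrm V y"
  using nrm_triangle[of "x \<ominus> y" y] by (simp add: minus_add_cancel)

lemma minus_eq_zero_iff: "x \<in> carrier V \<Longrightarrow> y \<in> carrier V \<Longrightarrow> x \<ominus> y = \<zero> \<longleftrightarrow> x = y"
  using minus_add_cancel[of x y] by (auto simp: a_minus_def r_neg)

lemma add_diff_add:
  assumes "a \<in> carrier V" "b \<in> carrier V" "c \<in> carrier V" "d \<in> carrier V"
  shows "(a \<oplus> b) \<ominus> (c \<oplus> d) = (a \<ominus> c) \<oplus> (b \<ominus> d)"
  using assms by (simp add: minus_eq_smult smult_add_right a_ac)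

sublocale metric: Metric_space "carrier V" "nrm_dist V"
proof
  show "0 \<le> nrm_dist V x y" for x y by (simp add: nrm_dist_def)
  show "nrm_dist V x y = nrm_dist V y x" for x y by (simp add: nrm_dist_def nrm_minus_commute)
  show "x \<in> carrier V \<Longrightarrow> y \<in> carrier V \<Longrightarrow> (nrm_dist V x y = 0) = (x = y)" for x y
    by (simp add: nrm_dist_def nrm_eq_0_iff minus_eq_zero_iff)
  show "nrm_dist V x z \<le> nrm_dist V x y + nrm_dist V y z"
    if "x \<in> carrier V" "y \<in> carrier V" "z \<in> carrier V" for x y z
    using that by (simp add: nrm_dist_def nrm_triangle_minus)
qed

lemma limitin_nrm_iff:
  "limitin (nrm_topology V) f l F \<longleftrightarrow>
     l \<in> carrier V \<and> (\<forall>e>0. \<forall>\<^sub>F x in F. f x \<in> carrier V \<and> nrm V (f x \<ominus> l) < e)"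
proof -
  have "(\<forall>\<^sub>F x in F. f x \<in> carrier V \<and> nrm_dist V (f x) l < e) \<longleftrightarrow>
        (\<forall>\<^sub>F x in F. f x \<in> carrier V \<and> nrm V (f x \<ominus> l) < e)" if "l \<in> carrier V" for e
    by (intro eventually_cong) (auto simp: nrm_dist_def that)
  then show ?thesis by (auto simp: metric.limitin_metric)
qed

text \<open>Confining the sequence to the carrier first is what permits replacing
  \<open>nrm_dist\<close>, which is 0 off the carrier, by \<open>nrm\<close> of a
  difference.\<close>

lemma mcomplete_iff:
  "metric.mcomplete \<longleftrightarrow> (\<forall>\<sigma> :: nat \<Rightarrow> 'a. range \<sigma> \<subseteq> carrier V \<and>
      (\<forall>e>0. \<exists>N. \<forall>m\<ge>N. \<forall>n\<ge>N. nrm V (\<sigma> m \<ominus> \<sigma> n) < e) \<longrightarrow>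
      (\<exists>l\<in>carrier V. \<forall>e>0. \<exists>N. \<forall>n\<ge>N. nrm V (\<sigma> n \<ominus> l) < e))"
proof -
  have C: "metric.MCauchy \<sigma> \<longleftrightarrow> range \<sigma> \<subseteq> carrier V \<and>
      (\<forall>e>0. \<exists>N. \<forall>m\<ge>N. \<forall>n\<ge>N. nrm V (\<sigma> m \<ominus> \<sigma> n) < e)" for \<sigma>
    unfolding metric.MCauchy_def
    by (intro conj_cong refl) (auto simp: nrm_dist_def image_subset_iff)
  have L: "limitin (nrm_topology V) \<sigma> l sequentially \<longleftrightarrow>
      l \<in> carrier V \<and> (\<forall>e>0. \<exists>N. \<forall>n\<ge>N. nrm V (\<sigma> n \<ominus> l) < e)" if "range \<sigma> \<subseteq> carrier V" for \<sigma> l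
    using that by (auto simp: limitin_nrm_iff eventually_sequentially image_subset_iff)
  have eq: "(range \<sigma> \<subseteq> carrier V \<and> Q \<longrightarrow> (\<exists>x. limitin (nrm_topology V) \<sigma> x sequentially)) \<longleftrightarrow>
        (range \<sigma> \<subseteq> carrier V \<and> Q \<longrightarrow>
           (\<exists>l\<in>carrier V. \<forall>e>0. \<exists>N. \<forall>n\<ge>N. nrm V (\<sigma> n \<ominus> l) < e))" for \<sigma> Q
    by (cases "range \<sigma> \<subseteq> carrier V") (simp_all add: L Bex_def)
  show ?thesis unfolding metric.mcomplete_def C by (simp only: eq)
qed

lemma closedin_nrm_iff:
  "closedin (nrm_topology V) S \<longleftrightarrow> S \<subseteq> carrier V \<and>
     (\<forall>(\<sigma> :: nat \<Rightarrow> 'a) l. range \<sigma> \<subseteq> S \<and> l \<in> carrier V \<and> (\<forall>e>0. \<exists>N. \<forall>n\<ge>N. nrm V (\<sigma> n \<ominus> l) < e) \<longrightarrow> l \<in> S)"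
proof (cases "S \<subseteq> carrier V")
  case True
  have L: "limitin (nrm_topology V) \<sigma> l sequentially \<longleftrightarrow>
      l \<in> carrier V \<and> (\<forall>e>0. \<exists>N. \<forall>n\<ge>N. nrm V (\<sigma> n \<ominus> l) < e)" if "range \<sigma> \<subseteq> S" for \<sigma> l
    using that True by (auto simp: limitin_nrm_iff eventually_sequentially image_subset_iff subset_iff)
  have eq: "(range \<sigma> \<subseteq> S \<and> limitin (nrm_topology V) \<sigma> l sequentially \<longrightarrow> l \<in> S) \<longleftrightarrow>
      (range \<sigma> \<subseteq> S \<and> l \<in> carrier V \<and> (\<forall>e>0. \<exists>N. \<forall>n\<ge>N. nrm V (\<sigma> n \<ominus> l) < e) \<longrightarrow> l \<in> S)" for \<sigma> l
    by (cases "range \<sigma> \<subseteq> S") (simp_all add: L)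
  show ?thesis unfolding metric.metric_closedin_iff_sequentially_closed by (simp only: eq)
qed (simp add: metric.metric_closedin_iff_sequentially_closed)

text \<open>In contrast to the definition of \<open>mtotally_bounded\<close>, the net need not lie in \<open>S\<close>.\<close>

lemma mtotally_bounded_iff:
  "metric.mtotally_bounded S \<longleftrightarrow> S \<subseteq> carrier V \<and>
     (\<forall>e>0. \<exists>F. finite F \<and> F \<subseteq> carrier V \<and> (\<forall>x\<in>S. \<exists>y\<in>F. nrm V (x \<ominus> y) < e))" (is "?L = ?R")
proof
  assume L: ?L
  then have S: "S \<subseteq> carrier V" by (rule metric.mtotally_bounded_imp_subset)
  have "\<exists>F. finite F \<and> F \<subseteq> carrier V \<and> (\<forall>x\<in>S. \<exists>y\<in>F. nrm V (x \<ominus> y) < e)" if e: "e > 0" for e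
  proof -
    obtain K where K: "finite K" "K \<subseteq> S" "S \<subseteq> (\<Union>x\<in>K. metric.mball x e)"
      using L[unfolded metric.mtotally_bounded_def, rule_format, OF e] by blast
    have "\<exists>y\<in>K. nrm V (x \<ominus> y) < e" if x: "x \<in> S" for x
    proof -
      obtain y where y: "y \<in> K" "x \<in> metric.mball y e" using K(3) x by blast
      then have "x \<in> carrier V" "y \<in> carrier V" "nrm_dist V y x < e"
        by (simp_all only: metric.in_mball)
      then have "nrm V (x \<ominus> y) < e" using nrm_minus_commute[of x y] by (simp only: nrm_dist_def) simp
      with y show ?thesis by blast
    qed
    then show ?thesis using K S by (intro exI[of _ K]) auto
  qed
  then show ?R using S by simp
next
  assume R: ?R
  then have SV: "S \<subseteq> carrier V" by (rule conjunct1)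
  show ?L unfolding metric.mtotally_bounded_def
  proof (intro allI impI)
    fix e :: real assume "e > 0"
    then obtain F where F: "finite F" "F \<subseteq> carrier V" "\<forall>x\<in>S. \<exists>y\<in>F. nrm V (x \<ominus> y) < e / 2"
      using R[THEN conjunct2, rule_format, of "e / 2"] by auto
    \<comment> \<open>Each net point \<open>y\<close> that is close to \<open>S\<close> is moved to
      a point of \<open>S\<close>; this doubles the radius \<open>e / 2\<close>.\<close>
    define s where "s y = (SOME x. x \<in> S \<and> nrm V (x \<ominus> y) < e / 2)" for y
    define K where "K = s ` {y\<in>F. \<exists>x\<in>S. nrm V (x \<ominus> y) < e / 2}"
    have s: "s y \<in> S \<and> nrm V (s y \<ominus> y) < e / 2" if "x \<in> S" "nrm V (x \<ominus> y) < e / 2" for x y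
      unfolding s_def by (rule someI[of _ x]) (use that in auto)
    have fK: "finite K" unfolding K_def using F(1) by simp
    have KS: "K \<subseteq> S" unfolding K_def using s by auto
    have "x \<in> (\<Union>x\<in>K. metric.mball x e)" if x: "x \<in> S" for x
    proof -
      obtain y where y: "y \<in> F" "nrm V (x \<ominus> y) < e / 2" using F(3) x by auto
      have c: "x \<in> carrier V" "y \<in> carrier V" "s y \<in> carrier V" 
        using x y(1) SV F(2) s[OF x y(2)] by auto
      have "nrm V (s y \<ominus> x) < e"
        using nrm_triangle_minus[of "s y" y x] s[OF x y(2)] y(2) nrm_minus_commute[of x y] c by simp
      moreover have "s y \<in> K" unfolding K_def using x y by blast
      moreover have "x \<in> metric.mball (s y) e" if "nrm V (s y \<ominus> x) < e"
        using c that by (simp add: nrm_dist_def metric.mball_def)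
      ultimately show ?thesis by blast
    qed
    then have "S \<subseteq> (\<Union>x\<in>K. metric.mball x e)" by (rule subsetI)
    with fK KS show "\<exists>K. finite K \<and> K \<subseteq> S \<and> S \<subseteq> (\<Union>x\<in>K. metric.mball x e)"
      by (intro exI[of _ K] conjI)
  qed
qed

end

lemma complex_space_simps [simp]:
  "carrier complex_space = UNIV" "\<zero>\<^bsub>complex_space\<^esub> = 0" "(x \<oplus>\<^bsub>complex_space\<^esub> y) = x + y"
  "c \<odot>\<^bsub>complex_space\<^esub> x = c * x" "nrm complex_space = cmod"
  by (simp_all add: complex_space_def)

lemma complex_normed_space_complex: "complex_normed_space complex_space"
  by (rule complex_normed_spaceI) (auto simp: algebra_simps norm_mult norm_triangle_ineq)

lemma zero_in_unit_ball: "complex_normed_space V \<Longrightarrow> \<zero>\<^bsub>V\<^esub> \<in> closed_unit_ball V"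
proof -
  assume "complex_normed_space V"
  then interpret complex_normed_space V .
  show ?thesis by (simp add: closed_unit_ball_def)
qed

section \<open>Bounded operators\<close>

lemma closed_unit_ballD: "x \<in> closed_unit_ball V \<Longrightarrow> x \<in> carrier V" "x \<in> closed_unit_ball V \<Longrightarrow> nrm V x \<le> 1"
  by (auto simp: closed_unit_ball_def)

lemma bounded_ops_linear: "T \<in> bounded_ops V W \<Longrightarrow> T \<in> linear_maps V W"
  by (simp add: bounded_ops_def)

lemma linear_mapsI:
  assumes "T \<in> extensional (carrier V)" "\<And>x. x \<in> carrier V \<Longrightarrow> T x \<in> carrier W"
    and "\<And>x y. x \<in> carrier V \<Longrightarrow> y \<in> carrier V \<Longrightarrow> T (x \<oplus>\<^bsub>V\<^esub> y) = T x \<oplus>\<^bsub>W\<^esub> T y"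
    and "\<And>c x. x \<in> carrier V \<Longrightarrow> T (c \<odot>\<^bsub>V\<^esub> x) = c \<odot>\<^bsub>W\<^esub> T x"
  shows "T \<in> linear_maps V W"
  using assms by (auto simp: linear_maps_def PiE_def)

locale normed_space_pair = V: complex_normed_space V + W: complex_normed_space W
  for V :: "('a, 'c) cnormed_scheme" and W :: "('b, 'd) cnormed_scheme"
begin

context
  fixes T assumes T: "T \<in> linear_maps V W"
begin

lemma linear_closed: "x \<in> carrier V \<Longrightarrow> T x \<in> carrier W"
  and linear_add: "x \<in> carrier V \<Longrightarrow> y \<in> carrier V \<Longrightarrow> T (x \<oplus>\<^bsub>V\<^esub> y) = T x \<oplus>\<^bsub>W\<^esub> T y"
  and linear_smult: "x \<in> carrier V \<Longrightarrow> T (c \<odot>\<^bsub>V\<^esub> x) = c \<odot>\<^bsub>W\<^esub> T x"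
  and linear_extensional: "T \<in> extensional (carrier V)"
  using T by (auto simp: linear_maps_def PiE_def)

lemma linear_minus: "x \<in> carrier V \<Longrightarrow> y \<in> carrier V \<Longrightarrow> T (x \<ominus>\<^bsub>V\<^esub> y) = T x \<ominus>\<^bsub>W\<^esub> T y"
  by (simp add: V.minus_eq_smult W.minus_eq_smult linear_closed linear_add linear_smult)

lemma linear_zero: "T \<zero>\<^bsub>V\<^esub> = \<zero>\<^bsub>W\<^esub>"
  using linear_smult[of "\<zero>\<^bsub>V\<^esub>" 0] by (simp add: linear_closed)

end

lemma bounded_opsI:
  assumes "T \<in> linear_maps V W" "\<And>x. x \<in> carrier V \<Longrightarrow> nrm W (T x) \<le> K * nrm V x"
  shows "T \<in> bounded_ops V W"
  using assms by (auto simp: bounded_ops_def)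

lemma bounded_opsE:
  assumes "T \<in> bounded_ops V W"
  obtains K where "K \<ge> 0" "\<And>x. x \<in> carrier V \<Longrightarrow> nrm W (T x) \<le> K * nrm V x"
proof -
  obtain K where K: "\<And>x. x \<in> carrier V \<Longrightarrow> nrm W (T x) \<le> K * nrm V x"
    using assms by (auto simp: bounded_ops_def)
  have "nrm W (T x) \<le> max K 0 * nrm V x" if "x \<in> carrier V" for x
    using K[OF that] mult_right_mono[of K "max K 0" "nrm V x"] that by (auto intro: order_trans)
  then show ?thesis using that[of "max K 0"] by auto
qed

lemma bdd_above_op_norm:
  assumes "T \<in> bounded_ops V W"
  shows "bdd_above ((\<lambda>x. nrm W (T x)) ` closed_unit_ball V)"
proof -
  obtain K where K: "K \<ge> 0" "\<And>x. x \<in> carrier V \<Longrightarrow> nrm W (T x) \<le> K * nrm V x"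
    using bounded_opsE[OF assms] by metis
  have "nrm W (T x) \<le> K" if "x \<in> closed_unit_ball V" for x
    using K(2)[of x] mult_left_mono[of "nrm V x" 1 K] K(1) closed_unit_ballD[OF that] by simp
  then show ?thesis by (auto intro!: bdd_aboveI2)
qed

lemma op_norm_upper:
  assumes "T \<in> bounded_ops V W" "x \<in> closed_unit_ball V"
  shows "nrm W (T x) \<le> op_norm V W T"
  unfolding op_norm_def by (rule cSUP_upper[OF assms(2) bdd_above_op_norm[OF assms(1)]])

lemma op_norm_le:
  assumes "\<And>x. x \<in> closed_unit_ball V \<Longrightarrow> nrm W (T x) \<le> B"
  shows "op_norm V W T \<le> B"
  unfolding op_norm_def using zero_in_unit_ball[OF V.complex_normed_space_axioms]
  by (intro cSUP_least) (auto simp: assms)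

lemma op_norm_nonneg:
  assumes "T \<in> bounded_ops V W"
  shows "0 \<le> op_norm V W T"
  using op_norm_upper[OF assms zero_in_unit_ball[OF V.complex_normed_space_axioms]]
    linear_zero[OF bounded_ops_linear[OF assms]] by simp

lemma nrm_op_le:
  assumes T: "T \<in> bounded_ops V W" and x: "x \<in> carrier V"
  shows "nrm W (T x) \<le> op_norm V W T * nrm V x"
proof (cases "nrm V x = 0")
  case True
  then have "x = \<zero>\<^bsub>V\<^esub>" using V.nrm_eq_0_iff x by simp
  then show ?thesis using linear_zero[OF bounded_ops_linear[OF T]] by simp
next
  case False
  then have pos: "nrm V x > 0" using V.nrm_nonneg[OF x] by simp
  define c where "c = complex_of_real (1 / nrm V x)"
  have c: "cmod c = 1 / nrm V x" using pos by (simp add: c_def norm_divide)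
  have "c \<odot>\<^bsub>V\<^esub> x \<in> closed_unit_ball V"
    using x pos by (simp add: closed_unit_ball_def V.nrm_smult c)
  from op_norm_upper[OF T this] show ?thesis
    using linear_smult[OF bounded_ops_linear[OF T] x, of c] linear_closed[OF bounded_ops_linear[OF T] x]
    by (simp add: W.nrm_smult c) (use pos in \<open>simp add: field_simps\<close>)
qed

lemma op_norm_less_exists:
  assumes "T \<in> bounded_ops V W" "c < op_norm V W T"
  shows "\<exists>x\<in>closed_unit_ball V. c < nrm W (T x)"
  using assms(2) less_cSUP_iff[OF _ bdd_above_op_norm[OF assms(1)], of c]
    zero_in_unit_ball[OF V.complex_normed_space_axioms] unfolding op_norm_def by blast

lemma op_norm_le_mult:
  assumes "T \<in> linear_maps V W" "K \<ge> 0" "\<And>x. x \<in> carrier V \<Longrightarrow> nrm W (T x) \<le> K * nrm V x"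
  shows "op_norm V W T \<le> K"
proof (rule op_norm_le)
  fix x assume x: "x \<in> closed_unit_ball V"
  then show "nrm W (T x) \<le> K"
    using assms(3)[of x] mult_left_mono[OF _ assms(2), of "nrm V x" 1] closed_unit_ballD[OF x] by simp
qed

lemma op_norm_eq_0_iff:
  assumes T: "T \<in> bounded_ops V W"
  shows "op_norm V W T = 0 \<longleftrightarrow> (\<forall>x\<in>carrier V. T x = \<zero>\<^bsub>W\<^esub>)"
proof
  assume *: "op_norm V W T = 0"
  show "\<forall>x\<in>carrier V. T x = \<zero>\<^bsub>W\<^esub>"
  proof
    fix x assume x: "x \<in> carrier V"
    have Tx: "T x \<in> carrier W" using linear_closed[OF bounded_ops_linear[OF T] x] .
    have "nrm W (T x) \<le> 0" using nrm_op_le[OF T x] * by simp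
    then have "nrm W (T x) = 0" using W.nrm_nonneg[OF Tx] by linarith
    then show "T x = \<zero>\<^bsub>W\<^esub>" using W.nrm_eq_0_iff[OF Tx] by simp
  qed
next
  assume *: "\<forall>x\<in>carrier V. T x = \<zero>\<^bsub>W\<^esub>"
  have "op_norm V W T \<le> 0" 
    by (rule op_norm_le) (use * in \<open>simp add: closed_unit_ball_def\<close>)
  then show "op_norm V W T = 0" using op_norm_nonneg[OF T] by simp
qed

end

section \<open>Bounded operators as a normed algebra\<close>

lemma op_algebra_simps [simp]:
  "carrier (op_algebra V) = bounded_ops V V"
  "(S \<otimes>\<^bsub>op_algebra V\<^esub> T) = compose (carrier V) S T"
  "\<zero>\<^bsub>op_algebra V\<^esub> = (\<lambda>x\<in>carrier V. \<zero>\<^bsub>V\<^esub>)"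
  "(S \<oplus>\<^bsub>op_algebra V\<^esub> T) = (\<lambda>x\<in>carrier V. S x \<oplus>\<^bsub>V\<^esub> T x)"
  "c \<odot>\<^bsub>op_algebra V\<^esub> T = (\<lambda>x\<in>carrier V. c \<odot>\<^bsub>V\<^esub> T x)"
  "nrm (op_algebra V) = op_norm V V"
  by (simp_all add: op_algebra_def)

context complex_normed_space
begin

lemma self_pair: "normed_space_pair V V"
  by (simp add: normed_space_pair_def complex_normed_space_axioms)

sublocale op: normed_space_pair V V by (rule self_pair)

lemma op_closed: "T \<in> bounded_ops V V \<Longrightarrow> x \<in> carrier V \<Longrightarrow> T x \<in> carrier V"
  using op.linear_closed bounded_ops_linear by metis

lemma add_op_closed:
  assumes S: "S \<in> bounded_ops V V" and T: "T \<in> bounded_ops V V"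
  shows "(\<lambda>x\<in>carrier V. S x \<oplus> T x) \<in> bounded_ops V V"
proof -
  note lS = bounded_ops_linear[OF S] and lT = bounded_ops_linear[OF T]
  show ?thesis
  proof (rule op.bounded_opsI[where K = "op_norm V V S + op_norm V V T"])
    show "(\<lambda>x\<in>carrier V. S x \<oplus> T x) \<in> linear_maps V V"
      by (rule linear_mapsI)
         (simp_all add: op.linear_closed[OF lS] op.linear_closed[OF lT] op.linear_add[OF lS] op.linear_add[OF lT]
            op.linear_smult[OF lS] op.linear_smult[OF lT] smult_add_right a_ac)
    show "nrm V ((\<lambda>x\<in>carrier V. S x \<oplus> T x) x) \<le> (op_norm V V S + op_norm V V T) * nrm V x"
      if x: "x \<in> carrier V" for x
      using nrm_triangle[OF op_closed[OF S x] op_closed[OF T x]] op.nrm_op_le[OF S x] op.nrm_op_le[OF T x] x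
      by (simp add: algebra_simps)
  qed
qed

lemma op_norm_add:
  assumes S: "S \<in> bounded_ops V V" and T: "T \<in> bounded_ops V V"
  shows "op_norm V V (\<lambda>x\<in>carrier V. S x \<oplus> T x) \<le> op_norm V V S + op_norm V V T"
proof (rule op.op_norm_le)
  fix x assume x: "x \<in> closed_unit_ball V"
  then show "nrm V ((\<lambda>x\<in>carrier V. S x \<oplus> T x) x) \<le> op_norm V V S + op_norm V V T"
    using nrm_triangle[of "S x" "T x"] op_closed[OF S] op_closed[OF T] op.op_norm_upper[OF S x]
      op.op_norm_upper[OF T x] closed_unit_ballD[OF x] by simp
qed

lemma smult_op_closed:
  assumes S: "S \<in> bounded_ops V V"
  shows "(\<lambda>x\<in>carrier V. c \<odot> S x) \<in> bounded_ops V V"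
proof -
  note lS = bounded_ops_linear[OF S]
  show ?thesis
  proof (rule op.bounded_opsI[where K = "cmod c * op_norm V V S"])
    show "(\<lambda>x\<in>carrier V. c \<odot> S x) \<in> linear_maps V V"
      by (rule linear_mapsI)
         (simp_all add: op.linear_closed[OF lS] op.linear_add[OF lS] op.linear_smult[OF lS] smult_add_right
          mult.commute flip: smult_mult)
    show "nrm V ((\<lambda>x\<in>carrier V. c \<odot> S x) x) \<le> (cmod c * op_norm V V S) * nrm V x"
      if x: "x \<in> carrier V" for x
      using mult_left_mono[OF op.nrm_op_le[OF S x], of "cmod c"] x op_closed[OF S x]
      by (simp add: nrm_smult mult.assoc)
  qed
qed

lemma op_norm_smult:
  assumes S: "S \<in> bounded_ops V V"
  shows "op_norm V V (\<lambda>x\<in>carrier V. c \<odot> S x) = cmod c * op_norm V V S"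
proof (rule antisym)
  have *: "op_norm V V (\<lambda>x\<in>carrier V. d \<odot> S x) \<le> cmod d * op_norm V V S" if S: "S \<in> bounded_ops V V" for d S
  proof (rule op.op_norm_le)
    fix x assume x: "x \<in> closed_unit_ball V"
    then show "nrm V ((\<lambda>x\<in>carrier V. d \<odot> S x) x) \<le> cmod d * op_norm V V S"
      using op_closed[OF S] op.op_norm_upper[OF S x] closed_unit_ballD[OF x]
      by (simp add: nrm_smult mult_left_mono)
  qed
  from *[OF S] show "op_norm V V (\<lambda>x\<in>carrier V. c \<odot> S x) \<le> cmod c * op_norm V V S" .
  show "cmod c * op_norm V V S \<le> op_norm V V (\<lambda>x\<in>carrier V. c \<odot> S x)"
  proof (cases "c = 0")
    case True
    then show ?thesis using op.op_norm_nonneg[OF smult_op_closed[OF S]] by simp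
  next
    case False
    \<comment> \<open>The reverse inequality is the first one, applied to the multiple of
      \<open>S\<close> by \<open>c\<close> and to the scalar \<open>1 / c\<close>.\<close>
    have "(\<lambda>x\<in>carrier V. (1 / c) \<odot> (\<lambda>x\<in>carrier V. c \<odot> S x) x) = S"
      using False op_closed[OF S] op.linear_extensional[OF bounded_ops_linear[OF S]]
      by (intro ext) (auto simp: restrict_def extensional_def simp flip: smult_mult)
    with *[OF smult_op_closed[OF S, of c], of "1 / c"] False show ?thesis
      by (simp add: norm_divide field_simps)
  qed
qed

lemma compose_op_closed:
  assumes S: "S \<in> bounded_ops V V" and T: "T \<in> bounded_ops V V"
  shows "compose (carrier V) S T \<in> bounded_ops V V"
proof -
  note lS = bounded_ops_linear[OF S] and lT = bounded_ops_linear[OF T]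
  show ?thesis
  proof (rule op.bounded_opsI[where K = "op_norm V V S * op_norm V V T"])
    show "compose (carrier V) S T \<in> linear_maps V V"
      by (rule linear_mapsI)
         (simp_all add: compose_def op.linear_closed[OF lS] op.linear_closed[OF lT] op.linear_add[OF lS] op.linear_add[OF lT]
            op.linear_smult[OF lS] op.linear_smult[OF lT])
    show "nrm V (compose (carrier V) S T x) \<le> (op_norm V V S * op_norm V V T) * nrm V x"
      if x: "x \<in> carrier V" for x
      using op.nrm_op_le[OF S op_closed[OF T x]] mult_left_mono[OF op.nrm_op_le[OF T x] op.op_norm_nonneg[OF S]] x
      by (simp add: compose_def mult.assoc)
  qed
qed

lemma op_norm_compose:
  assumes S: "S \<in> bounded_ops V V" and T: "T \<in> bounded_ops V V"
  shows "op_norm V V (compose (carrier V) S T) \<le> op_norm V V S * op_norm V V T"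
proof (rule op.op_norm_le)
  fix x assume x: "x \<in> closed_unit_ball V"
  then show "nrm V (compose (carrier V) S T x) \<le> op_norm V V S * op_norm V V T"
    using op.nrm_op_le[OF S op_closed[OF T]] mult_left_mono[OF op.op_norm_upper[OF T x] op.op_norm_nonneg[OF S]]
      closed_unit_ballD[OF x]
    by (simp add: compose_def) (meson order_trans)
qed

lemma op_algebra_normed: "complex_normed_space (op_algebra V)"
proof (rule complex_normed_spaceI)
  show "\<zero>\<^bsub>op_algebra V\<^esub> \<in> carrier (op_algebra V)"
    by (auto intro!: op.bounded_opsI[where K = 0] linear_mapsI)
  show "(nrm (op_algebra V) T = 0) = (T = \<zero>\<^bsub>op_algebra V\<^esub>)" if "T \<in> carrier (op_algebra V)" for T
    using that op.linear_extensional[OF bounded_ops_linear, of T]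
    by (auto simp: op.op_norm_eq_0_iff extensional_def fun_eq_iff)
qed (simp add: add_op_closed smult_op_closed op_norm_add op_norm_smult;
    auto simp: fun_eq_iff restrict_def op_closed a_ac
      smult_mult smult_add_left smult_add_right op.linear_extensional[OF bounded_ops_linear, THEN extensional_arb])+

lemma op_minus_apply:
  assumes "S \<in> bounded_ops V V" "T \<in> bounded_ops V V" "x \<in> carrier V"
  shows "(S \<ominus>\<^bsub>op_algebra V\<^esub> T) x = S x \<ominus> T x"
  using complex_normed_space.minus_eq_smult[OF op_algebra_normed, of S T] assms
  by (simp add: minus_eq_smult op_closed)

lemma op_minus_closed:
  assumes "S \<in> bounded_ops V V" "T \<in> bounded_ops V V"
  shows "S \<ominus>\<^bsub>op_algebra V\<^esub> T \<in> bounded_ops V V"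
  using complex_normed_space.minus_cl[OF op_algebra_normed, of S T] assms by simp

end

section \<open>Completeness of the operator algebra\<close>

context complex_normed_space
begin

lemma mcompleteD:
  fixes \<sigma> :: "nat \<Rightarrow> 'a"
  assumes "metric.mcomplete" "range \<sigma> \<subseteq> carrier V"
    and "\<And>e. e > 0 \<Longrightarrow> \<exists>N. \<forall>m\<ge>N. \<forall>n\<ge>N. nrm V (\<sigma> m \<ominus> \<sigma> n) < e"
  obtains l where "l \<in> carrier V" "\<And>e. e > 0 \<Longrightarrow> \<exists>N. \<forall>n\<ge>N. nrm V (\<sigma> n \<ominus> l) < e"
  using assms(1)[unfolded mcomplete_iff, rule_format, OF conjI[OF assms(2)]] assms(3) that by auto

text \<open>Limits exist pointwise because \<open>V\<close> is complete. Letting one index of the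
  Cauchy estimate tend to infinity at each point (\<open>close\<close> below) gives both the
  boundedness of the limit and the convergence in operator norm.\<close>

lemma op_algebra_complete:
  assumes complete: "metric.mcomplete"
  shows "Metric_space.mcomplete (carrier (op_algebra V)) (nrm_dist (op_algebra V))"
proof -
  interpret O: complex_normed_space "op_algebra V" by (rule op_algebra_normed)
  show ?thesis
    unfolding O.mcomplete_iff
  proof (intro allI impI, elim conjE)
    fix \<sigma> :: "nat \<Rightarrow> 'a \<Rightarrow> 'a"
    assume "range \<sigma> \<subseteq> carrier (op_algebra V)"
    then have \<sigma>: "\<sigma> n \<in> bounded_ops V V" for n by auto
    note l\<sigma> = bounded_ops_linear[OF \<sigma>]
    assume cauchy: "\<forall>e>0. \<exists>N. \<forall>m\<ge>N. \<forall>n\<ge>N. nrm (op_algebra V) (\<sigma> m \<ominus>\<^bsub>op_algebra V\<^esub> \<sigma> n) < e"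
    have diff: "nrm V (\<sigma> m x \<ominus> \<sigma> n x) \<le> op_norm V V (\<sigma> m \<ominus>\<^bsub>op_algebra V\<^esub> \<sigma> n) * nrm V x"
      if "x \<in> carrier V" for m n x
      using op.nrm_op_le[OF op_minus_closed[OF \<sigma> \<sigma>] that] op_minus_apply[OF \<sigma> \<sigma> that] by simp
    have "\<exists>l\<in>carrier V. \<forall>e>0. \<exists>N. \<forall>n\<ge>N. nrm V (\<sigma> n x \<ominus> l) < e" if x: "x \<in> carrier V" for x
    proof -
      have "\<exists>N. \<forall>m\<ge>N. \<forall>n\<ge>N. nrm V (\<sigma> m x \<ominus> \<sigma> n x) < e" if e: "e > 0" for e
      proof -
        have p: "0 < nrm V x + 1" using nrm_nonneg[OF x] by linarith
        obtain N where N: "\<forall>m\<ge>N. \<forall>n\<ge>N. op_norm V V (\<sigma> m \<ominus>\<^bsub>op_algebra V\<^esub> \<sigma> n) < e / (nrm V x + 1)"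
          using cauchy[rule_format, of "e / (nrm V x + 1)"] e p by auto
        have "nrm V (\<sigma> m x \<ominus> \<sigma> n x) < e" if "m \<ge> N" "n \<ge> N" for m n
        proof -
          have "nrm V (\<sigma> m x \<ominus> \<sigma> n x) \<le> e / (nrm V x + 1) * nrm V x"
            using diff[OF x, of m n] N that mult_right_mono[OF less_imp_le nrm_nonneg[OF x]] by (meson order_trans)
          also have "\<dots> < e" using e p by (simp add: field_simps)
          finally show ?thesis .
        qed
        then show ?thesis by blast
      qed
      then obtain l where "l \<in> carrier V" "\<And>e. e > 0 \<Longrightarrow> \<exists>N. \<forall>n\<ge>N. nrm V (\<sigma> n x \<ominus> l) < e"
        using mcompleteD[OF complete, of "\<lambda>n. \<sigma> n x"] op_closed[OF \<sigma> x] by (metis (no_types, lifting) image_subsetI)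
      then show ?thesis by (intro bexI[of _ l] allI impI)
    qed
    then obtain L where L: "\<And>x. x \<in> carrier V \<Longrightarrow> L x \<in> carrier V"
      and lim: "\<And>x e. x \<in> carrier V \<Longrightarrow> e > 0 \<Longrightarrow> \<exists>N. \<forall>n\<ge>N. nrm V (\<sigma> n x \<ominus> L x) < e"
      by metis
    define T where "T = restrict L (carrier V)"
    have T: "T x \<in> carrier V" "e > 0 \<Longrightarrow> \<exists>N. \<forall>n\<ge>N. nrm V (\<sigma> n x \<ominus> T x) < e"
      if "x \<in> carrier V" for x e
      using that L lim by (auto simp: T_def)
    have unique: "l = l'"
      if "l \<in> carrier V" "l' \<in> carrier V" "\<And>e. e > 0 \<Longrightarrow> nrm V (l \<ominus> l') < e" for l l'
    proof -
      have "nrm V (l \<ominus> l') \<le> 0" using that(3)[of "nrm V (l \<ominus> l')"] by linarith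
      then have "nrm V (l \<ominus> l') = 0" using nrm_nonneg[OF minus_cl[OF that(1,2)]] by linarith
      then show ?thesis using nrm_eq_0_iff[OF minus_cl[OF that(1,2)]] minus_eq_zero_iff[OF that(1,2)] by simp
    qed
    have linT: "T \<in> linear_maps V V"
    proof (rule linear_mapsI)
      show "T \<in> extensional (carrier V)" by (simp add: T_def)
      show "T x \<in> carrier V" if "x \<in> carrier V" for x using T that by blast
      fix x y assume xy: "x \<in> carrier V" "y \<in> carrier V"
      show "T (x \<oplus> y) = T x \<oplus> T y"
      proof (rule unique)
        fix e :: real assume "e > 0"
        then have e: "e / 3 > 0" by simp
        obtain N1 where N1: "\<forall>n\<ge>N1. nrm V (\<sigma> n x \<ominus> T x) < e / 3" using T(2)[OF xy(1) e] by blast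
        obtain N2 where N2: "\<forall>n\<ge>N2. nrm V (\<sigma> n y \<ominus> T y) < e / 3" using T(2)[OF xy(2) e] by blast
        obtain N3 where N3: "\<forall>n\<ge>N3. nrm V (\<sigma> n (x \<oplus> y) \<ominus> T (x \<oplus> y)) < e / 3"
          using T(2)[of "x \<oplus> y", OF _ e] xy by auto
        define n where "n = max N1 (max N2 N3)"
        have n: "nrm V (\<sigma> n x \<ominus> T x) < e / 3" "nrm V (\<sigma> n y \<ominus> T y) < e / 3"
          "nrm V (T (x \<oplus> y) \<ominus> \<sigma> n (x \<oplus> y)) < e / 3"
          using N1 N2 N3 xy by (auto simp: n_def nrm_minus_commute T op_closed[OF \<sigma>])
        have "nrm V (T (x \<oplus> y) \<ominus> (T x \<oplus> T y))
            \<le> nrm V (T (x \<oplus> y) \<ominus> \<sigma> n (x \<oplus> y)) + nrm V (\<sigma> n (x \<oplus> y) \<ominus> (T x \<oplus> T y))"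
          by (rule nrm_triangle_minus) (auto simp: xy T op_closed[OF \<sigma>])
        also have "\<sigma> n (x \<oplus> y) \<ominus> (T x \<oplus> T y) = (\<sigma> n x \<ominus> T x) \<oplus> (\<sigma> n y \<ominus> T y)"
          using xy by (simp add: op.linear_add[OF l\<sigma>] add_diff_add T op_closed[OF \<sigma>])
        also have "nrm V \<dots> \<le> nrm V (\<sigma> n x \<ominus> T x) + nrm V (\<sigma> n y \<ominus> T y)"
          by (rule nrm_triangle) (auto simp: xy T op_closed[OF \<sigma>])
        finally show "nrm V (T (x \<oplus> y) \<ominus> (T x \<oplus> T y)) < e" using n by linarith
      qed (auto simp: xy T)
    next
      fix c x assume x: "x \<in> carrier V"
      show "T (c \<odot> x) = c \<odot> T x"
      proof (rule unique)
        fix e :: real assume e: "e > 0"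
        have cp: "cmod c + 1 > 0" by (simp add: add_nonneg_pos)
        have e2: "e / (2 * (cmod c + 1)) > 0" using e cp by simp
        obtain N1 where N1: "\<forall>n\<ge>N1. nrm V (\<sigma> n x \<ominus> T x) < e / (2 * (cmod c + 1))" using T(2)[OF x e2] by blast
        obtain N2 where N2: "\<forall>n\<ge>N2. nrm V (\<sigma> n (c \<odot> x) \<ominus> T (c \<odot> x)) < e / 2"
          using T(2)[of "c \<odot> x" "e / 2"] x e by auto
        define n where "n = max N1 N2"
        have n: "nrm V (\<sigma> n x \<ominus> T x) < e / (2 * (cmod c + 1))" "nrm V (T (c \<odot> x) \<ominus> \<sigma> n (c \<odot> x)) < e / 2"
          using N1 N2 x by (auto simp: n_def nrm_minus_commute T op_closed[OF \<sigma>])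
        have "nrm V (T (c \<odot> x) \<ominus> c \<odot> T x)
            \<le> nrm V (T (c \<odot> x) \<ominus> \<sigma> n (c \<odot> x)) + nrm V (\<sigma> n (c \<odot> x) \<ominus> c \<odot> T x)"
          by (rule nrm_triangle_minus) (auto simp: x T op_closed[OF \<sigma>])
        also have "\<sigma> n (c \<odot> x) \<ominus> c \<odot> T x = c \<odot> (\<sigma> n x \<ominus> T x)"
          using x by (simp add: op.linear_smult[OF l\<sigma>] smult_minus_right T op_closed[OF \<sigma>])
        also have "nrm V \<dots> = cmod c * nrm V (\<sigma> n x \<ominus> T x)"
          by (rule nrm_smult) (auto simp: x T op_closed[OF \<sigma>])
        also have "\<dots> \<le> (cmod c + 1) * (e / (2 * (cmod c + 1)))"
          using n(1) by (intro mult_mono) (auto simp: x T op_closed[OF \<sigma>])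
        also have "\<dots> = e / 2" using cp by (simp add: field_simps)
        finally show "nrm V (T (c \<odot> x) \<ominus> c \<odot> T x) < e" using n(2) by linarith
      qed (auto simp: x T)
    qed
    have close: "nrm V (\<sigma> n x \<ominus> T x) \<le> e * nrm V x"
      if x: "x \<in> carrier V" and e: "e > 0"
        and N: "\<forall>m\<ge>N. \<forall>n\<ge>N. op_norm V V (\<sigma> m \<ominus>\<^bsub>op_algebra V\<^esub> \<sigma> n) < e" and n: "n \<ge> N" for x e N n
    proof (rule field_le_epsilon)
      fix d :: real assume "d > 0"
      then obtain N' where N': "\<forall>m\<ge>N'. nrm V (\<sigma> m x \<ominus> T x) < d" using T(2)[OF x] by blast
      define m where "m = max N N'"
      have "nrm V (\<sigma> n x \<ominus> T x) \<le> nrm V (\<sigma> n x \<ominus> \<sigma> m x) + nrm V (\<sigma> m x \<ominus> T x)"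
        by (rule nrm_triangle_minus) (auto simp: x T op_closed[OF \<sigma>])
      moreover have "nrm V (\<sigma> n x \<ominus> \<sigma> m x) \<le> e * nrm V x"
      proof -
        have "op_norm V V (\<sigma> n \<ominus>\<^bsub>op_algebra V\<^esub> \<sigma> m) \<le> e" using N n by (simp add: m_def less_imp_le)
        then show ?thesis using diff[OF x, of n m] mult_right_mono[OF _ nrm_nonneg[OF x]] by (meson order_trans)
      qed
      moreover have "nrm V (\<sigma> m x \<ominus> T x) < d" using N' by (simp add: m_def)
      ultimately show "nrm V (\<sigma> n x \<ominus> T x) \<le> e * nrm V x + d" by linarith
    qed
    obtain N where N: "\<forall>m\<ge>N. \<forall>n\<ge>N. op_norm V V (\<sigma> m \<ominus>\<^bsub>op_algebra V\<^esub> \<sigma> n) < 1"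
      using cauchy[rule_format, of 1] by auto
    have bT: "T \<in> bounded_ops V V"
    proof (rule op.bounded_opsI[OF linT, where K = "op_norm V V (\<sigma> N) + 1"])
      fix x assume x: "x \<in> carrier V"
      have "nrm V (T x) \<le> nrm V (T x \<ominus> \<sigma> N x) + nrm V (\<sigma> N x)"
        by (rule nrm_le_minus) (auto simp: x T op_closed[OF \<sigma>])
      then show "nrm V (T x) \<le> (op_norm V V (\<sigma> N) + 1) * nrm V x"
        using close[OF x _ N order_refl] op.nrm_op_le[OF \<sigma>[of N] x] nrm_minus_commute[of "T x" "\<sigma> N x"]
        by (simp add: x T op_closed[OF \<sigma>] algebra_simps)
    qed
    show "\<exists>l\<in>carrier (op_algebra V). \<forall>e>0. \<exists>N. \<forall>n\<ge>N. nrm (op_algebra V) (\<sigma> n \<ominus>\<^bsub>op_algebra V\<^esub> l) < e"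
    proof (intro bexI[of _ T] allI impI)
      fix e :: real assume e: "e > 0"
      then obtain N where N: "\<forall>m\<ge>N. \<forall>n\<ge>N. op_norm V V (\<sigma> m \<ominus>\<^bsub>op_algebra V\<^esub> \<sigma> n) < e / 2"
        using cauchy[rule_format, of "e / 2"] by auto
      have "op_norm V V (\<sigma> n \<ominus>\<^bsub>op_algebra V\<^esub> T) < e" if "n \<ge> N" for n
      proof -
        have "op_norm V V (\<sigma> n \<ominus>\<^bsub>op_algebra V\<^esub> T) \<le> e / 2"
          using close[OF _ _ N that] e
          by (intro op.op_norm_le_mult bounded_ops_linear[OF op_minus_closed[OF \<sigma> bT]])
             (auto simp: op_minus_apply[OF \<sigma> bT])
        then show ?thesis using e by simp
      qed
      then show "\<exists>N. \<forall>n\<ge>N. nrm (op_algebra V) (\<sigma> n \<ominus>\<^bsub>op_algebra V\<^esub> T) < e" by auto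
    qed (use bT in simp)
  qed
qed

lemma op_algebra_banach:
  assumes "metric.mcomplete"
  shows "complex_banach_algebra (op_algebra V)"
proof -
  interpret O: complex_normed_space "op_algebra V" by (rule op_algebra_normed)
  show ?thesis
  proof
    show "Metric_space.mcomplete (carrier (op_algebra V)) (nrm_dist (op_algebra V))"
      by (rule op_algebra_complete[OF assms])
    fix R S T :: "'a \<Rightarrow> 'a" and c :: complex
    assume R: "R \<in> carrier (op_algebra V)" and S: "S \<in> carrier (op_algebra V)"
    then have R': "R \<in> bounded_ops V V" and S': "S \<in> bounded_ops V V" by auto
    show "R \<otimes>\<^bsub>op_algebra V\<^esub> S \<in> carrier (op_algebra V)"
      using compose_op_closed[OF R' S'] by simp
    show "nrm (op_algebra V) (R \<otimes>\<^bsub>op_algebra V\<^esub> S) \<le> nrm (op_algebra V) R * nrm (op_algebra V) S"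
      using op_norm_compose[OF R' S'] by simp
    show "(c \<odot>\<^bsub>op_algebra V\<^esub> R) \<otimes>\<^bsub>op_algebra V\<^esub> S = c \<odot>\<^bsub>op_algebra V\<^esub> (R \<otimes>\<^bsub>op_algebra V\<^esub> S)"
      by (auto simp: fun_eq_iff compose_def op_closed[OF S'])
    show "R \<otimes>\<^bsub>op_algebra V\<^esub> (c \<odot>\<^bsub>op_algebra V\<^esub> S) = c \<odot>\<^bsub>op_algebra V\<^esub> (R \<otimes>\<^bsub>op_algebra V\<^esub> S)"
      by (auto simp: fun_eq_iff compose_def op_closed[OF S'] op.linear_smult[OF bounded_ops_linear[OF R']])
    assume "T \<in> carrier (op_algebra V)"
    then have T': "T \<in> bounded_ops V V" by simp
    show "(R \<otimes>\<^bsub>op_algebra V\<^esub> S) \<otimes>\<^bsub>op_algebra V\<^esub> T = R \<otimes>\<^bsub>op_algebra V\<^esub> (S \<otimes>\<^bsub>op_algebra V\<^esub> T)"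
      by (auto simp: fun_eq_iff compose_def op_closed[OF T'])
    show "(R \<oplus>\<^bsub>op_algebra V\<^esub> S) \<otimes>\<^bsub>op_algebra V\<^esub> T =
        (R \<otimes>\<^bsub>op_algebra V\<^esub> T) \<oplus>\<^bsub>op_algebra V\<^esub> (S \<otimes>\<^bsub>op_algebra V\<^esub> T)"
      by (auto simp: fun_eq_iff compose_def op_closed[OF T'])
    show "R \<otimes>\<^bsub>op_algebra V\<^esub> (S \<oplus>\<^bsub>op_algebra V\<^esub> T) =
        (R \<otimes>\<^bsub>op_algebra V\<^esub> S) \<oplus>\<^bsub>op_algebra V\<^esub> (R \<otimes>\<^bsub>op_algebra V\<^esub> T)"
      by (auto simp: fun_eq_iff compose_def op_closed[OF T'] op_closed[OF S'] op.linear_add[OF bounded_ops_linear[OF R']])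
  qed
qed

end

section \<open>Compact operators\<close>

lemma norm_closed_subalgebraD:
  assumes "complex_banach_algebra A" "norm_closed_subalgebra S A"
  shows "S \<subseteq> carrier A" "\<zero>\<^bsub>A\<^esub> \<in> S" "x \<in> S \<Longrightarrow> y \<in> S \<Longrightarrow> x \<oplus>\<^bsub>A\<^esub> y \<in> S" "x \<in> S \<Longrightarrow> c \<odot>\<^bsub>A\<^esub> x \<in> S"
    "x \<in> S \<Longrightarrow> y \<in> S \<Longrightarrow> x \<otimes>\<^bsub>A\<^esub> y \<in> S"
proof -
  interpret complex_banach_algebra A by fact
  have sub: "submodule S complex_ring A" using assms(2) by (simp add: norm_closed_subalgebra_def)
  note E = submoduleE[OF sub]
  show "S \<subseteq> carrier A" and sm: "x \<in> S \<Longrightarrow> c \<odot>\<^bsub>A\<^esub> x \<in> S" for c x using E by auto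
  show "x \<in> S \<Longrightarrow> y \<in> S \<Longrightarrow> x \<oplus>\<^bsub>A\<^esub> y \<in> S" using E by auto
  show "x \<in> S \<Longrightarrow> y \<in> S \<Longrightarrow> x \<otimes>\<^bsub>A\<^esub> y \<in> S"
    using assms(2) by (simp add: norm_closed_subalgebra_def)
  obtain x where "x \<in> S" using E(2) by blast
  then show "\<zero>\<^bsub>A\<^esub> \<in> S" using sm[of x 0] E(1) by auto
qed

lemma norm_closed_subalgebra_banach:
  fixes A :: "('a, 'b) cnormed_scheme"
  assumes A: "complex_banach_algebra A" and S: "norm_closed_subalgebra S A"
  shows "complex_banach_algebra (A\<lparr>carrier := S\<rparr>)"
proof -
  interpret A: complex_banach_algebra A by fact
  note D = norm_closed_subalgebraD[OF A S]
  have c: "x \<in> S \<Longrightarrow> x \<in> carrier A" for x using D(1) by auto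
  have "complex_normed_space (A\<lparr>carrier := S\<rparr>)"
    by (rule complex_normed_spaceI)
       (simp_all add: D c A.a_ac A.smult_add_left A.smult_add_right A.smult_mult A.nrm_eq_0_iff A.nrm_smult A.nrm_triangle)
  then interpret B: complex_normed_space "A\<lparr>carrier := S\<rparr>" .
  \<comment> \<open>Negatives are defined by a description over the carrier of the record, so
    shrinking the carrier could change them.\<close>
  have minus: "x \<ominus>\<^bsub>A\<lparr>carrier := S\<rparr>\<^esub> y = x \<ominus>\<^bsub>A\<^esub> y" if "x \<in> S" "y \<in> S" for x y
    using B.minus_eq_smult[of x y] A.minus_eq_smult[of x y] that c by simp
  have "B.metric.mcomplete"
    unfolding B.mcomplete_iff
  proof (intro allI impI, elim conjE)
    fix \<sigma> :: "nat \<Rightarrow> 'a"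
    assume "range \<sigma> \<subseteq> carrier (A\<lparr>carrier := S\<rparr>)"
    then have \<sigma>: "\<sigma> n \<in> S" for n by auto
    assume "\<forall>e>0. \<exists>N. \<forall>m\<ge>N. \<forall>n\<ge>N. nrm (A\<lparr>carrier := S\<rparr>) (\<sigma> m \<ominus>\<^bsub>A\<lparr>carrier := S\<rparr>\<^esub> \<sigma> n) < e"
    then have "\<And>e. e > 0 \<Longrightarrow> \<exists>N. \<forall>m\<ge>N. \<forall>n\<ge>N. nrm A (\<sigma> m \<ominus>\<^bsub>A\<^esub> \<sigma> n) < e"
      by (simp add: minus \<sigma>)
    moreover have "range \<sigma> \<subseteq> carrier A" using \<sigma> c by auto
    ultimately obtain l where l: "l \<in> carrier A" "\<And>e. e > 0 \<Longrightarrow> \<exists>N. \<forall>n\<ge>N. nrm A (\<sigma> n \<ominus>\<^bsub>A\<^esub> l) < e"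
      using A.mcompleteD[OF A.complete, of \<sigma>] by metis
    have cl: "closedin (nrm_topology A) S" using S by (simp add: norm_closed_subalgebra_def)
    have "l \<in> S"
      by (rule cl[unfolded A.closedin_nrm_iff, THEN conjunct2, rule_format, of \<sigma>]) (use l \<sigma> in auto)
    with l show "\<exists>l\<in>carrier (A\<lparr>carrier := S\<rparr>). \<forall>e>0. \<exists>N. \<forall>n\<ge>N. 
        nrm (A\<lparr>carrier := S\<rparr>) (\<sigma> n \<ominus>\<^bsub>A\<lparr>carrier := S\<rparr>\<^esub> l) < e"
      by (intro bexI[of _ l]) (simp_all add: minus \<sigma>)
  qed
  then show ?thesis
    by unfold_locales (simp_all add: D c A.mult_assoc A.mult_distr_right A.mult_distr_left A.mult_smult_left A.mult_smult_right A.nrm_mult)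
qed

locale complex_banach_space = complex_normed_space +
  assumes mcomplete: "metric.mcomplete"
begin

text \<open>In a complete space a set has compact closure iff it is totally bounded. All later
  compactness arguments work with these finite nets.\<close>

lemma compact_ops_iff:
  "T \<in> compact_ops V \<longleftrightarrow> T \<in> bounded_ops V V \<and>
     (\<forall>e>0. \<exists>F. finite F \<and> F \<subseteq> carrier V \<and> (\<forall>x\<in>closed_unit_ball V. \<exists>y\<in>F. nrm V (T x \<ominus> y) < e))"
proof (cases "T \<in> bounded_ops V V")
  case True
  then have *: "T ` closed_unit_ball V \<subseteq> carrier V" by (auto simp: op_closed closed_unit_ball_def)
  then have "compactin (nrm_topology V) (nrm_topology V closure_of (T ` closed_unit_ball V)) \<longleftrightarrow>
        metric.mtotally_bounded (T ` closed_unit_ball V)"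
    using metric.mtotally_bounded_eq_compact_closure_of[OF mcomplete] by simp
  then show ?thesis
    unfolding mtotally_bounded_iff using True * by (simp add: compact_ops_def)
qed (simp add: compact_ops_def)

lemma compact_ops_bounded: "T \<in> compact_ops V \<Longrightarrow> T \<in> bounded_ops V V"
  by (simp add: compact_ops_def)

lemma compact_ops_net:
  assumes "T \<in> compact_ops V" "e > 0"
  obtains F where "finite F" "F \<subseteq> carrier V" "\<And>x. x \<in> closed_unit_ball V \<Longrightarrow> \<exists>y\<in>F. nrm V (T x \<ominus> y) < e"
  using assms(1)[unfolded compact_ops_iff, THEN conjunct2, rule_format, OF assms(2)] that by auto

lemma compact_opsI:
  assumes "T \<in> bounded_ops V V"
    and "\<And>e. e > 0 \<Longrightarrow> \<exists>F. finite F \<and> F \<subseteq> carrier V \<and> (\<forall>x\<in>closed_unit_ball V. \<exists>y\<in>F. nrm V (T x \<ominus> y) < e)"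
  shows "T \<in> compact_ops V"
  using assms by (simp add: compact_ops_iff)

lemma compact_ops_add:
  assumes S: "S \<in> compact_ops V" and T: "T \<in> compact_ops V"
  shows "(\<lambda>x\<in>carrier V. S x \<oplus> T x) \<in> compact_ops V"
proof (rule compact_opsI)
  note bS = compact_ops_bounded[OF S] and bT = compact_ops_bounded[OF T]
  show "(\<lambda>x\<in>carrier V. S x \<oplus> T x) \<in> bounded_ops V V" by (rule add_op_closed[OF bS bT])
  fix e :: real assume "e > 0"
  then have e: "e / 2 > 0" by simp
  obtain F where F: "finite F" "F \<subseteq> carrier V" "\<And>x. x \<in> closed_unit_ball V \<Longrightarrow> \<exists>y\<in>F. nrm V (S x \<ominus> y) < e / 2"
    by (rule compact_ops_net[OF S e]) auto
  obtain G where G: "finite G" "G \<subseteq> carrier V" "\<And>x. x \<in> closed_unit_ball V \<Longrightarrow> \<exists>y\<in>G. nrm V (T x \<ominus> y) < e / 2"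
    by (rule compact_ops_net[OF T e]) auto
  define H where "H = (\<lambda>(y, z). y \<oplus> z) ` (F \<times> G)"
  have "\<exists>w\<in>H. nrm V ((\<lambda>x\<in>carrier V. S x \<oplus> T x) x \<ominus> w) < e" if x: "x \<in> closed_unit_ball V" for x
  proof -
    obtain y where y: "y \<in> F" "nrm V (S x \<ominus> y) < e / 2" using F(3)[OF x] by auto
    obtain z where z: "z \<in> G" "nrm V (T x \<ominus> z) < e / 2" using G(3)[OF x] by auto
    have c: "x \<in> carrier V" "y \<in> carrier V" "z \<in> carrier V" "S x \<in> carrier V" "T x \<in> carrier V"
      using closed_unit_ballD[OF x] y z F G op_closed[OF bS] op_closed[OF bT] by auto
    have "nrm V ((S x \<oplus> T x) \<ominus> (y \<oplus> z)) < e"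
      using nrm_triangle[of "S x \<ominus> y" "T x \<ominus> z"] c y z by (simp add: add_diff_add)
    moreover have "y \<oplus> z \<in> H" using y z by (auto simp: H_def)
    ultimately show ?thesis using c by (intro bexI[of _ "y \<oplus> z"]) auto
  qed
  moreover have "finite H" "H \<subseteq> carrier V" using F G by (auto simp: H_def subset_iff)
  ultimately show "\<exists>F. finite F \<and> F \<subseteq> carrier V \<and>
      (\<forall>x\<in>closed_unit_ball V. \<exists>y\<in>F. nrm V ((\<lambda>x\<in>carrier V. S x \<oplus> T x) x \<ominus> y) < e)"
    by (intro exI[of _ H]) simp
qed

lemma compose_bounded_compact:
  assumes S: "S \<in> bounded_ops V V" and T: "T \<in> compact_ops V"
  shows "compose (carrier V) S T \<in> compact_ops V"
proof (rule compact_opsI)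
  note bT = compact_ops_bounded[OF T]
  show "compose (carrier V) S T \<in> bounded_ops V V" by (rule compose_op_closed[OF S bT])
  fix e :: real assume e: "e > 0"
  have p: "op_norm V V S + 1 > 0" using op.op_norm_nonneg[OF S] by linarith
  then have e': "e / (op_norm V V S + 1) > 0" using e by simp
  obtain F where F: "finite F" "F \<subseteq> carrier V"
    "\<And>x. x \<in> closed_unit_ball V \<Longrightarrow> \<exists>y\<in>F. nrm V (T x \<ominus> y) < e / (op_norm V V S + 1)"
    by (rule compact_ops_net[OF T e']) auto
  have "\<exists>w\<in>S ` F. nrm V (compose (carrier V) S T x \<ominus> w) < e" if x: "x \<in> closed_unit_ball V" for x
  proof -
    obtain y where y: "y \<in> F" "nrm V (T x \<ominus> y) < e / (op_norm V V S + 1)" using F(3)[OF x] by auto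
    have c: "x \<in> carrier V" "y \<in> carrier V" "T x \<in> carrier V"
      using closed_unit_ballD[OF x] y F op_closed[OF bT] by auto
    have "nrm V (S (T x) \<ominus> S y) \<le> op_norm V V S * nrm V (T x \<ominus> y)"
      using op.nrm_op_le[OF S, of "T x \<ominus> y"] c by (simp add: op.linear_minus[OF bounded_ops_linear[OF S]])
    also have "\<dots> \<le> (op_norm V V S + 1) * nrm V (T x \<ominus> y)" using c by (intro mult_right_mono) auto
    also have "\<dots> < e" using y(2) p by (simp add: field_simps)
    finally show ?thesis using y c by (auto simp: compose_def)
  qed
  moreover have "finite (S ` F)" "S ` F \<subseteq> carrier V" using F op_closed[OF S] by (auto simp: subset_iff)
  ultimately show "\<exists>F. finite F \<and> F \<subseteq> carrier V \<and>
      (\<forall>x\<in>closed_unit_ball V. \<exists>y\<in>F. nrm V (compose (carrier V) S T x \<ominus> y) < e)"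
    by (intro exI[of _ "S ` F"]) simp
qed

lemma compact_ops_smult:
  assumes T: "T \<in> compact_ops V"
  shows "(\<lambda>x\<in>carrier V. c \<odot> T x) \<in> compact_ops V"
proof -
  define S where "S = (\<lambda>x\<in>carrier V. c \<odot> x)"
  have "S \<in> bounded_ops V V" unfolding S_def
    by (rule op.bounded_opsI[where K = "cmod c"])
       (auto intro!: linear_mapsI simp: smult_add_right nrm_smult mult.commute simp flip: smult_mult)
  from compose_bounded_compact[OF this T] show ?thesis
    by (simp add: compose_def S_def op_closed[OF compact_ops_bounded[OF T]] cong: restrict_cong)
qed

lemma compact_ops_zero: "(\<lambda>x\<in>carrier V. \<zero>) \<in> compact_ops V"
proof (rule compact_opsI)
  show "(\<lambda>x\<in>carrier V. \<zero>) \<in> bounded_ops V V"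
    by (auto intro!: op.bounded_opsI[where K = 0] linear_mapsI)
  fix e :: real assume "e > 0"
  then show "\<exists>F. finite F \<and> F \<subseteq> carrier V \<and> (\<forall>x\<in>closed_unit_ball V. \<exists>y\<in>F. nrm V ((\<lambda>x\<in>carrier V. \<zero>) x \<ominus> y) < e)"
    by (intro exI[of _ "{\<zero>}"]) (auto simp: closed_unit_ball_def a_minus_def r_neg)
qed

lemma compact_ops_closed: "closedin (nrm_topology (op_algebra V)) (compact_ops V)"
proof -
  interpret O: complex_normed_space "op_algebra V" by (rule op_algebra_normed)
  show ?thesis
    unfolding O.closedin_nrm_iff
  proof (intro conjI allI impI, goal_cases)
    case 1
    then show ?case using compact_ops_bounded by auto
  next
    case (2 \<sigma> T)
    then have \<sigma>: "\<sigma> n \<in> compact_ops V" and T: "T \<in> bounded_ops V V"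
      and lim: "\<forall>e>0. \<exists>N. \<forall>n\<ge>N. op_norm V V (\<sigma> n \<ominus>\<^bsub>op_algebra V\<^esub> T) < e" for n by auto
    show "T \<in> compact_ops V"
    proof (rule compact_opsI[OF T])
      fix e :: real assume "e > 0"
      then have e: "e / 2 > 0" by simp
      then obtain n where n: "op_norm V V (\<sigma> n \<ominus>\<^bsub>op_algebra V\<^esub> T) < e / 2" using lim[rule_format, OF e] by blast
      note bn = compact_ops_bounded[OF \<sigma>[of n]]
      obtain F where F: "finite F" "F \<subseteq> carrier V"
        "\<And>x. x \<in> closed_unit_ball V \<Longrightarrow> \<exists>y\<in>F. nrm V (\<sigma> n x \<ominus> y) < e / 2"
        by (rule compact_ops_net[OF \<sigma> e]) auto
      have "\<exists>y\<in>F. nrm V (T x \<ominus> y) < e" if x: "x \<in> closed_unit_ball V" for x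
      proof -
        obtain y where y: "y \<in> F" "nrm V (\<sigma> n x \<ominus> y) < e / 2" using F(3)[OF x] by auto
        have c: "x \<in> carrier V" "y \<in> carrier V" "T x \<in> carrier V" "\<sigma> n x \<in> carrier V"
          using closed_unit_ballD[OF x] y F op_closed[OF T] op_closed[OF bn] by auto
        have "nrm V (\<sigma> n x \<ominus> T x) < e / 2"
          using op.op_norm_upper[OF op_minus_closed[OF bn T] x] n c by (simp add: op_minus_apply[OF bn T])
        then have "nrm V (T x \<ominus> y) < e"
          using nrm_triangle_minus[of "T x" "\<sigma> n x" y] y c nrm_minus_commute[of "T x" "\<sigma> n x"] by simp
        then show ?thesis using y(1) by auto
      qed
      then show "\<exists>F. finite F \<and> F \<subseteq> carrier V \<and> (\<forall>x\<in>closed_unit_ball V. \<exists>y\<in>F. nrm V (T x \<ominus> y) < e)"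
        using F(1,2) by (intro exI[of _ F]) simp
    qed
  qed
qed

lemma compact_ops_subalgebra: "norm_closed_subalgebra (compact_ops V) (op_algebra V)"
proof -
  interpret O: complex_normed_space "op_algebra V" by (rule op_algebra_normed)
  have "submodule (compact_ops V) complex_ring (op_algebra V)"
  proof (rule O.submoduleI)
    show "compact_ops V \<subseteq> carrier (op_algebra V)" using compact_ops_bounded by auto
    show "\<ominus>\<^bsub>op_algebra V\<^esub> T \<in> compact_ops V" if "T \<in> compact_ops V" for T
      using O.uminus_eq[of T] compact_ops_smult[OF that, of "-1"] compact_ops_bounded[OF that] by simp
  qed (simp_all add: compact_ops_zero compact_ops_smult compact_ops_add)
  then show ?thesis
    using compact_ops_closed compose_bounded_compact[OF compact_ops_bounded]
    by (simp add: norm_closed_subalgebra_def)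
qed

lemma compact_op_algebra_banach: "complex_banach_algebra (compact_op_algebra V)"
  unfolding compact_op_algebra_def
  by (intro norm_closed_subalgebra_banach op_algebra_banach mcomplete compact_ops_subalgebra)

end

lemma compact_op_algebra_simps [simp]:
  "carrier (compact_op_algebra V) = compact_ops V"
  "(S \<otimes>\<^bsub>compact_op_algebra V\<^esub> T) = compose (carrier V) S T"
  "\<zero>\<^bsub>compact_op_algebra V\<^esub> = (\<lambda>x\<in>carrier V. \<zero>\<^bsub>V\<^esub>)"
  "(S \<oplus>\<^bsub>compact_op_algebra V\<^esub> T) = (\<lambda>x\<in>carrier V. S x \<oplus>\<^bsub>V\<^esub> T x)"
  "c \<odot>\<^bsub>compact_op_algebra V\<^esub> T = (\<lambda>x\<in>carrier V. c \<odot>\<^bsub>V\<^esub> T x)"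
  "nrm (compact_op_algebra V) = op_norm V V"
  by (simp_all add: compact_op_algebra_def op_algebra_def)

lemma isometrically_isomorphic_refl: "isometrically_isomorphic A A" if "complex_banach_algebra A"
proof -
  interpret complex_banach_algebra A by fact
  show ?thesis unfolding isometrically_isomorphic_def
    by (intro bexI[of _ "\<lambda>x\<in>carrier A. x"] linear_mapsI)
       (auto simp: bij_betw_def inj_on_def mult_closed)
qed

section \<open>The spaces \<open>L\<^sup>p\<close>\<close>

text \<open>Young's inequality for \<open>s powr (p - 1)\<close> and \<open>t\<close>, with
  exponents \<open>p / (p - 1)\<close> and \<open>p\<close>, is this tangent inequality in disguise.
  No derivative at 0 is involved.\<close>

lemma powr_tangent:
  fixes p s t :: real
  assumes p: "1 < p" and s: "0 \<le> s" and t: "0 \<le> t"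
  shows "s powr p + p * s powr (p - 1) * (t - s) \<le> t powr p"
proof -
  have "s powr (p - 1) * t \<le> (s powr (p - 1)) powr (p / (p - 1)) / (p / (p - 1)) + t powr p / p"
    using p t by (intro Youngs_inequality) (auto simp: field_simps)
  also have "(s powr (p - 1)) powr (p / (p - 1)) = s powr p" using p by (simp add: powr_powr)
  finally have "p * (s powr (p - 1) * t) \<le> p * (s powr p / (p / (p - 1)) + t powr p / p)"
    using p by (intro mult_left_mono) auto
  also have "\<dots> = (p - 1) * s powr p + t powr p" using p by (simp add: field_simps)
  finally have *: "p * (s powr (p - 1) * t) \<le> (p - 1) * s powr p + t powr p" .
  have "s powr (p - 1) * s = s powr p" using s by (cases "s = 0") (auto simp: powr_diff)
  then show ?thesis using * by (simp add: algebra_simps)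
qed

text \<open>Average the tangent inequalities at the convex combination \<open>s\<close>; their
  linear terms cancel.\<close>

lemma powr_convex_nonneg:
  fixes p l a b :: real
  assumes p: "1 < p" and l: "0 \<le> l" "l \<le> 1" and a: "0 \<le> a" and b: "0 \<le> b"
  shows "(l * a + (1 - l) * b) powr p \<le> l * a powr p + (1 - l) * b powr p"
proof -
  define s where "s = l * a + (1 - l) * b"
  have s: "0 \<le> s" unfolding s_def using assms by simp
  have "l * (s powr p + p * s powr (p - 1) * (a - s)) + (1 - l) * (s powr p + p * s powr (p - 1) * (b - s))
      \<le> l * a powr p + (1 - l) * b powr p"
    using l powr_tangent[OF p s a] powr_tangent[OF p s b] by (intro add_mono mult_left_mono) auto
  also have "l * (s powr p + p * s powr (p - 1) * (a - s)) + (1 - l) * (s powr p + p * s powr (p - 1) * (b - s))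
     = s powr p + p * s powr (p - 1) * (l * a + (1 - l) * b - s)"
    by (simp add: algebra_simps)
  finally show ?thesis by (simp add: s_def)
qed

lemma powr_add_le:
  fixes p a b :: real
  assumes "1 < p" "0 \<le> a" "0 \<le> b"
  shows "(a + b) powr p \<le> 2 powr p * (a powr p + b powr p)"
proof -
  have "(a + b) powr p \<le> (2 * max a b) powr p" using assms by (intro powr_mono2) auto
  also have "\<dots> = 2 powr p * (max a b) powr p" using assms by (simp add: powr_mult)
  also have "\<dots> \<le> 2 powr p * (a powr p + b powr p)" using assms by (intro mult_left_mono) (auto simp: max_def)
  finally show ?thesis .
qed

section \<open>Minkowski's inequality and the space of classes\<close>

lemma Lp_functionsD:
  assumes "f \<in> Lp_functions p M"
  shows "f \<in> borel_measurable M" "integrable M (\<lambda>x. cmod (f x) powr p)"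
  using assms by (auto simp: Lp_functions_def)

lemma Lp_functions_bound:
  assumes f: "f \<in> borel_measurable M" and g: "integrable M g"
    and le: "AE x in M. cmod (f x) powr p \<le> g x"
  shows "f \<in> Lp_functions p M"
proof -
  have "integrable M (\<lambda>x. cmod (f x) powr p)"
    by (rule Bochner_Integration.integrable_bound[OF g]) (use f le in \<open>auto elim: eventually_mono\<close>)
  with f show ?thesis by (simp add: Lp_functions_def)
qed

lemma Lp_seminorm_cong_AE:
  assumes f: "f \<in> borel_measurable M" and g: "g \<in> borel_measurable M" and eq: "AE x in M. f x = g x"
  shows "Lp_seminorm p M f = Lp_seminorm p M g"
proof -
  have "(LINT x|M. cmod (f x) powr p) = (LINT x|M. cmod (g x) powr p)"
    by (rule integral_cong_AE) (use f g eq in auto)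
  then show ?thesis by (simp add: Lp_seminorm_def)
qed

lemma Lp_seminorm_nonneg [simp]: "0 \<le> Lp_seminorm p M f"
  by (simp add: Lp_seminorm_def)

locale Lp_space =
  fixes p :: real and M :: "'x measure"
  assumes p_gt_1: "1 < p"
begin

abbreviation LF where "LF \<equiv> Lp_functions p M"

abbreviation snorm where "snorm \<equiv> Lp_seminorm p M"

abbreviation LP where "LP \<equiv> Lp p M"

lemma p_pos: "0 < p" and p_ne_0: "p \<noteq> 0" using p_gt_1 by auto

lemma Lp_seminorm_powr: "snorm f powr p = (LINT x|M. cmod (f x) powr p)"
  using p_gt_1 by (simp add: Lp_seminorm_def powr_powr)

lemma Lp_seminorm_leI:
  assumes "(LINT x|M. cmod (f x) powr p) \<le> B powr p" "0 \<le> B"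
  shows "snorm f \<le> B"
proof -
  have "snorm f \<le> (B powr p) powr (1 / p)"
    unfolding Lp_seminorm_def using assms p_gt_1 by (intro powr_mono2) auto
  then show ?thesis using p_gt_1 assms(2) by (simp add: powr_powr)
qed

lemma Lp_seminorm_eq_0_iff:
  assumes f: "f \<in> LF"
  shows "snorm f = 0 \<longleftrightarrow> (AE x in M. f x = 0)"
  using integral_nonneg_eq_0_iff_AE[OF Lp_functionsD(2)[OF f]] p_gt_1 by (simp add: Lp_seminorm_def)

lemma Lp_functions_zero: "(\<lambda>x. 0) \<in> LF"
  using p_gt_1 by (simp add: Lp_functions_def)

lemma Lp_functions_smult:
  assumes f: "f \<in> LF"
  shows "(\<lambda>x. c * f x) \<in> LF"
  using Lp_functionsD[OF f] by (simp add: Lp_functions_def norm_mult powr_mult)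

lemma Lp_seminorm_smult: "snorm (\<lambda>x. c * f x) = cmod c * snorm f"
  using p_gt_1 by (simp add: Lp_seminorm_def norm_mult powr_mult powr_powr)

lemma Lp_functions_add:
  assumes f: "f \<in> LF" and g: "g \<in> LF"
  shows "(\<lambda>x. f x + g x) \<in> LF"
proof (rule Lp_functions_bound)
  show "(\<lambda>x. f x + g x) \<in> borel_measurable M" using Lp_functionsD[OF f] Lp_functionsD[OF g] by auto
  show "integrable M (\<lambda>x. 2 powr p * (cmod (f x) powr p + cmod (g x) powr p))"
    using Lp_functionsD[OF f] Lp_functionsD[OF g] by auto
  have "cmod (f x + g x) powr p \<le> 2 powr p * (cmod (f x) powr p + cmod (g x) powr p)" for x
    using powr_add_le[OF p_gt_1, of "cmod (f x)" "cmod (g x)"]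
      powr_mono2[OF _ norm_ge_zero norm_triangle_ineq, of p "f x" "g x"] p_gt_1 by simp
  then show "AE x in M. cmod (f x + g x) powr p \<le> 2 powr p * (cmod (f x) powr p + cmod (g x) powr p)" by simp
qed

lemma Lp_functions_diff:
  assumes f: "f \<in> LF" and g: "g \<in> LF"
  shows "(\<lambda>x. f x - g x) \<in> LF"
  using Lp_functions_add[OF f Lp_functions_smult[OF g, of "-1"]] by simp

text \<open>Convexity of \<open>powr\<close> suffices: |f| + |g| is \<open>a + b\<close> times the
  convex combination of |f| / \<open>a\<close> and |g| / \<open>b\<close> with weights
  \<open>a / (a + b)\<close> and \<open>b / (a + b)\<close>, and both normalised functions have p-th
  power integral 1. Vanishing seminorms are treated apart because of the division.\<close>

lemma Lp_seminorm_triangle: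
  assumes f: "f \<in> LF" and g: "g \<in> LF"
  shows "snorm (\<lambda>x. f x + g x) \<le> snorm f + snorm g"
proof (cases "snorm f = 0 \<or> snorm g = 0")
  case True
  have m: "f \<in> borel_measurable M" "g \<in> borel_measurable M" using Lp_functionsD f g by auto
  from True consider "AE x in M. f x = 0" | "AE x in M. g x = 0"
    using Lp_seminorm_eq_0_iff f g by auto
  then show ?thesis
  proof cases
    case 1
    then have "AE x in M. f x + g x = g x" by auto
    then show ?thesis using Lp_seminorm_cong_AE[of "\<lambda>x. f x + g x" M g p] m by simp
  next
    case 2
    then have "AE x in M. f x + g x = f x" by auto
    then show ?thesis using Lp_seminorm_cong_AE[of "\<lambda>x. f x + g x" M f p] m by simp
  qed
next
  case False
  define a where "a = snorm f"
  define b where "b = snorm g"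
  have ab: "a > 0" "b > 0" using False by (auto simp: a_def b_def less_le)
  define l where "l = a / (a + b)"
  have l: "0 \<le> l" "l \<le> 1" "1 - l = b / (a + b)" using ab by (auto simp: l_def field_simps)
  note If = Lp_functionsD(2)[OF f] and Ig = Lp_functionsD(2)[OF g]
  have pt: "cmod (f x + g x) powr p \<le> (a + b) powr p * (l / a powr p * cmod (f x) powr p + (1 - l) / b powr p * cmod (g x) powr p)" for x
  proof -
    have "(a + b) * (l * (cmod (f x) / a)) = cmod (f x)" "(a + b) * ((1 - l) * (cmod (g x) / b)) = cmod (g x)"
      unfolding l(3) using ab by (simp_all add: l_def)
    then have "(a + b) * (l * (cmod (f x) / a) + (1 - l) * (cmod (g x) / b)) = cmod (f x) + cmod (g x)"
      by (simp only: distrib_left)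
    then have "cmod (f x + g x) powr p \<le> ((a + b) * (l * (cmod (f x) / a) + (1 - l) * (cmod (g x) / b))) powr p"
      using p_gt_1 norm_triangle_ineq[of "f x" "g x"] by (intro powr_mono2) auto
    also have "\<dots> = (a + b) powr p * (l * (cmod (f x) / a) + (1 - l) * (cmod (g x) / b)) powr p"
      using ab l by (simp add: powr_mult)
    also have "\<dots> \<le> (a + b) powr p * (l * (cmod (f x) / a) powr p + (1 - l) * (cmod (g x) / b) powr p)"
      using ab l p_gt_1 by (intro mult_left_mono powr_convex_nonneg) auto
    finally show ?thesis using ab by (simp add: powr_divide)
  qed
  have "(LINT x|M. cmod (f x + g x) powr p)
     \<le> (LINT x|M. (a + b) powr p * (l / a powr p * cmod (f x) powr p + (1 - l) / b powr p * cmod (g x) powr p))"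
    using Lp_functionsD(2)[OF Lp_functions_add[OF f g]] If Ig pt by (intro integral_mono) auto
  also have "\<dots> = (a + b) powr p * (l / a powr p * (LINT x|M. cmod (f x) powr p) + (1 - l) / b powr p * (LINT x|M. cmod (g x) powr p))"
    using If Ig by simp
  also have "\<dots> = (a + b) powr p * (l / a powr p * a powr p + (1 - l) / b powr p * b powr p)"
    by (simp add: a_def b_def Lp_seminorm_powr)
  also have "\<dots> = (a + b) powr p" using ab by simp
  finally show ?thesis using ab by (intro Lp_seminorm_leI) (auto simp: a_def b_def)
qed

lemma equiv_Lp_rel: "equiv (LF) (Lp_rel p M)"
  by (intro equivI refl_onI symI transI) (auto simp: Lp_rel_def)

definition cls :: "('x \<Rightarrow> complex) \<Rightarrow> ('x \<Rightarrow> complex) set" where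
  "cls f = Lp_rel p M `` {f}"

lemma carrier_Lp: "carrier LP = cls ` LF"
  by (auto simp: Lp_def quotient_def cls_def)

lemma cls_in_carrier [simp, intro]: "f \<in> LF \<Longrightarrow> cls f \<in> carrier LP"
  by (auto simp: carrier_Lp)

lemma carrier_Lp_cases:
  assumes "F \<in> carrier LP"
  obtains f where "f \<in> LF" "F = cls f"
  using assms by (auto simp: carrier_Lp)

lemma mem_cls: "f \<in> LF \<Longrightarrow> f \<in> cls f"
  by (simp add: cls_def Lp_rel_def)

lemma in_cls_iff: "g \<in> cls f \<longleftrightarrow> f \<in> LF \<and> g \<in> LF \<and> (AE x in M. g x = f x)"
  by (auto simp: cls_def Lp_rel_def elim: eventually_mono)

lemma cls_eq_iff:
  "f \<in> LF \<Longrightarrow> g \<in> LF \<Longrightarrow> cls f = cls g \<longleftrightarrow> (AE x in M. f x = g x)"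
  using eq_equiv_class_iff[OF equiv_Lp_rel, of f g] by (auto simp: cls_def Lp_rel_def)

lemma cls_eqI:
  "f \<in> LF \<Longrightarrow> g \<in> LF \<Longrightarrow> AE x in M. f x = g x \<Longrightarrow> cls f = cls g"
  by (simp add: cls_eq_iff)

lemma Lp_zero: "\<zero>\<^bsub>LP\<^esub> = cls (\<lambda>_. 0)"
  by (simp add: Lp_def cls_def)

text \<open>The union in the record runs over equal sets, since sums of other representatives differ
  from the given one on null sets only.\<close>

lemma Lp_add:
  assumes f: "f \<in> LF" and g: "g \<in> LF"
  shows "cls f \<oplus>\<^bsub>LP\<^esub> cls g = cls (\<lambda>x. f x + g x)"
proof -
  have "cls (\<lambda>x. f' x + g' x) = cls (\<lambda>x. f x + g x)" if "f' \<in> cls f" "g' \<in> cls g" for f' g'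
    using that by (intro cls_eqI Lp_functions_add) (auto simp: in_cls_iff)
  then have "(\<Union>f\<in>cls f. \<Union>g\<in>cls g. cls (\<lambda>x. f x + g x)) = cls (\<lambda>x. f x + g x)"
    using mem_cls[OF f] mem_cls[OF g] by blast
  then show ?thesis by (simp add: Lp_def cls_def)
qed

lemma Lp_smult:
  assumes f: "f \<in> LF"
  shows "c \<odot>\<^bsub>LP\<^esub> cls f = cls (\<lambda>x. c * f x)"
proof -
  have "cls (\<lambda>x. c * f' x) = cls (\<lambda>x. c * f x)" if "f' \<in> cls f" for f'
    using that by (intro cls_eqI Lp_functions_smult) (auto simp: in_cls_iff elim: eventually_mono)
  then have "(\<Union>f\<in>cls f. cls (\<lambda>x. c * f x)) = cls (\<lambda>x. c * f x)"
    using mem_cls[OF f] by blast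
  then show ?thesis by (simp add: Lp_def cls_def)
qed

lemma Lp_nrm:
  assumes f: "f \<in> LF"
  shows "nrm LP (cls f) = snorm f"
proof -
  have "snorm g = snorm f" if g: "g \<in> cls f" for g
  proof -
    have "g \<in> LF" "AE x in M. g x = f x" using g unfolding in_cls_iff by simp_all
    then show ?thesis using Lp_seminorm_cong_AE Lp_functionsD(1) f by metis
  qed
  then have "snorm ` cls f = (\<lambda>_. snorm f) ` cls f" by (rule image_cong[OF refl])
  also have "\<dots> = {snorm f}" using mem_cls[OF f] by auto
  finally have "snorm ` cls f = {snorm f}" .
  then show ?thesis by (simp add: Lp_def)
qed

sublocale Lp: complex_normed_space "LP"
proof (rule complex_normed_spaceI)
  show "\<zero>\<^bsub>LP\<^esub> \<in> carrier LP" by (simp add: Lp_zero Lp_functions_zero)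
  show "(nrm LP F = 0) = (F = \<zero>\<^bsub>LP\<^esub>)" if F: "F \<in> carrier LP" for F
    using F by (rule carrier_Lp_cases) (simp only: Lp_zero Lp_nrm Lp_seminorm_eq_0_iff cls_eq_iff Lp_functions_zero)
qed (auto elim!: carrier_Lp_cases simp: Lp_zero Lp_add Lp_smult Lp_nrm Lp_functions_zero Lp_functions_add
  Lp_functions_smult algebra_simps Lp_seminorm_smult Lp_seminorm_triangle)

lemma Lp_minus:
  assumes "f \<in> LF" "g \<in> LF"
  shows "cls f \<ominus>\<^bsub>LP\<^esub> cls g = cls (\<lambda>x. f x - g x)"
  using assms Lp.minus_eq_smult[of "cls f" "cls g"] Lp_functions_smult[OF assms(2), of "-1"]
  by (simp add: Lp_smult Lp_add)

end

text \<open>Young's inequality holds pointwise for the functions divided by their seminorms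
  \<open>a\<close> and \<open>b\<close>. If one of these is 0, the product vanishes almost
  everywhere.\<close>

lemma Hoelder_inequality:
  fixes f g :: "'x \<Rightarrow> complex"
  assumes p: "1 < p" and q: "1 < q" and pq: "1 / p + 1 / q = 1"
    and f: "f \<in> Lp_functions p M" and g: "g \<in> Lp_functions q M"
  shows "integrable M (\<lambda>x. f x * g x)"
    and "(LINT x|M. cmod (f x * g x)) \<le> Lp_seminorm p M f * Lp_seminorm q M g"
proof -
  note mf = Lp_functionsD[OF f] and mg = Lp_functionsD[OF g]
  have young: "cmod (u * v) \<le> cmod u powr p / p + cmod v powr q / q" for u v
    using Youngs_inequality[OF p q pq, of "cmod u" "cmod v"] by (simp add: norm_mult)
  show I: "integrable M (\<lambda>x. f x * g x)"
  proof (rule Bochner_Integration.integrable_bound)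
    show "integrable M (\<lambda>x. cmod (f x) powr p / p + cmod (g x) powr q / q)" using mf mg by auto
    show "(\<lambda>x. f x * g x) \<in> borel_measurable M" using mf mg by auto
    show "AE x in M. norm (f x * g x) \<le> norm (cmod (f x) powr p / p + cmod (g x) powr q / q)"
      using young by (intro AE_I2) (smt (verit) real_norm_def)
  qed
  interpret P: Lp_space p M by unfold_locales (rule p)
  interpret Q: Lp_space q M by unfold_locales (rule q)
  define a where "a = Lp_seminorm p M f"
  define b where "b = Lp_seminorm q M g"
  have ab0: "a \<ge> 0" "b \<ge> 0" by (auto simp: a_def b_def)
  have "(LINT x|M. cmod (f x * g x)) \<le> a * b"
  proof (cases "a = 0 \<or> b = 0")
    case True
    then have "AE x in M. cmod (f x * g x) = 0"
      using P.Lp_seminorm_eq_0_iff[OF f] Q.Lp_seminorm_eq_0_iff[OF g] by (auto simp: a_def b_def)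
    then have "(LINT x|M. cmod (f x * g x)) = 0" by (rule integral_eq_zero_AE)
    then show ?thesis using ab0 by simp
  next
    case False
    with ab0 have ab: "a > 0" "b > 0" by auto
    have "cmod (f x * g x) \<le> a * b * ((1 / (a powr p * p)) * cmod (f x) powr p + (1 / (b powr q * q)) * cmod (g x) powr q)" for x
    proof -
      have "cmod (f x * g x) = a * b * cmod ((f x / of_real a) * (g x / of_real b))"
        using ab by (simp add: norm_mult norm_divide)
      also have "\<dots> \<le> a * b * (cmod (f x / of_real a) powr p / p + cmod (g x / of_real b) powr q / q)"
        using ab by (intro mult_left_mono young) auto
      finally show ?thesis using ab by (simp add: norm_divide powr_divide)
    qed
    then have "(LINT x|M. cmod (f x * g x)) \<le>
       (LINT x|M. a * b * ((1 / (a powr p * p)) * cmod (f x) powr p + (1 / (b powr q * q)) * cmod (g x) powr q))"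
      using I mf mg by (intro integral_mono) auto
    also have "\<dots> = a * b * ((1 / (a powr p * p)) * (LINT x|M. cmod (f x) powr p) + (1 / (b powr q * q)) * (LINT x|M. cmod (g x) powr q))"
      using mf mg by simp
    also have "\<dots> = a * b * ((1 / (a powr p * p)) * a powr p + (1 / (b powr q * q)) * b powr q)"
      by (simp add: a_def b_def P.Lp_seminorm_powr Q.Lp_seminorm_powr)
    also have "\<dots> = a * b * (1 / p + 1 / q)" using ab by simp
    finally show ?thesis by (simp add: pq)
  qed
  then show "(LINT x|M. cmod (f x * g x)) \<le> Lp_seminorm p M f * Lp_seminorm q M g"
    by (simp add: a_def b_def)
qed

section \<open>Probability spaces: comparison with the integral, completeness\<close>

locale Lp_prob_space = Lp_space p M + prob_space M for p :: real and M :: "'x measure"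
begin

lemma Lp_functions_bounded:
  assumes "f \<in> borel_measurable M" "AE x in M. cmod (f x) \<le> C"
  shows "f \<in> LF"
proof (rule Lp_functions_bound[OF assms(1)])
  show "integrable M (\<lambda>_. (max C 0) powr p)" by simp
  show "AE x in M. cmod (f x) powr p \<le> (max C 0) powr p"
    using assms(2) by (auto elim!: eventually_mono intro!: powr_mono2 simp: p_pos less_imp_le)
qed

lemma Lp_seminorm_bounded:
  assumes "f \<in> borel_measurable M" "AE x in M. cmod (f x) \<le> C" "0 \<le> C"
  shows "snorm f \<le> C"
proof (rule Lp_seminorm_leI[OF _ assms(3)])
  have "(LINT x|M. cmod (f x) powr p) \<le> (LINT x|M. C powr p)"
    using Lp_functionsD(2)[OF Lp_functions_bounded[OF assms(1,2)]] assms(2)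
    by (intro integral_mono_AE) (auto elim!: eventually_mono intro!: powr_mono2 simp: p_pos less_imp_le)
  then show "(LINT x|M. cmod (f x) powr p) \<le> C powr p" by (simp add: prob_space)
qed

lemma Lp_functions_const: "(\<lambda>_. c) \<in> LF"
  by (rule Lp_functions_bounded[where C = "cmod c"]) auto

lemma Lp_functions_mult_bounded:
  assumes f: "f \<in> LF" and g: "g \<in> borel_measurable M" "\<And>x. cmod (g x) \<le> C"
  shows "(\<lambda>x. g x * f x) \<in> LF"
proof (rule Lp_functions_bound)
  show "(\<lambda>x. g x * f x) \<in> borel_measurable M" using Lp_functionsD(1)[OF f] g by auto
  show "integrable M (\<lambda>x. C powr p * cmod (f x) powr p)" using Lp_functionsD(2)[OF f] by simp
  have "C \<ge> 0" using g(2) norm_ge_zero order_trans by metis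
  then show "AE x in M. cmod (g x * f x) powr p \<le> C powr p * cmod (f x) powr p"
    using g(2) by (auto simp: norm_mult powr_mult intro!: mult_right_mono powr_mono2 simp: p_pos less_imp_le)
qed

lemma Lp_functions_indicator:
  assumes "f \<in> LF" "A \<in> sets M"
  shows "(\<lambda>x. indicator A x * f x) \<in> LF"
  using assms by (intro Lp_functions_mult_bounded[where C = 1]) (auto simp: indicator_def)

lemma conj_exponent: "1 < p / (p - 1)" "1 / p + 1 / (p / (p - 1)) = 1"
  using p_gt_1 by (auto simp: field_simps)

lemma Lp_integrable:
  assumes f: "f \<in> LF"
  shows "integrable M f"
proof -
  interpret Q: Lp_prob_space "p / (p - 1)" M by unfold_locales (rule conj_exponent)
  show ?thesis
    using Hoelder_inequality(1)[OF p_gt_1 conj_exponent f Q.Lp_functions_const[of 1]] by simp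
qed

text \<open>Hoelder against the indicator of \<open>A\<close>, whose norm for the conjugate exponent
  is \<open>measure M A powr (1 - 1 / p)\<close>. The same estimate yields the contractivity of
  averages over cells, the bound of the mean by the norm, and the sharper bound of the mean by the
  norms on the two halves of the interval.\<close>

lemma indicator_integral_abs_le:
  assumes f: "f \<in> LF" and A: "A \<in> sets M"
  shows "(LINT x|M. indicator A x * cmod (f x))
    \<le> measure M A powr (1 - 1 / p) * (LINT x|M. indicator A x * cmod (f x) powr p) powr (1 / p)"
proof -
  interpret Q: Lp_prob_space "p / (p - 1)" M by unfold_locales (rule conj_exponent)
  define g where "g = (\<lambda>x. indicator A x * f x)"
  have g: "g \<in> LF" unfolding g_def by (rule Lp_functions_indicator[OF f A])
  have i: "(indicator A :: _ \<Rightarrow> complex) \<in> Lp_functions (p / (p - 1)) M"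
    by (rule Q.Lp_functions_bounded[where C = 1]) (use A in \<open>auto simp: indicator_def\<close>)
  have "(LINT x|M. cmod (g x * indicator A x)) \<le> snorm g * Lp_seminorm (p / (p - 1)) M (indicator A)"
    by (rule Hoelder_inequality(2)[OF p_gt_1 conj_exponent g i])
  also have "Lp_seminorm (p / (p - 1)) M (indicator A) = measure M A powr (1 - 1 / p)"
  proof -
    have "(LINT x|M. cmod (indicator A x) powr (p / (p - 1))) = (LINT x|M. indicator A x)"
      by (intro Bochner_Integration.integral_cong) (auto simp: indicator_def)
    also have "\<dots> = measure M A" using A by simp
    finally show ?thesis using p_gt_1 by (simp add: Lp_seminorm_def field_simps)
  qed
  also have "snorm g = (LINT x|M. indicator A x * cmod (f x) powr p) powr (1 / p)"
    unfolding Lp_seminorm_def g_def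
    by (intro arg_cong[where f = "\<lambda>x. x powr (1 / p)"] Bochner_Integration.integral_cong) (auto simp: indicator_def)
  also have "(LINT x|M. cmod (g x * indicator A x)) = (LINT x|M. indicator A x * cmod (f x))"
    by (intro Bochner_Integration.integral_cong) (auto simp: g_def indicator_def)
  finally show ?thesis by (simp add: mult.commute)
qed

lemma indicator_integral_le:
  assumes f: "f \<in> LF" and A: "A \<in> sets M"
  shows "cmod (LINT x|M. indicator A x * f x)
    \<le> measure M A powr (1 - 1 / p) * (LINT x|M. indicator A x * cmod (f x) powr p) powr (1 / p)"
proof -
  have "cmod (LINT x|M. indicator A x * f x) \<le> (LINT x|M. cmod (indicator A x * f x))"
    by (rule integral_norm_bound)
  also have "\<dots> = (LINT x|M. indicator A x * cmod (f x))"
    by (intro Bochner_Integration.integral_cong) (auto simp: indicator_def)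
  finally show ?thesis using indicator_integral_abs_le[OF f A] by linarith
qed

lemma integral_abs_le_Lp_seminorm:
  assumes f: "f \<in> LF"
  shows "(LINT x|M. cmod (f x)) \<le> snorm f"
proof -
  have "(LINT x|M. indicator (space M) x * cmod (f x)) = (LINT x|M. cmod (f x))"
    "(LINT x|M. indicator (space M) x * cmod (f x) powr p) = (LINT x|M. cmod (f x) powr p)"
    by (intro Bochner_Integration.integral_cong; simp)+
  then show ?thesis using indicator_integral_abs_le[OF f, of "space M"] by (simp add: Lp_seminorm_def prob_space)
qed

lemma integral_le_Lp_seminorm:
  assumes f: "f \<in> LF"
  shows "cmod (LINT x|M. f x) \<le> snorm f"
  using integral_norm_bound[of M f] integral_abs_le_Lp_seminorm[OF f] by linarith

text \<open>On a probability space the integral of the modulus is at most the seminorm. So the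
  moduli of the increments have a finite total integral, hence a finite sum almost everywhere, and
  the telescoping series converges absolutely there.\<close>

lemma Lp_cauchy_subseq_AE:
  fixes f :: "nat \<Rightarrow> 'x \<Rightarrow> complex"
  assumes f: "\<And>n. f n \<in> LF"
    and bound: "\<And>k. snorm (\<lambda>x. f (Suc k) x - f k x) \<le> (1 / 2) ^ k"
  shows "AE x in M. convergent (\<lambda>k. f k x)"
proof -
  define h where "h k = (\<lambda>x. f (Suc k) x - f k x)" for k
  have h: "h k \<in> LF" for k unfolding h_def by (rule Lp_functions_diff[OF f f])
  note mh = Lp_functionsD(1)[OF h]
  have "(\<integral>\<^sup>+x. (\<Sum>k. ennreal (cmod (h k x))) \<partial>M) = (\<Sum>k. \<integral>\<^sup>+x. ennreal (cmod (h k x)) \<partial>M)"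
    using mh by (intro nn_integral_suminf) auto
  also have "\<dots> \<le> (\<Sum>k. ennreal ((1 / 2) ^ k))"
  proof (intro suminf_le)
    fix k
    have "(\<integral>\<^sup>+x. ennreal (cmod (h k x)) \<partial>M) = ennreal (LINT x|M. cmod (h k x))"
      using Lp_integrable[OF h] by (intro nn_integral_eq_integral) auto
    also have "\<dots> \<le> ennreal ((1 / 2) ^ k)"
      using integral_abs_le_Lp_seminorm[OF h[of k]] bound[of k] unfolding h_def by (intro ennreal_leI) linarith
    finally show "(\<integral>\<^sup>+x. ennreal (cmod (h k x)) \<partial>M) \<le> ennreal ((1 / 2) ^ k)" .
  qed auto
  also have "\<dots> = ennreal (\<Sum>k. (1 / 2) ^ k)" by (intro suminf_ennreal2 summable_geometric) auto
  finally have "(\<integral>\<^sup>+x. (\<Sum>k. ennreal (cmod (h k x))) \<partial>M) \<noteq> \<infinity>" by (auto simp: top_unique)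
  then have "AE x in M. (\<Sum>k. ennreal (cmod (h k x))) \<noteq> \<infinity>"
    using mh by (intro nn_integral_PInf_AE) auto
  then show ?thesis
  proof eventually_elim
    fix x assume "(\<Sum>k. ennreal (cmod (h k x))) \<noteq> \<infinity>"
    then have "summable (\<lambda>k. cmod (h k x))" by (intro summable_suminf_not_top) auto
    then have "summable (\<lambda>k. h k x)" by (rule summable_norm_cancel)
    then have "convergent (\<lambda>n. \<Sum>k<n. h k x)" by (simp add: summable_iff_convergent)
    then have "convergent (\<lambda>n. f 0 x + (\<Sum>k<n. h k x))" by (intro convergent_add convergent_const)
    moreover have "f 0 x + (\<Sum>k<n. h k x) = f n x" for n
      by (simp add: h_def sum_lessThan_telescope[of "\<lambda>k. f k x"])
    ultimately show "convergent (\<lambda>k. f k x)" by simp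
  qed
qed

text \<open>Fatou's lemma for p-th powers. The bound is only asked from \<open>N\<close> on because
  the lemma is applied to tails of Cauchy sequences.\<close>

lemma Lp_fatou:
  fixes f :: "nat \<Rightarrow> 'x \<Rightarrow> complex"
  assumes f: "\<And>n. f n \<in> LF" and g: "g \<in> borel_measurable M"
    and lim: "AE x in M. (\<lambda>n. f n x) \<longlonglongrightarrow> g x"
    and bound: "\<And>n. n \<ge> N \<Longrightarrow> snorm (f n) \<le> B"
  shows "g \<in> LF" "snorm g \<le> B"
proof -
  have B: "0 \<le> B" using bound[of N] Lp_seminorm_nonneg[of p M "f N"] by linarith
  note mf = Lp_functionsD[OF f]
  have "(\<integral>\<^sup>+x. ennreal (cmod (g x) powr p) \<partial>M) = (\<integral>\<^sup>+x. liminf (\<lambda>n. ennreal (cmod (f n x) powr p)) \<partial>M)"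
  proof (rule nn_integral_cong_AE, use lim in eventually_elim)
    fix x assume "(\<lambda>n. f n x) \<longlonglongrightarrow> g x"
    then have "(\<lambda>n. cmod (f n x) powr p) \<longlonglongrightarrow> cmod (g x) powr p"
      using p_gt_1 by (intro tendsto_powr' tendsto_norm tendsto_const) auto
    then have "(\<lambda>n. ennreal (cmod (f n x) powr p)) \<longlonglongrightarrow> ennreal (cmod (g x) powr p)"
      by (rule tendsto_ennrealI)
    then show "ennreal (cmod (g x) powr p) = liminf (\<lambda>n. ennreal (cmod (f n x) powr p))"
      using lim_imp_Liminf[of sequentially] by (metis trivial_limit_sequentially)
  qed
  also have "\<dots> \<le> liminf (\<lambda>n. \<integral>\<^sup>+x. ennreal (cmod (f n x) powr p) \<partial>M)"
    using mf by (intro nn_integral_liminf) auto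
  also have "\<dots> \<le> ennreal (B powr p)"
  proof (rule Liminf_le, rule trivial_limit_sequentially)
    have "(\<integral>\<^sup>+x. ennreal (cmod (f n x) powr p) \<partial>M) \<le> ennreal (B powr p)" if "n \<ge> N" for n
    proof -
      have "(\<integral>\<^sup>+x. ennreal (cmod (f n x) powr p) \<partial>M) = ennreal (LINT x|M. cmod (f n x) powr p)"
        using mf by (intro nn_integral_eq_integral) auto
      also have "\<dots> \<le> ennreal (B powr p)"
        using bound[OF that] p_gt_1 by (intro ennreal_leI) (auto simp: simp flip: Lp_seminorm_powr intro!: powr_mono2)
      finally show ?thesis .
    qed
    then show "\<forall>\<^sub>F n in sequentially. (\<integral>\<^sup>+x. ennreal (cmod (f n x) powr p) \<partial>M) \<le> ennreal (B powr p)"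
      using eventually_sequentially by blast
  qed
  finally have *: "(\<integral>\<^sup>+x. ennreal (cmod (g x) powr p) \<partial>M) \<le> ennreal (B powr p)" .
  have I: "integrable M (\<lambda>x. cmod (g x) powr p)"
    by (rule integrableI_bounded) (use * g in \<open>auto simp: le_less_trans\<close>)
  with g show gL: "g \<in> LF" by (simp add: Lp_functions_def)
  have "ennreal (LINT x|M. cmod (g x) powr p) \<le> ennreal (B powr p)"
    using * I by (subst (asm) nn_integral_eq_integral) auto
  then show "snorm g \<le> B" using B by (intro Lp_seminorm_leI) (simp_all add: ennreal_le_iff)
qed

lemma mcomplete_Lp: "Lp.metric.mcomplete"
  unfolding Lp.mcomplete_iff
proof (intro allI impI, elim conjE)
  fix \<sigma> :: "nat \<Rightarrow> ('x \<Rightarrow> complex) set"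
  assume "range \<sigma> \<subseteq> carrier LP"
  then have "\<exists>f. f \<in> LF \<and> \<sigma> n = cls f" for n
    using carrier_Lp_cases[of "\<sigma> n"] by (metis rangeI subsetD)
  then obtain f where f: "\<And>n. f n \<in> LF" and \<sigma>: "\<And>n. \<sigma> n = cls (f n)" by metis
  have nrm: "nrm LP (\<sigma> m \<ominus>\<^bsub>LP\<^esub> \<sigma> n) = snorm (\<lambda>x. f m x - f n x)" for m n
    by (simp add: \<sigma> Lp_minus f Lp_nrm Lp_functions_diff)
  assume "\<forall>e>0. \<exists>N. \<forall>m\<ge>N. \<forall>n\<ge>N. nrm LP (\<sigma> m \<ominus>\<^bsub>LP\<^esub> \<sigma> n) < e"
  then have "\<exists>N. \<forall>m\<ge>N. \<forall>n\<ge>N. snorm (\<lambda>x. f m x - f n x) < (1 / 2) ^ k" for k :: nat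
    by (simp add: nrm)
  then obtain N where N: "\<And>k m n. m \<ge> N k \<Longrightarrow> n \<ge> N k \<Longrightarrow> snorm (\<lambda>x. f m x - f n x) < (1 / 2) ^ k"
    by metis
  \<comment> \<open>A monotone majorant of \<open>N\<close>: the index \<open>r j\<close> lies
    beyond \<open>N k\<close> for all \<open>k \<le> j\<close>, so consecutive terms of the
    subsequence are as close as required.\<close>
  define r where "r k = Max (N ` {..k})" for k
  have r: "N k \<le> r j" if "k \<le> j" for k j unfolding r_def using that by (intro Max_ge) auto
  \<comment> \<open>\<open>lim\<close> has a value at every point, so \<open>F\<close> is measurable
    before any convergence is known.\<close>
  define F where "F x = lim (\<lambda>k. f (r k) x)" for x
  have mF: "F \<in> borel_measurable M"
    unfolding F_def using Lp_functionsD(1)[OF f] by measurable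
  have "AE x in M. convergent (\<lambda>k. f (r k) x)"
  proof (rule Lp_cauchy_subseq_AE[OF f])
    show "snorm (\<lambda>x. f (r (Suc k)) x - f (r k) x) \<le> (1 / 2) ^ k" for k
      by (rule less_imp_le[OF N[OF r r]]) auto
  qed
  then have lim: "AE x in M. (\<lambda>k. f (r k) x) \<longlonglongrightarrow> F x"
    by eventually_elim (simp add: F_def convergent_LIMSEQ_iff)
  \<comment> \<open>The Cauchy estimate for \<open>f n\<close> and \<open>f (r j)\<close> passes to
    the limit in \<open>j\<close> by Fatou, so the whole sequence converges and not only the
    subsequence.\<close>
  have close: "(\<lambda>x. f n x - F x) \<in> LF" "snorm (\<lambda>x. f n x - F x) \<le> (1 / 2) ^ k"
    if "n \<ge> N k" for n k
  proof -
    have m: "(\<lambda>x. f n x - F x) \<in> borel_measurable M" using mF Lp_functionsD(1)[OF f] by auto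
    have l: "AE x in M. (\<lambda>j. f n x - f (r j) x) \<longlonglongrightarrow> f n x - F x"
      using lim by eventually_elim (intro tendsto_intros)
    have b: "snorm (\<lambda>x. f n x - f (r j) x) \<le> (1 / 2) ^ k" if "j \<ge> k" for j
      using N[OF \<open>n \<ge> N k\<close> r[OF that]] by simp
    show "(\<lambda>x. f n x - F x) \<in> LF" "snorm (\<lambda>x. f n x - F x) \<le> (1 / 2) ^ k"
      using Lp_fatou[OF Lp_functions_diff[OF f f] m l b] by auto
  qed
  have FL: "F \<in> LF"
    using Lp_functions_diff[OF f[of "N 0"] close(1)[OF order_refl, of 0]] by simp
  show "\<exists>l\<in>carrier LP. \<forall>e>0. \<exists>N. \<forall>n\<ge>N. nrm LP (\<sigma> n \<ominus>\<^bsub>LP\<^esub> l) < e"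
  proof (intro bexI[of _ "cls F"] allI impI)
    fix e :: real assume "e > 0"
    then obtain k where k: "(1 / 2) ^ k < e" using real_arch_pow_inv[of e "1 / 2"] by auto
    have "nrm LP (\<sigma> n \<ominus>\<^bsub>LP\<^esub> cls F) < e" if "n \<ge> N k" for n
      using close(2)[OF that] k by (simp add: \<sigma> Lp_minus f FL Lp_nrm Lp_functions_diff)
    then show "\<exists>N. \<forall>n\<ge>N. nrm LP (\<sigma> n \<ominus>\<^bsub>LP\<^esub> cls F) < e" by blast
  qed (use FL in auto)
qed

sublocale Lp: complex_banach_space "LP"
  by unfold_locales (rule mcomplete_Lp)

end

section \<open>Operators of finite rank\<close>

context Lp_prob_space
begin

lemma Lp_functions_sum:
  assumes "\<And>i. i \<in> I \<Longrightarrow> u i \<in> LF"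
  shows "(\<lambda>x. \<Sum>i\<in>I. a i * u i x) \<in> LF"
  using assms
proof (induction I rule: infinite_finite_induct)
  case (insert i I)
  then have "u i \<in> LF" "(\<lambda>x. \<Sum>i\<in>I. a i * u i x) \<in> LF" by auto
  from Lp_functions_add[OF Lp_functions_smult[OF this(1), of "a i"] this(2)] insert(1,2) show ?case by simp
qed (simp_all add: Lp_functions_zero)

lemma Lp_seminorm_zero [simp]: "snorm (\<lambda>_. 0) = 0"
  using p_gt_1 by (simp add: Lp_seminorm_def)

lemma Lp_seminorm_sum_le:
  assumes "\<And>i. i \<in> I \<Longrightarrow> u i \<in> LF"
  shows "snorm (\<lambda>x. \<Sum>i\<in>I. a i * u i x) \<le> (\<Sum>i\<in>I. cmod (a i) * snorm (u i))"
  using assms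
proof (induction I rule: infinite_finite_induct)
  case (insert i I)
  then have u: "u i \<in> LF" and s: "(\<lambda>x. \<Sum>i\<in>I. a i * u i x) \<in> LF"
    by (auto intro!: Lp_functions_sum)
  have "snorm (\<lambda>x. \<Sum>i\<in>insert i I. a i * u i x)
      = snorm (\<lambda>x. a i * u i x + (\<Sum>i\<in>I. a i * u i x))" using insert(1,2) by simp
  also have "\<dots> \<le> snorm (\<lambda>x. a i * u i x) + snorm (\<lambda>x. \<Sum>i\<in>I. a i * u i x)"
    by (rule Lp_seminorm_triangle[OF Lp_functions_smult[OF u] s])
  also have "\<dots> \<le> cmod (a i) * snorm (u i) + (\<Sum>i\<in>I. cmod (a i) * snorm (u i))"
    using insert by (simp add: Lp_seminorm_smult)
  finally show ?case using insert(1,2) by simp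
qed simp_all

text \<open>Meaningful only if \<open>T\<close> respects equality almost everywhere; otherwise the union need not be a class.\<close>

definition lift :: "(('x \<Rightarrow> complex) \<Rightarrow> 'x \<Rightarrow> complex) \<Rightarrow> ('x \<Rightarrow> complex) set \<Rightarrow> ('x \<Rightarrow> complex) set" where
  "lift T = (\<lambda>F\<in>carrier LP. \<Union>f\<in>F. cls (T f))"

lemma cball_finite_net:
  assumes "e > 0"
  obtains N where "finite N" "\<And>z::complex. cmod z \<le> C \<Longrightarrow> \<exists>w\<in>N. cmod (z - w) < e"
proof -
  obtain N where N: "finite N" "cball (0::complex) C \<subseteq> (\<Union>x\<in>N. ball x e)"
    using compact_cball[of "0::complex" C, unfolded compact_eq_totally_bounded, THEN conjunct2, rule_format, OF assms]
    by auto
  show ?thesis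
  proof (rule that[OF N(1)])
    fix z :: complex assume "cmod z \<le> C"
    then obtain w where "w \<in> N" "z \<in> ball w e" using N(2) by auto
    then show "\<exists>w\<in>N. cmod (z - w) < e" by (auto simp: dist_norm norm_minus_commute)
  qed
qed

end

text \<open>The functionals act on functions instead of classes, so that integrals can be used
  directly; \<open>\<phi>_cong\<close> is what lets the operator descend to classes. Both the rank
  one operators and the averaging operators are instances.\<close>

locale finite_rank = Lp_prob_space p M for p :: real and M :: "'x measure" +
  fixes n :: nat and \<phi> :: "nat \<Rightarrow> ('x \<Rightarrow> complex) \<Rightarrow> complex" and u :: "nat \<Rightarrow> 'x \<Rightarrow> complex" and C :: real
  assumes \<phi>_add: "\<And>i f g. i < n \<Longrightarrow> f \<in> LF \<Longrightarrow> g \<in> LF \<Longrightarrow> \<phi> i (\<lambda>x. f x + g x) = \<phi> i f + \<phi> i g"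
    and \<phi>_smult: "\<And>i f c. i < n \<Longrightarrow> f \<in> LF \<Longrightarrow> \<phi> i (\<lambda>x. c * f x) = c * \<phi> i f"
    and \<phi>_le: "\<And>i f. i < n \<Longrightarrow> f \<in> LF \<Longrightarrow> cmod (\<phi> i f) \<le> C * snorm f"
    and \<phi>_cong: "\<And>i f g. i < n \<Longrightarrow> f \<in> LF \<Longrightarrow> g \<in> LF \<Longrightarrow> AE x in M. f x = g x \<Longrightarrow> \<phi> i f = \<phi> i g"
    and u: "\<And>i. i < n \<Longrightarrow> u i \<in> LF"
    and C: "0 \<le> C"
begin

definition op_fun :: "('x \<Rightarrow> complex) \<Rightarrow> 'x \<Rightarrow> complex" where
  "op_fun f = (\<lambda>x. \<Sum>i<n. \<phi> i f * u i x)"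

lemma op_fun_Lp [simp]: "op_fun f \<in> LF"
  unfolding op_fun_def by (rule Lp_functions_sum) (simp add: u)

lemma lift_cls: 
  assumes f: "f \<in> LF"
  shows "lift op_fun (cls f) = cls (op_fun f)"
proof -
  have "cls (op_fun g) = cls (op_fun f)" if "g \<in> cls f" for g
  proof -
    have "\<phi> i g = \<phi> i f" if "i < n" for i
      using \<open>g \<in> cls f\<close> by (intro \<phi>_cong that) (auto simp: in_cls_iff)
    then show ?thesis by (simp add: op_fun_def)
  qed
  then have "(\<Union>g\<in>cls f. cls (op_fun g)) = cls (op_fun f)" using mem_cls[OF f] by blast
  then show ?thesis using f by (simp add: lift_def)
qed

lemma lift_linear: "lift op_fun \<in> linear_maps LP LP"
proof (rule linear_mapsI)
  show "lift op_fun \<in> extensional (carrier LP)" by (simp add: lift_def)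
  show "lift op_fun F \<in> carrier LP" if "F \<in> carrier LP" for F
    using that by (auto elim!: carrier_Lp_cases simp: lift_cls)
  show "lift op_fun (F \<oplus>\<^bsub>LP\<^esub> G) = lift op_fun F \<oplus>\<^bsub>LP\<^esub> lift op_fun G"
    if "F \<in> carrier LP" "G \<in> carrier LP" for F G
    using that
  proof (elim carrier_Lp_cases)
    fix f g assume fg: "f \<in> LF" "F = cls f" "g \<in> LF" "G = cls g"
    have "op_fun (\<lambda>x. f x + g x) = (\<lambda>x. op_fun f x + op_fun g x)"
      using fg by (simp add: op_fun_def \<phi>_add distrib_right sum.distrib)
    then show ?thesis using fg by (simp add: Lp_add lift_cls Lp_functions_add)
  qed
  show "lift op_fun (c \<odot>\<^bsub>LP\<^esub> F) = c \<odot>\<^bsub>LP\<^esub> lift op_fun F" if "F \<in> carrier LP" for c F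
    using that
  proof (elim carrier_Lp_cases)
    fix f assume f: "f \<in> LF" "F = cls f"
    have "op_fun (\<lambda>x. c * f x) = (\<lambda>x. c * op_fun f x)"
      using f by (simp add: op_fun_def \<phi>_smult sum_distrib_left mult.assoc)
    then show ?thesis using f by (simp add: Lp_smult lift_cls Lp_functions_smult)
  qed
qed

lemma lift_bounded: "lift op_fun \<in> bounded_ops LP LP"
proof (rule Lp.op.bounded_opsI[OF lift_linear])
  fix F assume "F \<in> carrier LP"
  then obtain f where f: "f \<in> LF" "F = cls f" by (rule carrier_Lp_cases)
  have "snorm (op_fun f) \<le> (\<Sum>i<n. cmod (\<phi> i f) * snorm (u i))"
    unfolding op_fun_def by (rule Lp_seminorm_sum_le) (simp add: u)
  also have "\<dots> \<le> (\<Sum>i<n. (C * snorm f) * snorm (u i))"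
    using f by (intro sum_mono mult_right_mono \<phi>_le) auto
  also have "\<dots> = (C * (\<Sum>i<n. snorm (u i))) * snorm f"
    by (simp add: sum_distrib_left sum_distrib_right mult_ac)
  finally show "nrm LP (lift op_fun F) \<le> (C * (\<Sum>i<n. snorm (u i))) * nrm LP F"
    using f by (simp add: lift_cls Lp_nrm)
qed

text \<open>On the unit ball the \<open>n\<close> coefficients stay in the disc of radius
  \<open>C\<close>. A finite net of that disc, chosen independently in every coordinate, gives a
  finite net of the image.\<close>

lemma lift_compact: "lift op_fun \<in> compact_ops LP"
proof (rule Lp.compact_opsI[OF lift_bounded])
  fix e :: real assume e: "e > 0"
  \<comment> \<open>The summand 1 makes \<open>U\<close> positive, and the final estimate by
    \<open>e / U * (U - 1)\<close> strict.\<close>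
  define U where "U = (\<Sum>i<n. snorm (u i)) + 1"
  have U: "U > 0" unfolding U_def by (intro add_nonneg_pos sum_nonneg) auto
  then have eU: "e / U > 0" using e by simp
  obtain N where N: "finite N" "\<And>z. cmod z \<le> C \<Longrightarrow> \<exists>w\<in>N. cmod (z - w) < e / U"
    using cball_finite_net[OF eU] by metis
  define H where "H = (\<lambda>w. cls (\<lambda>x. \<Sum>i<n. w i * u i x)) ` ({..<n} \<rightarrow>\<^sub>E N)"
  have sL: "(\<lambda>x. \<Sum>i<n. w i * u i x) \<in> LF" for w by (rule Lp_functions_sum) (simp add: u)
  have "\<exists>G\<in>H. nrm LP (lift op_fun F \<ominus>\<^bsub>LP\<^esub> G) < e" if F: "F \<in> closed_unit_ball LP" for F
  proof -
    obtain f where f: "f \<in> LF" "F = cls f"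
      using closed_unit_ballD(1)[OF F] by (rule carrier_Lp_cases)
    have f1: "snorm f \<le> 1" using closed_unit_ballD(2)[OF F] f by (simp add: Lp_nrm)
    have "cmod (\<phi> i f) \<le> C" if "i < n" for i
      using \<phi>_le[OF that f(1)] mult_left_mono[OF f1 C] by simp
    then have "\<forall>i\<in>{..<n}. \<exists>w\<in>N. cmod (\<phi> i f - w) < e / U" using N(2) by simp
    then obtain w where w: "\<And>i. i < n \<Longrightarrow> w i \<in> N \<and> cmod (\<phi> i f - w i) < e / U"
      using bchoice[of "{..<n}" "\<lambda>i w. w \<in> N \<and> cmod (\<phi> i f - w) < e / U"] by (auto simp: Bex_def)
    define w' where "w' = restrict w {..<n}"
    have "(\<lambda>x. op_fun f x - (\<Sum>i<n. w' i * u i x)) = (\<lambda>x. \<Sum>i<n. (\<phi> i f - w i) * u i x)"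
      by (simp add: op_fun_def w'_def left_diff_distrib sum_subtractf)
    then have "snorm (\<lambda>x. op_fun f x - (\<Sum>i<n. w' i * u i x))
        \<le> (\<Sum>i<n. cmod (\<phi> i f - w i) * snorm (u i))"
      using Lp_seminorm_sum_le[of "{..<n}" u "\<lambda>i. \<phi> i f - w i"] u by simp
    also have "\<dots> \<le> (\<Sum>i<n. e / U * snorm (u i))"
      using w by (intro sum_mono mult_right_mono) (auto simp: less_imp_le)
    also have "\<dots> = e / U * (U - 1)" by (simp add: U_def sum_distrib_left)
    also have "\<dots> < e" using U e by (simp add: field_simps)
    finally have "nrm LP (lift op_fun F \<ominus>\<^bsub>LP\<^esub> cls (\<lambda>x. \<Sum>i<n. w' i * u i x)) < e"
      using f sL by (simp add: lift_cls Lp_minus Lp_nrm Lp_functions_diff)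
    moreover have "cls (\<lambda>x. \<Sum>i<n. w' i * u i x) \<in> H"
      unfolding H_def w'_def using w by (intro imageI restrict_PiE_iff[THEN iffD2]) auto
    ultimately show ?thesis by blast
  qed
  moreover have "finite H" unfolding H_def using N(1) by (intro finite_imageI finite_PiE) auto
  moreover have "H \<subseteq> carrier LP" unfolding H_def using sL by auto
  ultimately show "\<exists>F. finite F \<and> F \<subseteq> carrier LP \<and>
      (\<forall>x\<in>closed_unit_ball LP. \<exists>y\<in>F. nrm LP (lift op_fun x \<ominus>\<^bsub>LP\<^esub> y) < e)"
    by (intro exI[of _ H]) simp
qed

end

context Lp_prob_space
begin

definition rank_one :: "('x \<Rightarrow> complex) \<Rightarrow> ('x \<Rightarrow> complex) set \<Rightarrow> ('x \<Rightarrow> complex) set" where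
  "rank_one u = lift (\<lambda>f x. (LINT y|M. f y) * u x)"

context
  fixes u :: "'x \<Rightarrow> complex"
  assumes u: "u \<in> LF"
begin

interpretation R: finite_rank p M "Suc 0" "\<lambda>_ f. LINT y|M. f y" "\<lambda>_. u" 1
  by unfold_locales (auto simp: u Lp_integrable integral_le_Lp_seminorm intro!: integral_cong_AE Lp_functionsD)

lemma rank_one_eq: "rank_one u = lift R.op_fun"
proof -
  have "R.op_fun = (\<lambda>f x. (LINT y|M. f y) * u x)" by (simp add: R.op_fun_def fun_eq_iff)
  then show ?thesis by (simp add: rank_one_def)
qed

lemma rank_one_compact: "rank_one u \<in> compact_ops LP"
  unfolding rank_one_eq by (rule R.lift_compact)

lemma rank_one_cls: "f \<in> LF \<Longrightarrow> rank_one u (cls f) = cls (\<lambda>x. (LINT y|M. f y) * u x)"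
  unfolding rank_one_eq by (simp add: R.lift_cls R.op_fun_def)

lemma rank_one_norm_le: "op_norm LP LP (rank_one u) \<le> snorm u"
proof (rule Lp.op.op_norm_le_mult)
  fix F assume "F \<in> carrier LP"
  then obtain f where f: "f \<in> LF" "F = cls f" by (rule carrier_Lp_cases)
  show "nrm LP (rank_one u F) \<le> snorm u * nrm LP F"
    using f u mult_right_mono[OF integral_le_Lp_seminorm[OF f(1)], of "snorm u"]
    by (simp add: rank_one_cls Lp_nrm Lp_functions_smult Lp_seminorm_smult) (simp add: mult.commute)
qed (use bounded_ops_linear[OF Lp.compact_ops_bounded[OF rank_one_compact]] in auto)

end

end

section \<open>Averaging over a partition\<close>

locale equipartition = Lp_prob_space p M for p :: real and M :: "'x measure" +
  fixes n :: nat and A :: "nat \<Rightarrow> 'x set"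
  assumes n_pos: "0 < n"
    and A_sets: "\<And>i. i < n \<Longrightarrow> A i \<in> sets M"
    and A_disjoint: "\<And>i j. i < n \<Longrightarrow> j < n \<Longrightarrow> i \<noteq> j \<Longrightarrow> A i \<inter> A j = {}"
    and A_measure: "\<And>i. i < n \<Longrightarrow> measure M (A i) = 1 / real n"
begin

definition cell :: "nat \<Rightarrow> ('x \<Rightarrow> complex) \<Rightarrow> complex" where
  "cell i f = (LINT x|M. indicator (A i) x * f x)"

definition step :: "(nat \<Rightarrow> complex) \<Rightarrow> 'x \<Rightarrow> complex" where
  "step c = (\<lambda>x. \<Sum>i<n. c i * indicator (A i) x)"

definition avg :: "('x \<Rightarrow> complex) \<Rightarrow> 'x \<Rightarrow> complex" where
  "avg f = step (\<lambda>i. of_nat n * cell i f)"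

lemma step_in: "i < n \<Longrightarrow> x \<in> A i \<Longrightarrow> step c x = c i"
proof -
  assume i: "i < n" "x \<in> A i"
  have "step c x = (\<Sum>j<n. if j = i then c i else 0)"
    unfolding step_def using A_disjoint[of i] i by (intro sum.cong) (auto simp: indicator_def)
  then show ?thesis using i by simp
qed

lemma step_notin: "(\<And>i. i < n \<Longrightarrow> x \<notin> A i) \<Longrightarrow> step c x = 0"
  unfolding step_def by (intro sum.neutral) simp

text \<open>At a point off all cells the step function is 0 and the sum on the right is empty of
  nonzero terms, which is why \<open>h 0 = 0\<close> is assumed.\<close>

lemma step_comp:
  assumes "h 0 = 0"
  shows "(h (step c x) :: 'b :: comm_semiring_1) = (\<Sum>i<n. h (c i) * indicator (A i) x)"
proof (cases "\<exists>i<n. x \<in> A i")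
  case True
  then obtain i where i: "i < n" "x \<in> A i" by blast
  have "(\<Sum>j<n. h (c j) * indicator (A j) x) = (\<Sum>j<n. if j = i then h (c i) else 0)"
    using A_disjoint[of i] i by (intro sum.cong) (auto simp: indicator_def)
  then show ?thesis using i by (simp add: step_in[OF i])
next
  case False
  then have "step c x = 0" "(\<Sum>i<n. h (c i) * indicator (A i) x) = 0"
    by (auto intro!: step_notin sum.neutral)
  then show ?thesis using assms by simp
qed

lemma step_measurable [measurable]: "step c \<in> borel_measurable M"
  unfolding step_def
  by (intro borel_measurable_sum borel_measurable_times borel_measurable_const borel_measurable_indicator A_sets) simp

lemma step_bound: "(\<And>i. i < n \<Longrightarrow> cmod (c i) \<le> C) \<Longrightarrow> 0 \<le> C \<Longrightarrow> cmod (step c x) \<le> C"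
  using step_in[of _ x c] step_notin[of x c] by (cases "\<exists>i<n. x \<in> A i") auto

lemma step_Lp [simp]: "step c \<in> LF"
proof (rule Lp_functions_bounded[OF step_measurable])
  show "AE x in M. cmod (step c x) \<le> (\<Sum>i<n. cmod (c i))"
    by (intro AE_I2 step_bound member_le_sum sum_nonneg) auto
qed

lemma avg_Lp [simp]: "avg f \<in> LF"
  by (simp add: avg_def)

text \<open>Covering is not an axiom of the locale: \<open>n\<close> disjoint cells of measure
  \<open>1 / n\<close> have a union of measure 1. On the unit interval the half-open cells miss the
  endpoint 1.\<close>

lemma A_cover: "AE x in M. \<exists>i<n. x \<in> A i"
proof -
  have "prob (\<Union>i<n. A i) = (\<Sum>i<n. prob (A i))"
    using A_sets A_disjoint by (intro finite_measure_finite_Union) (auto simp: disjoint_family_on_def)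
  also have "\<dots> = 1" using A_measure n_pos by simp
  finally have "AE x in M. x \<in> (\<Union>i<n. A i)" using A_sets by (intro AE_prob_1) auto
  then show ?thesis by eventually_elim auto
qed

lemma indicator_mult_integrable:
  fixes f :: "'x \<Rightarrow> 'b :: {real_normed_algebra_1, second_countable_topology, banach}"
  shows "i < n \<Longrightarrow> integrable M f \<Longrightarrow> integrable M (\<lambda>x. indicator (A i) x * f x)"
proof -
  assume i: "i < n" and f: "integrable M f"
  have "(\<lambda>x. indicator (A i) x * f x) = (\<lambda>x. indicat_real (A i) x *\<^sub>R f x)"
    by (rule ext) (simp add: indicator_def)
  then show ?thesis using integrable_mult_indicator[OF A_sets[OF i] f] by simp
qed

lemma integral_cells:
  fixes f :: "'x \<Rightarrow> 'b :: {real_normed_algebra_1, second_countable_topology, banach}"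
  assumes f: "integrable M f"
  shows "(LINT x|M. f x) = (\<Sum>i<n. LINT x|M. indicator (A i) x * f x)"
proof -
  have "(LINT x|M. f x) = (LINT x|M. (\<Sum>i<n. indicator (A i) x * f x))"
  proof (rule integral_cong_AE)
    show "(\<lambda>x. \<Sum>i<n. indicator (A i) x * f x) \<in> borel_measurable M"
      using indicator_mult_integrable[OF _ f] by (intro borel_measurable_sum) auto
    show "AE x in M. f x = (\<Sum>i<n. indicator (A i) x * f x)"
      using A_cover
    proof eventually_elim
      fix x assume "\<exists>i<n. x \<in> A i"
      then obtain i where i: "i < n" "x \<in> A i" by blast
      have "(\<Sum>j<n. indicator (A j) x * f x) = (\<Sum>j<n. if j = i then f x else 0)"
        using A_disjoint[of i] i by (intro sum.cong) (auto simp: indicator_def)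
      then show "f x = (\<Sum>i<n. indicator (A i) x * f x)" using i by simp
    qed
    show "f \<in> borel_measurable M" using f by (rule borel_measurable_integrable)
  qed
  also have "\<dots> = (\<Sum>i<n. LINT x|M. indicator (A i) x * f x)"
    using indicator_mult_integrable[OF _ f] by (intro Bochner_Integration.integral_sum) auto
  finally show ?thesis .
qed

lemma integral_step:
  assumes h: "h 0 = (0 :: real)"
  shows "integrable M (\<lambda>x. h (step c x))" "(LINT x|M. h (step c x)) = (\<Sum>i<n. h (c i)) / real n"
proof -
  have *: "(\<lambda>x. h (step c x)) = (\<lambda>x. \<Sum>i<n. h (c i) * indicator (A i) x)"
    by (rule ext) (rule step_comp, rule h)
  have I: "i < n \<Longrightarrow> integrable M (\<lambda>x. h (c i) * indicator (A i) x)" for i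
    using A_sets[of i] by (simp add: emeasure_eq_measure)
  show "integrable M (\<lambda>x. h (step c x))" unfolding * by (intro Bochner_Integration.integrable_sum I) simp
  have "(LINT x|M. h (step c x)) = (\<Sum>i<n. LINT x|M. h (c i) * indicator (A i) x)"
    unfolding * by (intro Bochner_Integration.integral_sum I) simp
  also have "\<dots> = (\<Sum>i<n. h (c i) * (1 / real n))"
    by (intro sum.cong refl) (simp add: A_sets A_measure)
  finally show "(LINT x|M. h (step c x)) = (\<Sum>i<n. h (c i)) / real n" by (simp add: sum_divide_distrib)
qed

lemma cell_add: "i < n \<Longrightarrow> f \<in> LF \<Longrightarrow> g \<in> LF \<Longrightarrow> cell i (\<lambda>x. f x + g x) = cell i f + cell i g"
  unfolding cell_def distrib_left
  by (intro Bochner_Integration.integral_add indicator_mult_integrable Lp_integrable)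

lemma cell_smult: "cell i (\<lambda>x. c * f x) = c * cell i f"
proof -
  have "cell i (\<lambda>x. c * f x) = (LINT x|M. c * (indicator (A i) x * f x))"
    unfolding cell_def by (intro Bochner_Integration.integral_cong refl mult.left_commute)
  then show ?thesis by (simp only: cell_def integral_mult_right_zero)
qed

lemma cell_diff: "i < n \<Longrightarrow> f \<in> LF \<Longrightarrow> g \<in> LF \<Longrightarrow> cell i (\<lambda>x. f x - g x) = cell i f - cell i g"
  unfolding cell_def right_diff_distrib
  by (intro Bochner_Integration.integral_diff indicator_mult_integrable Lp_integrable)

lemma cell_le:
  assumes i: "i < n" and f: "f \<in> LF"
  shows "cmod (cell i f) powr p \<le> (1 / real n) powr (p - 1) * (LINT x|M. indicator (A i) x * cmod (f x) powr p)"
proof -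
  have nn: "0 \<le> (LINT x|M. indicator (A i) x * cmod (f x) powr p)" by (intro integral_nonneg_AE) auto
  have "cmod (cell i f) powr p \<le>
     ((1 / real n) powr (1 - 1 / p) * (LINT x|M. indicator (A i) x * cmod (f x) powr p) powr (1 / p)) powr p"
    using indicator_integral_le[OF f A_sets[OF i]] A_measure[OF i] p_gt_1
    by (intro powr_mono2) (auto simp: cell_def)
  also have "\<dots> = (1 / real n) powr (p - 1) * (LINT x|M. indicator (A i) x * cmod (f x) powr p)"
    using p_gt_1 nn by (simp add: powr_mult powr_powr left_diff_distrib)
  finally show ?thesis .
qed

lemma cell_step: "i < n \<Longrightarrow> cell i (step c) = c i / of_nat n"
proof -
  assume i: "i < n"
  have "cell i (step c) = (LINT x|M. c i * indicator (A i) x)"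
    unfolding cell_def
    by (intro Bochner_Integration.integral_cong refl) (auto simp: indicator_def step_in[OF i])
  also have "\<dots> = c i * (LINT x|M. indicator (A i) x)" by simp
  also have "(LINT x|M. (indicator (A i) x :: complex)) = (LINT x|M. of_real (indicator (A i) x))"
    by (intro Bochner_Integration.integral_cong refl) (auto simp: indicator_def)
  also have "\<dots> = of_real (measure M (A i))" using A_sets[OF i] by simp
  finally show ?thesis using A_measure[OF i] by simp
qed

lemma cell_avg: "i < n \<Longrightarrow> cell i (avg f) = cell i f"
  using n_pos by (simp add: avg_def cell_step)

lemma cell_abs_le:
  assumes i: "i < n" and f: "f \<in> LF"
  shows "cmod (cell i f) \<le> snorm f"
proof -
  have "cmod (cell i f) \<le> snorm (\<lambda>x. indicator (A i) x * f x)"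
    unfolding cell_def by (rule integral_le_Lp_seminorm[OF Lp_functions_indicator[OF f A_sets[OF i]]])
  also have "\<dots> \<le> snorm f"
  proof (rule Lp_seminorm_leI)
    have "(LINT x|M. cmod (indicator (A i) x * f x) powr p) \<le> (LINT x|M. cmod (f x) powr p)"
      using Lp_functionsD(2)[OF f] Lp_functionsD(2)[OF Lp_functions_indicator[OF f A_sets[OF i]]]
      by (intro integral_mono) (auto simp: indicator_def)
    then show "(LINT x|M. cmod (indicator (A i) x * f x) powr p) \<le> snorm f powr p"
      by (simp add: Lp_seminorm_powr)
  qed simp
  finally show ?thesis .
qed

text \<open>The average over a cell is \<open>n\<close> times its integral. The resulting factor
  n^(p-1) is cancelled exactly by the factor (1/n)^(p-1) that Hoelder gives in
  \<open>cell_le\<close>.\<close>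

lemma avg_contractive:
  assumes f: "f \<in> LF"
  shows "snorm (avg f) \<le> snorm f"
proof (rule Lp_seminorm_leI)
  have "(LINT x|M. cmod (avg f x) powr p) = (\<Sum>i<n. cmod (of_nat n * cell i f) powr p) / real n"
    unfolding avg_def using p_gt_1 by (subst integral_step) auto
  also have "\<dots> = (\<Sum>i<n. real n powr (p - 1) * cmod (cell i f) powr p)"
    using n_pos by (simp add: norm_mult powr_mult sum_divide_distrib powr_diff)
  also have "\<dots> \<le> (\<Sum>i<n. LINT x|M. indicator (A i) x * cmod (f x) powr p)"
  proof (rule sum_mono)
    fix i assume "i \<in> {..<n}"
    then have "real n powr (p - 1) * cmod (cell i f) powr p
      \<le> real n powr (p - 1) * ((1 / real n) powr (p - 1) * (LINT x|M. indicator (A i) x * cmod (f x) powr p))"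
      using cell_le[OF _ f, of i] by (intro mult_left_mono) auto
    then show "real n powr (p - 1) * cmod (cell i f) powr p \<le> (LINT x|M. indicator (A i) x * cmod (f x) powr p)"
      using n_pos by (simp add: powr_divide)
  qed
  also have "\<dots> = snorm f powr p"
    using integral_cells[OF Lp_functionsD(2)[OF f]] by (simp add: Lp_seminorm_powr)
  finally show "(LINT x|M. cmod (avg f x) powr p) \<le> snorm f powr p" .
qed simp

lemma avg_diff: "f \<in> LF \<Longrightarrow> g \<in> LF \<Longrightarrow> avg (\<lambda>x. f x - g x) = (\<lambda>x. avg f x - avg g x)"
  unfolding avg_def step_def sum_subtractf[symmetric]
  by (intro ext sum.cong refl) (simp only: cell_diff right_diff_distrib left_diff_distrib lessThan_iff)

lemma integral_step_mult:
  assumes w: "integrable M w"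
  shows "(LINT x|M. step c x * w x) = (\<Sum>i<n. c i * cell i w)"
proof -
  have "(LINT x|M. step c x * w x) = (LINT x|M. (\<Sum>i<n. c i * (indicator (A i) x * w x)))"
    unfolding step_def sum_distrib_right mult.assoc ..
  also have "\<dots> = (\<Sum>i<n. LINT x|M. c i * (indicator (A i) x * w x))"
    by (intro Bochner_Integration.integral_sum integrable_mult_right indicator_mult_integrable w) simp
  finally show ?thesis by (simp add: cell_def)
qed

text \<open>The crude bound \<open>real n\<close> is enough for compactness; the sharp bound 1 for
  the operator comes from \<open>avg_contractive\<close>.\<close>

sublocale E: finite_rank p M n "\<lambda>i f. of_nat n * cell i f" "\<lambda>i. indicator (A i)" "real n"
proof
  show "of_nat n * cell i f = of_nat n * cell i g"
    if "i < n" "f \<in> LF" "g \<in> LF" "AE x in M. f x = g x" for i f g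
    unfolding cell_def using that A_sets[of i]
    by (intro arg_cong[where f = "\<lambda>x. of_nat n * x"] integral_cong_AE borel_measurable_times
        Lp_functionsD(1)[OF that(2)] Lp_functionsD(1)[OF that(3)]) auto
  show "indicator (A i) \<in> LF" if "i < n" for i
    using A_sets[OF that] by (intro Lp_functions_bounded[where C = 1]) (auto simp: indicator_def)
  show "of_nat n * cell i (\<lambda>x. f x + g x) = of_nat n * cell i f + of_nat n * cell i g"
    if "i < n" "f \<in> LF" "g \<in> LF" for i f g
    by (simp only: cell_add[OF that] distrib_left)
  show "of_nat n * cell i (\<lambda>x. c * f x) = c * (of_nat n * cell i f)" for i f c
    by (simp only: cell_smult mult.left_commute)
  show "cmod (of_nat n * cell i f) \<le> real n * snorm f" if "i < n" "f \<in> LF" for i f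
    using mult_left_mono[OF cell_abs_le[OF that], of "real n"] by (simp add: norm_mult)
qed simp

lemma E_op_fun: "E.op_fun = avg"
  by (rule ext) (simp only: E.op_fun_def avg_def step_def)

definition cond_exp_op :: "('x \<Rightarrow> complex) set \<Rightarrow> ('x \<Rightarrow> complex) set" where
  "cond_exp_op = lift avg"

lemma cond_exp_op_cls: "f \<in> LF \<Longrightarrow> cond_exp_op (cls f) = cls (avg f)"
  unfolding cond_exp_op_def by (rule E.lift_cls[unfolded E_op_fun])

lemma cond_exp_op_compact: "cond_exp_op \<in> compact_ops LP"
  unfolding cond_exp_op_def by (rule E.lift_compact[unfolded E_op_fun])

lemma cond_exp_op_norm: "op_norm LP LP cond_exp_op \<le> 1"
proof (rule Lp.op.op_norm_le_mult)
  show "cond_exp_op \<in> linear_maps LP LP"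
    by (rule bounded_ops_linear[OF Lp.compact_ops_bounded[OF cond_exp_op_compact]])
  show "nrm LP (cond_exp_op F) \<le> 1 * nrm LP F" if F: "F \<in> carrier LP" for F
  proof -
    obtain f where f: "f \<in> LF" "F = cls f"
      using F by (rule carrier_Lp_cases)
    show ?thesis
      using avg_contractive[OF f(1)] unfolding f(2) by (simp add: cond_exp_op_cls f(1) Lp_nrm)
  qed
qed simp

end

section \<open>The unit interval\<close>

lemma (in equipartition) avg_close:
  assumes i: "i < n" "x \<in> A i" and h: "integrable M h" and e: "\<And>y. y \<in> A i \<Longrightarrow> cmod (h y - h x) \<le> e"
  shows "cmod (avg h x - h x) \<le> e"
proof -
  have int1: "integrable M (\<lambda>y. indicator (A i) y * (h y - h x))"
    using h by (intro indicator_mult_integrable[OF i(1)]) auto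
  have "(LINT y|M. indicator (A i) y * (h y - h x)) = cell i h - cell i (\<lambda>_. h x)"
    unfolding cell_def right_diff_distrib
    using h by (intro Bochner_Integration.integral_diff indicator_mult_integrable[OF i(1)]) auto
  also have "cell i (\<lambda>_. h x) = cell i (step (\<lambda>_. h x))"
    unfolding cell_def by (intro Bochner_Integration.integral_cong) (auto simp: indicator_def step_in[OF i(1)])
  also have "\<dots> = h x / of_nat n" by (rule cell_step[OF i(1)])
  finally have "avg h x - h x = of_nat n * (LINT y|M. indicator (A i) y * (h y - h x))"
    using n_pos by (simp add: avg_def step_in[OF i] right_diff_distrib)
  then have "cmod (avg h x - h x) = real n * cmod (LINT y|M. indicator (A i) y * (h y - h x))"
    by (simp add: norm_mult)
  also have "\<dots> \<le> real n * (LINT y|M. e * indicator (A i) y)"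
  proof (intro mult_left_mono)
    have "cmod (LINT y|M. indicator (A i) y * (h y - h x)) \<le> (LINT y|M. cmod (indicator (A i) y * (h y - h x)))"
      by (rule integral_norm_bound)
    also have "\<dots> \<le> (LINT y|M. e * indicator (A i) y)"
    proof (rule integral_mono)
      show "integrable M (\<lambda>y. e * indicator (A i) y)"
        using A_sets[OF i(1)] by (intro integrable_mult_right) (simp add: emeasure_eq_measure)
      show "cmod (indicator (A i) y * (h y - h x)) \<le> e * indicator (A i) y" for y
        using e[of y] by (auto simp: indicator_def)
    qed (use int1 in simp)
    finally show "cmod (LINT y|M. indicator (A i) y * (h y - h x)) \<le> (LINT y|M. e * indicator (A i) y)" .
  qed simp
  also have "\<dots> = e" using A_sets[OF i(1)] A_measure[OF i(1)] n_pos by simp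
  finally show ?thesis .
qed

section \<open>Dominated convergence and density of the continuous functions\<close>

lemma (in Lp_prob_space) Lp_seminorm_dominated_convergence:
  assumes m: "\<And>k. f k \<in> borel_measurable M" "g \<in> borel_measurable M"
    and w: "integrable M (\<lambda>x. w x powr p)"
    and dom: "\<And>k. AE x in M. cmod (f k x - g x) \<le> w x"
    and lim: "AE x in M. (\<lambda>k. f k x) \<longlonglongrightarrow> g x"
  shows "(\<lambda>k. snorm (\<lambda>x. f k x - g x)) \<longlonglongrightarrow> 0"
proof -
  have "(\<lambda>k. LINT x|M. cmod (f k x - g x) powr p) \<longlonglongrightarrow> (LINT x|M. 0)"
  proof (rule integral_dominated_convergence[OF _ _ w])
    show "AE x in M. (\<lambda>k. cmod (f k x - g x) powr p) \<longlonglongrightarrow> 0"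
      using lim
    proof eventually_elim
      fix x assume "(\<lambda>k. f k x) \<longlonglongrightarrow> g x"
      then have "(\<lambda>k. cmod (f k x - g x)) \<longlonglongrightarrow> 0" by (intro tendsto_norm_zero) (simp add: LIM_zero)
      then have "(\<lambda>k. cmod (f k x - g x) powr p) \<longlonglongrightarrow> 0 powr p"
        using p_gt_1 by (intro tendsto_powr' tendsto_const) auto
      then show "(\<lambda>k. cmod (f k x - g x) powr p) \<longlonglongrightarrow> 0" by simp
    qed
    show "AE x in M. norm (cmod (f k x - g x) powr p) \<le> w x powr p" for k
      using dom[of k] by eventually_elim (auto intro!: powr_mono2 simp: less_imp_le[OF p_pos])
  qed (use m in measurable)
  then have "(\<lambda>k. (LINT x|M. cmod (f k x - g x) powr p) powr (1 / p)) \<longlonglongrightarrow> 0 powr (1 / p)"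
    using p_gt_1 by (intro tendsto_powr' tendsto_const) (auto intro!: always_eventually)
  then show ?thesis by (simp add: Lp_seminorm_def)
qed

text \<open>For \<open>C > 0\<close> this is the radial retraction of the plane onto the closed disc
  of radius \<open>C\<close>.\<close>

definition clip :: "real \<Rightarrow> complex \<Rightarrow> complex" where
  "clip C z = z / of_real (max 1 (cmod z / C))"

lemma clip_le: "0 < C \<Longrightarrow> cmod (clip C z) \<le> C"
  by (auto simp: clip_def norm_divide max_def field_simps)

lemma clip_eq: "0 < C \<Longrightarrow> cmod z \<le> C \<Longrightarrow> clip C z = z"
  by (simp add: clip_def max_def field_simps)

lemma clip_diff_le:
  assumes "0 < C" shows "cmod (clip C z - z) \<le> cmod z"
proof -
  define t where "t = 1 / max 1 (cmod z / C)"
  have t: "0 \<le> t" "t \<le> 1" unfolding t_def by (auto simp: max_def)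
  have "clip C z - z = of_real (t - 1) * z" by (simp add: clip_def t_def left_diff_distrib)
  then have "cmod (clip C z - z) = (1 - t) * cmod z" using t by (simp only: norm_mult norm_of_real) simp
  also have "\<dots> \<le> 1 * cmod z" using t by (intro mult_right_mono) auto
  finally show ?thesis by simp
qed

lemma continuous_on_clip: "continuous_on UNIV (clip C)"
proof -
  have "max 1 t \<noteq> 0" for t :: real by (simp add: max_def)
  then show ?thesis unfolding clip_def divide_inverse
    by (intro continuous_intros) (simp only: of_real_eq_0_iff simp_thms ball_simps)
qed

lemma clip_measurable [measurable]: "clip C \<in> borel_measurable borel"
  by (rule borel_measurable_continuous_onI[OF continuous_on_clip])

abbreviation unit_interval :: "real measure" where "unit_interval \<equiv> lebesgue_on {0..1}"

lemma prob_space_unit_interval: "prob_space unit_interval"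
  by (rule prob_spaceI) (simp add: emeasure_restrict_space space_restrict_space)

locale Lp_unit_interval = Lp_space p unit_interval for p :: real
begin

sublocale Lp_prob_space p unit_interval
  by (simp add: Lp_prob_space_def prob_space_unit_interval Lp_space_axioms)

lemma measure_Ico:
  assumes "0 \<le> a" "a \<le> b" "b \<le> 1"
  shows "{a..<b} \<in> sets unit_interval" "measure unit_interval {a..<b} = b - a"
proof -
  have "{a..<b} \<subseteq> {0..1}" using assms by auto
  then show "{a..<b} \<in> sets unit_interval" "measure unit_interval {a..<b} = b - a"
    using assms by (auto simp: sets_restrict_space measure_restrict_space intro!: image_eqI[of _ _ "{a..<b}"])
qed

text \<open>Dominated convergence is used twice: \<open>f\<close> is first replaced by its
  truncation at a level \<open>C\<close>, and the truncation is then approximated by continuous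
  functions truncated at the same level, which makes a constant the dominating function.\<close>

lemma continuous_dense:
  assumes f: "f \<in> LF" and e: "0 < e"
  obtains h where "continuous_on UNIV h" "h \<in> LF"
    "snorm (\<lambda>x. h x - f x) < e"
proof -
  note mf = Lp_functionsD(1)[OF f]
  have "(\<lambda>k. snorm (\<lambda>x. clip (real (Suc k)) (f x) - f x)) \<longlonglongrightarrow> 0"
  proof (rule Lp_seminorm_dominated_convergence[OF _ _ Lp_functionsD(2)[OF f]])
    show "AE x in unit_interval. cmod (clip (real (Suc k)) (f x) - f x) \<le> cmod (f x)" for k
      by (intro AE_I2 clip_diff_le) simp
    show "AE x in unit_interval. (\<lambda>k. clip (real (Suc k)) (f x)) \<longlonglongrightarrow> f x"
    proof (intro AE_I2 tendsto_eventually)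
      fix x
      obtain K where K: "cmod (f x) \<le> real K" using real_arch_simple by blast
      have "clip (real (Suc k)) (f x) = f x" if "k \<ge> K" for k using K that by (intro clip_eq) auto
      then show "\<forall>\<^sub>F k in sequentially. clip (real (Suc k)) (f x) = f x"
        using eventually_sequentially by blast
    qed
  qed (use mf in measurable)
  then obtain k where k: "snorm (\<lambda>x. clip (real (Suc k)) (f x) - f x) < e / 2"
    using e LIMSEQ_D[of _ 0 "e / 2"] by fastforce
  define C where "C = real (Suc k)"
  have C: "0 < C" by (simp add: C_def)
  have clipL: "(\<lambda>x. clip C (g x)) \<in> LF" if "g \<in> borel_measurable unit_interval" for g
    using that by (intro Lp_functions_bounded[where C = C] AE_I2 clip_le C) measurable
  \<comment> \<open>Measurability in the sense of \<open>measurable_on\<close> provides continuous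
    functions on the line that converge to \<open>f\<close> off a negligible set.\<close>
  have "f measurable_on {0..1}"
    using mf by (subst measurable_on_iff_borel_measurable) auto
  then obtain N g where N: "negligible N" and g: "\<And>n. continuous_on UNIV (g n)"
    and lim: "\<And>x. x \<notin> N \<Longrightarrow> (\<lambda>n. g n x) \<longlonglongrightarrow> (if x \<in> {0..1} then f x else 0)"
    unfolding measurable_on_def by blast
  have mg: "g n \<in> borel_measurable unit_interval" for n
    using borel_measurable_continuous_onI[OF g[of n]] by (intro measurable_restrict_space1 measurable_completion) simp
  have N0: "AE x in unit_interval. x \<notin> N"
    using N by (intro AE_restrict_space_iff[THEN iffD2] AE_I') (auto simp: negligible_iff_null_sets)
  have "(\<lambda>n. snorm (\<lambda>x. clip C (g n x) - clip C (f x))) \<longlonglongrightarrow> 0"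
  proof (rule Lp_seminorm_dominated_convergence)
    show "integrable unit_interval (\<lambda>x. (2 * C) powr p)" by simp
    have "cmod (clip C (g n x) - clip C (f x)) \<le> 2 * C" for n x
      using norm_triangle_ineq4[of "clip C (g n x)" "clip C (f x)"] clip_le[OF C, of "g n x"] clip_le[OF C, of "f x"] by linarith
    then show "AE x in unit_interval. cmod (clip C (g n x) - clip C (f x)) \<le> 2 * C" for n by simp
    show "AE x in unit_interval. (\<lambda>n. clip C (g n x)) \<longlonglongrightarrow> clip C (f x)"
      using N0 AE_space
    proof eventually_elim
      fix x assume "x \<notin> N" "x \<in> space unit_interval"
      then have "(\<lambda>n. g n x) \<longlonglongrightarrow> f x" using lim[of x] by (simp add: space_restrict_space)
      moreover have "isCont (clip C) (f x)"
        using continuous_on_clip by (simp add: continuous_on_eq_continuous_at)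
      ultimately show "(\<lambda>n. clip C (g n x)) \<longlonglongrightarrow> clip C (f x)"
        by (intro isCont_tendsto_compose[where g = "clip C"])
    qed
  qed (use mf mg in measurable)
  then obtain n where n: "snorm (\<lambda>x. clip C (g n x) - clip C (f x)) < e / 2"
    using e LIMSEQ_D[of _ 0 "e / 2"] by fastforce
  show ?thesis
  proof (rule that)
    show "continuous_on UNIV (\<lambda>x. clip C (g n x))"
      by (rule continuous_on_compose2[OF continuous_on_clip g]) simp
    have "snorm (\<lambda>x. (clip C (g n x) - clip C (f x)) + (clip C (f x) - f x))
       \<le> snorm (\<lambda>x. clip C (g n x) - clip C (f x)) + snorm (\<lambda>x. clip C (f x) - f x)"
      by (intro Lp_seminorm_triangle Lp_functions_diff clipL mg mf f)
    then show "snorm (\<lambda>x. clip C (g n x) - f x) < e" using n k by (simp add: C_def)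
  qed (rule clipL[OF mg])
qed

text \<open>An even number of cells makes 1/2 a division point, so each mesh refines the two halves
  of the interval, which form the mesh of index 0. Passing from \<open>m\<close> to
  \<open>Suc (2 * m)\<close> cuts every cell in two.\<close>

definition mesh :: "nat \<Rightarrow> nat" where "mesh m = 2 * Suc m"

definition mesh_cell :: "nat \<Rightarrow> nat \<Rightarrow> real set" where
  "mesh_cell m i = {real i / real (mesh m)..<real (Suc i) / real (mesh m)}"

lemma mesh_pos: "0 < mesh m" by (simp add: mesh_def)

sublocale mesh: equipartition p unit_interval "mesh m" "mesh_cell m" for m
proof
  have le: "real (Suc i) / real (mesh m) \<le> 1" if "i < mesh m" for i
    using that by (simp add: divide_le_eq mesh_def del: of_nat_Suc)
  show "mesh_cell m i \<in> sets unit_interval" if "i < mesh m" for i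
    unfolding mesh_cell_def using le[OF that] by (intro measure_Ico) (auto simp: divide_right_mono)
  show "measure unit_interval (mesh_cell m i) = 1 / real (mesh m)" if "i < mesh m" for i
    unfolding mesh_cell_def using le[OF that] by (subst measure_Ico) (auto simp: divide_right_mono simp flip: diff_divide_distrib)
  show "mesh_cell m i \<inter> mesh_cell m j = {}" if "i < mesh m" "j < mesh m" "i \<noteq> j" for i j
  proof -
    have "x \<notin> mesh_cell m j" if x: "x \<in> mesh_cell m i" and ij: "i < j" for x i j
    proof
      assume "x \<in> mesh_cell m j"
      then have "real j / real (mesh m) < real (Suc i) / real (mesh m)" using x by (auto simp: mesh_cell_def)
      then have "real j < real (Suc i)" using mesh_pos[of m] by (simp add: divide_less_cancel)
      then show False using ij by simp
    qed
    then show ?thesis using that(3) by (metis disjoint_iff linorder_neqE_nat)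
  qed
qed (rule mesh_pos)

lemma avg_tendsto_continuous:
  assumes h: "continuous_on UNIV h" "h \<in> LF" and e: "0 < e"
  shows "\<exists>N. \<forall>m\<ge>N. snorm (\<lambda>x. mesh.avg m h x - h x) \<le> e"
proof -
  have "uniformly_continuous_on {0..1} h"
    using continuous_on_subset[OF h(1)] by (intro compact_uniformly_continuous) auto
  then obtain d where d: "d > 0" "\<And>x y. x \<in> {0..1} \<Longrightarrow> y \<in> {0..1} \<Longrightarrow> dist y x < d \<Longrightarrow> dist (h y) (h x) < e"
    unfolding uniformly_continuous_on_def using e by metis
  obtain N :: nat where N: "1 / real (Suc N) < d" using d(1) nat_approx_posE by blast
  have "snorm (\<lambda>x. mesh.avg m h x - h x) \<le> e" if "m \<ge> N" for m
  proof (rule Lp_seminorm_bounded)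
    show "(\<lambda>x. mesh.avg m h x - h x) \<in> borel_measurable unit_interval"
      using Lp_functionsD(1)[OF h(2)] Lp_functionsD(1)[OF mesh.avg_Lp] by (intro borel_measurable_diff)
    show "AE x in unit_interval. cmod (mesh.avg m h x - h x) \<le> e"
      using mesh.A_cover[of m]
    proof eventually_elim
      fix x assume "\<exists>i<mesh m. x \<in> mesh_cell m i"
      then obtain i where i: "i < mesh m" "x \<in> mesh_cell m i" by blast
      have sub: "mesh_cell m i \<subseteq> {0..1}" using sets.sets_into_space[OF mesh.A_sets[OF i(1)]] by (simp add: space_restrict_space)
      show "cmod (mesh.avg m h x - h x) \<le> e"
      proof (rule mesh.avg_close[OF i Lp_integrable[OF h(2)]])
        fix y assume y: "y \<in> mesh_cell m i"
        have "\<bar>y - x\<bar> \<le> real (Suc i) / real (mesh m) - real i / real (mesh m)"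
          using y i(2) by (auto simp: mesh_cell_def)
        also have "\<dots> = 1 / real (mesh m)" by (simp flip: diff_divide_distrib)
        also have "\<dots> \<le> 1 / real (Suc N)" using \<open>m \<ge> N\<close> by (intro divide_left_mono) (auto simp: mesh_def)
        finally have "dist y x < d" using N by (simp add: dist_real_def)
        then show "cmod (h y - h x) \<le> e" using d(2)[of x y] sub y i(2) by (auto simp: dist_norm less_imp_le subset_iff)
      qed
    qed
  qed (use e in simp)
  then show ?thesis by blast
qed

text \<open>As the averages are contractive, convergence spreads from the dense set of continuous
  functions, where it follows from uniform continuity.\<close>

lemma avg_tendsto:
  assumes f: "f \<in> LF" and e: "0 < e"
  shows "\<exists>N. \<forall>m\<ge>N. snorm (\<lambda>x. mesh.avg m f x - f x) < e"
proof -
  have e4: "e / 4 > 0" using e by simp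
  obtain h where h: "continuous_on UNIV h" "h \<in> LF"
    "snorm (\<lambda>x. h x - f x) < e / 4" by (rule continuous_dense[OF f e4])
  obtain N where N: "\<forall>m\<ge>N. snorm (\<lambda>x. mesh.avg m h x - h x) \<le> e / 4"
    using avg_tendsto_continuous[OF h(1,2) e4] by blast
  have "snorm (\<lambda>x. mesh.avg m f x - f x) < e" if m: "m \<ge> N" for m
  proof -
    note L = Lp_functions_diff mesh.avg_Lp h(2) f
    have eq: "(\<lambda>x. mesh.avg m f x - f x) = (\<lambda>x. mesh.avg m (\<lambda>x. f x - h x) x + ((mesh.avg m h x - h x) + (h x - f x)))"
      by (simp add: mesh.avg_diff[OF f h(2)])
    have "snorm (\<lambda>x. mesh.avg m f x - f x)
       \<le> snorm (mesh.avg m (\<lambda>x. f x - h x)) +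
          snorm (\<lambda>x. (mesh.avg m h x - h x) + (h x - f x))"
      unfolding eq by (intro Lp_seminorm_triangle Lp_functions_add L)
    also have "snorm (\<lambda>x. (mesh.avg m h x - h x) + (h x - f x))
       \<le> snorm (\<lambda>x. mesh.avg m h x - h x) + snorm (\<lambda>x. h x - f x)"
      by (intro Lp_seminorm_triangle L)
    also have "snorm (mesh.avg m (\<lambda>x. f x - h x)) \<le> snorm (\<lambda>x. f x - h x)"
      by (intro mesh.avg_contractive L)
    also have "snorm (\<lambda>x. f x - h x) = snorm (\<lambda>x. h x - f x)"
      by (simp add: Lp_seminorm_def norm_minus_commute)
    finally show ?thesis using h(3) N[rule_format, OF m] e by linarith
  qed
  then show ?thesis by blast
qed

definition E :: "nat \<Rightarrow> (real \<Rightarrow> complex) set \<Rightarrow> (real \<Rightarrow> complex) set" where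
  "E m = mesh.cond_exp_op m"

lemma E_compact: "E m \<in> compact_ops (Lp p unit_interval)"
  and E_bounded: "E m \<in> bounded_ops (Lp p unit_interval) (Lp p unit_interval)"
  and E_norm: "op_norm (Lp p unit_interval) (Lp p unit_interval) (E m) \<le> 1"
  and E_cls: "f \<in> LF \<Longrightarrow> E m (cls f) = cls (mesh.avg m f)"
  using mesh.cond_exp_op_compact Lp.compact_ops_bounded mesh.cond_exp_op_norm mesh.cond_exp_op_cls
  by (auto simp: E_def)

lemma E_contractive: "F \<in> carrier (Lp p unit_interval) \<Longrightarrow> nrm (Lp p unit_interval) (E m F) \<le> nrm (Lp p unit_interval) F"
  using Lp.op.nrm_op_le[OF E_bounded, of F m] mult_right_mono[OF E_norm[of m] Lp.nrm_nonneg, of F] by simp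

lemma E_tendsto:
  assumes "F \<in> carrier (Lp p unit_interval)" "0 < e"
  shows "\<exists>N. \<forall>m\<ge>N. nrm (Lp p unit_interval) (E m F \<ominus>\<^bsub>Lp p unit_interval\<^esub> F) < e"
proof -
  obtain f where f: "f \<in> LF" "F = cls f" using assms(1) by (rule carrier_Lp_cases)
  then show ?thesis
    using avg_tendsto[OF f(1) assms(2)] by (simp add: E_cls Lp_minus Lp_nrm Lp_functions_diff)
qed

end

section \<open>Smoothness of the norm\<close>

text \<open>Up to the factor \<open>p\<close>, the gradient of \<open>\<lambda>v. cmod v powr p\<close>.\<close>

definition powr_grad :: "real \<Rightarrow> complex \<Rightarrow> complex" where
  "powr_grad p v = of_real (cmod v powr (p - 1)) * sgn v"

lemma powr_grad_0 [simp]: "powr_grad p 0 = 0"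
  by (simp add: powr_grad_def)

lemma norm_powr_grad: "cmod (powr_grad p v) = cmod v powr (p - 1)"
  by (cases "v = 0") (simp_all add: powr_grad_def norm_mult norm_sgn)

lemma powr_grad_scale: "0 < s \<Longrightarrow> powr_grad p (of_real s * v) = of_real (s powr (p - 1)) * powr_grad p v"
  by (simp add: powr_grad_def norm_mult powr_mult sgn_mult sgn_of_real)

lemma continuous_powr_grad:
  assumes p: "1 < p"
  shows "continuous_on UNIV (powr_grad p)"
  unfolding continuous_on_eq_continuous_at[OF open_UNIV]
proof
  fix v :: complex
  show "isCont (powr_grad p) v"
  proof (cases "v = 0")
    case True
    have "((\<lambda>w. cmod w powr (p - 1)) \<longlongrightarrow> cmod (0::complex) powr (p - 1)) (at 0)"
      using p by (intro tendsto_powr' tendsto_norm tendsto_ident_at tendsto_const) auto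
    then have "((\<lambda>w. cmod (powr_grad p w)) \<longlongrightarrow> 0) (at 0)" by (simp add: norm_powr_grad)
    then have "(powr_grad p \<longlongrightarrow> 0) (at 0)" by (rule tendsto_norm_zero_cancel)
    with True show ?thesis by (simp add: isCont_def)
  next
    case False
    then show ?thesis unfolding powr_grad_def sgn_div_norm
      by (intro continuous_intros) auto
  qed
qed

text \<open>The supporting hyperplane of a convex function on the plane. Projecting to the direction
  \<open>sgn v\<close> can only decrease the modulus of \<open>u\<close>, which reduces the claim to
  \<open>powr_tangent\<close>.\<close>

lemma norm_powr_tangent:
  assumes p: "1 < p"
  shows "cmod v powr p + p * Re (cnj (powr_grad p v) * (u - v)) \<le> cmod u powr p"
proof (cases "v = 0")
  case False
  have "Re (cnj (powr_grad p v) * (u - v)) = cmod v powr (p - 1) * (Re (cnj (sgn v) * u) - Re (cnj (sgn v) * v))"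
    unfolding powr_grad_def by (simp add: algebra_simps)
  also have "cnj (sgn v) * v = of_real (cmod v)"
    using False complex_norm_square[of v] by (simp add: sgn_div_norm scaleR_conv_of_real power2_eq_square field_simps)
  also have "cmod v powr (p - 1) * (Re (cnj (sgn v) * u) - Re (of_real (cmod v))) \<le> cmod v powr (p - 1) * (cmod u - cmod v)"
    using complex_Re_le_cmod[of "cnj (sgn v) * u"] False
    by (intro mult_left_mono) (auto simp: norm_mult norm_sgn)
  finally have "p * Re (cnj (powr_grad p v) * (u - v)) \<le> p * (cmod v powr (p - 1) * (cmod u - cmod v))"
    using p by (intro mult_left_mono) auto
  then show ?thesis using powr_tangent[OF p, of "cmod v" "cmod u"] by (simp add: mult.assoc)
qed (use p in simp)

text \<open>One \<open>t\<close> has to serve all \<open>a\<close> and \<open>z\<close>, and the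
  error has to be relative to the p-th powers, so that the inequality can be integrated. Dividing by
  the larger modulus reduces to the unit disc, because \<open>powr_grad\<close> is homogeneous of
  degree \<open>p - 1\<close>; there its uniform continuity bounds the change of the
  gradient.\<close>

lemma norm_powr_uniformly_smooth:
  assumes p: "1 < p" and e: "0 < e"
  obtains t :: real where "0 < t" "t \<le> 1"
    "\<And>a z. cmod (a + of_real t * z) powr p
        \<le> cmod a powr p + t * p * Re (cnj (powr_grad p a) * z) + t * e * (cmod a powr p + cmod z powr p)"
proof -
  have "uniformly_continuous_on (cball 0 2) (powr_grad p)"
    using continuous_on_subset[OF continuous_powr_grad[OF p]] by (intro compact_uniformly_continuous) auto
  moreover have "e / p > 0" using p e by simp
  ultimately obtain d where d: "d > 0"
    "\<And>x y. x \<in> cball 0 2 \<Longrightarrow> y \<in> cball 0 2 \<Longrightarrow> dist y x < d \<Longrightarrow> dist (powr_grad p y) (powr_grad p x) < e / p"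
    unfolding uniformly_continuous_on_def by metis
  \<comment> \<open>\<open>t \<le> 1\<close> keeps \<open>a + of_real t * z\<close> in the disc of
    radius 2, and \<open>t < d\<close> keeps it within \<open>d\<close> of \<open>a\<close>.\<close>
  define t where "t = min 1 (d / 2)"
  have t: "0 < t" "t \<le> 1" "t < d" using d(1) by (auto simp: t_def)
  have unit: "cmod (powr_grad p (a + of_real t * z) - powr_grad p a) \<le> e / p" if "cmod a \<le> 1" "cmod z \<le> 1" for a z
  proof -
    have tz: "cmod (of_real t * z) \<le> t" using that(2) t by (simp add: norm_mult mult_left_le)
    have "cmod (a + of_real t * z) \<le> 2" using norm_triangle_ineq[of a "of_real t * z"] that tz t by linarith
    then have "a + of_real t * z \<in> cball 0 2" "a \<in> cball 0 2" using that by simp_all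
    moreover have "dist (a + of_real t * z) a < d" using tz t by (simp add: dist_norm)
    ultimately have "dist (powr_grad p (a + of_real t * z)) (powr_grad p a) < e / p"
      by (intro d(2))
    then show ?thesis by (simp add: dist_norm)
  qed
  have "cmod (a + of_real t * z) powr p
        \<le> cmod a powr p + t * p * Re (cnj (powr_grad p a) * z) + t * e * (cmod a powr p + cmod z powr p)" for a z
  proof (cases "a = 0 \<and> z = 0")
    case True
    then show ?thesis using p by simp
  next
    case False
    define s where "s = max (cmod a) (cmod z)"
    have s: "s > 0" using False by (auto simp: s_def less_max_iff_disj)
    define D where "D = powr_grad p (a + of_real t * z) - powr_grad p a"
    define W where "W = powr_grad p (a / of_real s + of_real t * (z / of_real s)) - powr_grad p (a / of_real s)"
    have "D = of_real (s powr (p - 1)) * W"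
      using powr_grad_scale[OF s, of p "a / of_real s"] powr_grad_scale[OF s, of p "a / of_real s + of_real t * (z / of_real s)"] s
      by (simp add: D_def W_def algebra_simps)
    then have "cmod D = s powr (p - 1) * cmod W" by (simp add: norm_mult)
    moreover have "cmod (a / of_real s) \<le> 1" "cmod (z / of_real s) \<le> 1"
      using s by (simp_all add: norm_divide divide_le_eq) (simp_all add: s_def)
    then have "cmod W \<le> e / p" unfolding W_def by (rule unit)
    then have "s powr (p - 1) * cmod W \<le> s powr (p - 1) * (e / p)" by (rule mult_left_mono) simp
    ultimately have "cmod D \<le> s powr (p - 1) * (e / p)" by simp
    then have "cmod D * cmod z \<le> (s powr (p - 1) * (e / p)) * s"
      using e p by (intro mult_mono) (auto simp: s_def)
    also have "\<dots> = s powr p * (e / p)" using s by (simp add: powr_diff)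
    also have "\<dots> \<le> (cmod a powr p + cmod z powr p) * (e / p)"
      using e p by (intro mult_right_mono) (auto simp: s_def max_def)
    finally have Dz: "cmod D * cmod z \<le> (cmod a powr p + cmod z powr p) * (e / p)" .
    \<comment> \<open>The lower bound by a tangent becomes an upper bound when the tangent is taken
      at the displaced point and evaluated at \<open>a\<close>.\<close>
    have "cmod (a + of_real t * z) powr p \<le> cmod a powr p - p * Re (cnj (powr_grad p (a + of_real t * z)) * (a - (a + of_real t * z)))"
      using norm_powr_tangent[OF p, of "a + of_real t * z" a] by linarith
    also have "\<dots> = cmod a powr p + t * p * Re (cnj (powr_grad p a) * z) + t * p * Re (cnj D * z)"
      by (simp add: D_def algebra_simps)
    also have "Re (cnj D * z) \<le> (cmod a powr p + cmod z powr p) * (e / p)"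
      using complex_Re_le_cmod[of "cnj D * z"] Dz by (simp add: norm_mult)
    finally show ?thesis using p t by (simp add: mult_left_mono mult_ac)
  qed
  with t that show ?thesis by blast
qed

text \<open>The gradient along a step function is again a step function for the same cells, and
  \<open>w\<close> has integral 0 over each of them. So the term of first order in \<open>t\<close>
  integrates to 0, and only the smoothness error remains.\<close>

lemma (in equipartition) smooth_perturbation:
  assumes t: "0 < t" "t \<le> 1" and e: "0 < e"
    and smooth: "\<And>a z. cmod (a + of_real t * z) powr p
        \<le> cmod a powr p + t * p * Re (cnj (powr_grad p a) * z) + t * e * (cmod a powr p + cmod z powr p)"
    and c: "snorm (step c) \<le> 1"
    and w: "w \<in> LF" "\<And>i. i < n \<Longrightarrow> cell i w = 0" "snorm w \<le> 2"
  shows "snorm (\<lambda>x. step c x + of_real t * w x) \<le> 1 + t * e * (1 + 2 powr p)"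
proof (rule Lp_seminorm_leI)
  define d where "d = (\<lambda>i. cnj (powr_grad p (c i)))"
  have d: "cnj (powr_grad p (step c x)) = step d x" for x
    using step_comp[of "\<lambda>v. cnj (powr_grad p v)" c x] by (simp add: d_def step_def)
  have "cmod (step d x) \<le> (\<Sum>i<n. cmod (d i))" for x
    by (intro step_bound member_le_sum sum_nonneg) auto
  then have "(\<lambda>x. step d x * w x) \<in> LF"
    by (intro Lp_functions_mult_bounded w(1) step_measurable)
  note Iw = Lp_integrable[OF this]
  have "(LINT x|M. step d x * w x) = 0"
    using integral_step_mult[OF Lp_integrable[OF w(1)], of d] w(2) by simp
  define r where "r = (\<lambda>x. Re (step d x * w x))"
  have Ir: "integrable M r" unfolding r_def by (rule integrable_Re[OF Iw])
  have orth: "(LINT x|M. r x) = 0"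
    unfolding r_def integral_Re[OF Iw] \<open>(LINT x|M. step d x * w x) = 0\<close> by simp
  note I1 = Lp_functionsD(2)[OF step_Lp[of c]] and I2 = Lp_functionsD(2)[OF w(1)]
  have L: "(\<lambda>x. step c x + of_real t * w x) \<in> LF"
    by (intro Lp_functions_add step_Lp Lp_functions_smult w)
  have "(LINT x|M. cmod (step c x + of_real t * w x) powr p)
    \<le> (LINT x|M. cmod (step c x) powr p + t * p * r x + t * e * (cmod (step c x) powr p + cmod (w x) powr p))"
  proof (rule integral_mono)
    show "cmod (step c x + of_real t * w x) powr p
        \<le> cmod (step c x) powr p + t * p * r x + t * e * (cmod (step c x) powr p + cmod (w x) powr p)" for x
      using smooth[of "step c x" "w x"] unfolding d r_def .
  qed (use Ir I1 I2 Lp_functionsD(2)[OF L] in auto)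
  also have "\<dots> = snorm (step c) powr p + t * e * (snorm (step c) powr p + snorm w powr p)"
    using Ir I1 I2 orth by (simp add: Lp_seminorm_powr)
  also have "\<dots> \<le> 1 powr p + t * e * (1 powr p + 2 powr p)"
    using c w(3) t e p_gt_1 by (intro add_mono mult_left_mono powr_mono2) auto
  \<comment> \<open>The base is at least 1, so raising the exponent from 1 to \<open>p\<close> only
    increases the value.\<close>
  also have "\<dots> \<le> (1 + t * e * (1 + 2 powr p)) powr 1" using t e by simp
  also have "\<dots> \<le> (1 + t * e * (1 + 2 powr p)) powr p"
    using t e p_gt_1 by (intro powr_mono) (auto intro!: mult_nonneg_nonneg add_nonneg_nonneg)
  finally show "(LINT x|M. cmod (step c x + of_real t * w x) powr p) \<le> (1 + t * e * (1 + 2 powr p)) powr p" .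
qed (use t e in simp)

text \<open>Unlike \<open>sgn\<close> it has modulus 1 also at 0, so a rotation by a phase never
  changes norms.\<close>

definition phase :: "complex \<Rightarrow> complex" where
  "phase z = (if z = 0 then 1 else sgn z)"

lemma norm_phase [simp]: "cmod (phase z) = 1"
  by (simp add: phase_def norm_sgn)

lemma phase_mult_norm: "phase z * of_real (cmod z) = z"
  by (simp add: phase_def sgn_eq)

lemma cnj_phase_mult: "cnj (phase z) * z = of_real (cmod z)"
proof -
  have "cnj (phase z) * phase z = 1"
    using complex_norm_square[of "phase z"] by (simp add: mult.commute)
  then have "cnj (phase z) * (phase z * of_real (cmod z)) = of_real (cmod z)"
    by (simp flip: mult.assoc)
  then show ?thesis by (simp only: phase_mult_norm)
qed

section \<open>Convergence of bounded functionals along the averages\<close>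

context complex_banach_space
begin

lemma compact_op_minus_apply:
  assumes S: "S \<in> compact_ops V" and T: "T \<in> compact_ops V" and x: "x \<in> carrier V"
  shows "(S \<ominus>\<^bsub>compact_op_algebra V\<^esub> T) x = S x \<ominus> T x"
proof -
  interpret K: complex_banach_algebra "compact_op_algebra V" by (rule compact_op_algebra_banach)
  show ?thesis
    using K.minus_eq_smult[of S T] assms
    by (simp add: minus_eq_smult op_closed compact_ops_bounded)
qed

lemma compact_op_norm_diff_le:
  assumes S: "S \<in> compact_ops V" and T: "T \<in> compact_ops V"
    and le: "\<And>x. x \<in> closed_unit_ball V \<Longrightarrow> nrm V (S x \<ominus> T x) \<le> e"
  shows "op_norm V V (S \<ominus>\<^bsub>compact_op_algebra V\<^esub> T) \<le> e"
  by (rule op.op_norm_le) (simp add: compact_op_minus_apply[OF S T] closed_unit_ballD le)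

end

context Lp_unit_interval
begin

sublocale func: normed_space_pair "LP" complex_space
  by (simp add: normed_space_pair_def Lp.complex_normed_space_axioms complex_normed_space_complex)

lemma E_closed: "F \<in> carrier LP \<Longrightarrow> E m F \<in> carrier LP"
  by (rule Lp.op_closed[OF E_bounded])

text \<open>If \<open>\<phi>\<close> nearly attains its norm at \<open>y\<close> in the range of \<open>E m\<close>, then \<open>\<phi>\<close> is small on the kernel
  of \<open>E m\<close>: by smoothness of the norm, adding a small multiple \<open>t w\<close> of a kernel element to \<open>y\<close>
  increases the norm only by \<open>o(t)\<close>.\<close>

lemma functional_E_tendsto:
  assumes \<phi>: "\<phi> \<in> bounded_ops LP complex_space" and e: "0 < e"
  shows "\<exists>N. \<forall>m\<ge>N. \<forall>F\<in>closed_unit_ball LP. cmod (\<phi> (F \<ominus>\<^bsub>LP\<^esub> E m F)) \<le> e"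
proof -
  note l\<phi> = bounded_ops_linear[OF \<phi>]
  define k where "k = op_norm LP complex_space \<phi>"
  have k: "0 \<le> k" unfolding k_def by (rule func.op_norm_nonneg[OF \<phi>])
  have \<phi>_le: "cmod (\<phi> F) \<le> k * nrm LP F" if "F \<in> carrier LP" for F
    using func.nrm_op_le[OF \<phi> that] by (simp add: k_def)
  \<comment> \<open>The denominator collects the errors, each in units of \<open>e' * t\<close>: one
    from the near attainment of the norm at \<open>F0\<close>, one from replacing \<open>F0\<close>
    by \<open>E m F0\<close>, and \<open>k * (1 + 2 powr p)\<close> from the smoothness
    estimate.\<close>
  define e' where "e' = e / (2 + k * (1 + 2 powr p))"
  have den: "2 + k * (1 + 2 powr p) > 0" using k by (intro add_pos_nonneg mult_nonneg_nonneg) auto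
  then have e': "e' > 0" using e by (simp add: e'_def)
  obtain t where t: "0 < t" "t \<le> 1" and smooth: "\<And>a z. cmod (a + of_real t * z) powr p
        \<le> cmod a powr p + t * p * Re (cnj (powr_grad p a) * z) + t * e' * (cmod a powr p + cmod z powr p)"
    using norm_powr_uniformly_smooth[OF p_gt_1 e'] by metis
  have "\<exists>F\<in>closed_unit_ball LP. k - e' * t < nrm complex_space (\<phi> F)"
    using e' t unfolding k_def by (intro func.op_norm_less_exists[OF \<phi>]) simp
  then obtain F0 where F0: "F0 \<in> closed_unit_ball LP" "k - e' * t < cmod (\<phi> F0)" by auto
  have F0c: "F0 \<in> carrier LP" and F01: "nrm LP F0 \<le> 1" using closed_unit_ballD[OF F0(1)] by auto
  obtain f where f: "f \<in> LF" "F0 = cls f" using F0c by (rule carrier_Lp_cases)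
  \<comment> \<open>Dividing by \<open>k + 1\<close> instead of \<open>k\<close> includes the zero
    functional.\<close>
  have "e' * t / (k + 1) > 0" using e' t k by simp
  then obtain N where N: "\<forall>m\<ge>N. nrm LP (E m F0 \<ominus>\<^bsub>LP\<^esub> F0) < e' * t / (k + 1)"
    using E_tendsto[OF F0c] by blast
  have "cmod (\<phi> (F \<ominus>\<^bsub>LP\<^esub> E m F)) \<le> e" if m: "m \<ge> N" and F: "F \<in> closed_unit_ball LP" for m F
  proof -
    have Fc: "F \<in> carrier LP" and F1: "nrm LP F \<le> 1" using closed_unit_ballD[OF F] by auto
    have "cmod (\<phi> F0 - \<phi> (E m F0)) \<le> e' * t"
    proof -
      have "cmod (\<phi> F0 - \<phi> (E m F0)) = cmod (\<phi> (E m F0 \<ominus>\<^bsub>LP\<^esub> F0))"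
        using complex_normed_space.minus_eq_smult[OF complex_normed_space_complex, of "\<phi> (E m F0)" "\<phi> F0"]
        by (simp add: func.linear_minus[OF l\<phi>] F0c E_closed norm_minus_commute)
      also have "\<dots> \<le> k * nrm LP (E m F0 \<ominus>\<^bsub>LP\<^esub> F0)" by (intro \<phi>_le) (simp add: F0c E_closed)
      also have "\<dots> \<le> (k + 1) * (e' * t / (k + 1))"
        using N[rule_format, OF m] k F0c E_closed by (intro mult_mono) auto
      finally show ?thesis using k by simp
    qed
    then have y: "cmod (\<phi> (E m F0)) > k - 2 * (e' * t)"
      using F0(2) norm_triangle_ineq2[of "\<phi> F0" "\<phi> (E m F0)"] by linarith
    define c where "c i = of_nat (mesh m) * mesh.cell m i f" for i
    have Ey: "E m F0 = cls (mesh.step m c)" using f by (simp add: E_cls mesh.avg_def c_def[abs_def])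
    have c1: "snorm (mesh.step m c) \<le> 1"
      using E_contractive[OF F0c, of m] F01 unfolding Ey by (simp add: Lp_nrm)
    obtain g where g: "g \<in> LF" "F = cls g" using Fc by (rule carrier_Lp_cases)
    define w where "w = (\<lambda>x. g x - mesh.avg m g x)"
    have w: "w \<in> LF" unfolding w_def by (intro Lp_functions_diff g mesh.avg_Lp)
    have Fw: "F \<ominus>\<^bsub>LP\<^esub> E m F = cls w" using g by (simp add: E_cls Lp_minus w_def)
    have cell_w: "mesh.cell m i w = 0" if "i < mesh m" for i
      unfolding w_def using that g by (simp add: mesh.cell_diff mesh.cell_avg)
    have w2: "snorm w \<le> 2"
    proof -
      have "nrm LP (F \<ominus>\<^bsub>LP\<^esub> E m F) \<le> nrm LP F + nrm LP (\<ominus>\<^bsub>LP\<^esub> E m F)"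
        unfolding a_minus_def using Fc E_closed by (intro Lp.nrm_triangle) auto
      also have "\<dots> \<le> 2" using E_contractive[OF Fc, of m] F1 Fc E_closed by (simp add: Lp.nrm_uminus)
      finally show ?thesis using w by (simp add: Fw Lp_nrm)
    qed
    note u = norm_phase phase_mult_norm cnj_phase_mult
    \<comment> \<open>A rotation giving the image of the kernel element the same phase as
      \<open>\<phi> (E m F0)\<close>, so that the two moduli add up.\<close>
    define a where "a = cnj (phase (\<phi> (cls w))) * phase (\<phi> (E m F0))"
    have a1: "cmod a \<le> 1" by (simp add: a_def norm_mult u)
    define v where "v = (\<lambda>x. a * w x)"
    have v: "v \<in> LF" unfolding v_def by (rule Lp_functions_smult[OF w])
    have "snorm (\<lambda>x. mesh.step m c x + of_real t * v x) \<le> 1 + t * e' * (1 + 2 powr p)"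
    proof (rule mesh.smooth_perturbation[OF t e' smooth c1 v])
      show "mesh.cell m i v = 0" if "i < mesh m" for i
        unfolding v_def mesh.cell_smult cell_w[OF that] by simp
      have "snorm v \<le> 1 * 2"
        unfolding v_def Lp_seminorm_smult by (intro mult_mono a1 w2) auto
      then show "snorm v \<le> 2" by simp
    qed
    then have nv: "nrm LP (E m F0 \<oplus>\<^bsub>LP\<^esub> of_real t \<odot>\<^bsub>LP\<^esub> cls v) \<le> 1 + t * e' * (1 + 2 powr p)"
      using v by (simp add: Ey Lp_smult Lp_add Lp_functions_smult Lp_nrm Lp_functions_add)
    have "\<phi> (E m F0 \<oplus>\<^bsub>LP\<^esub> of_real t \<odot>\<^bsub>LP\<^esub> cls v) = \<phi> (E m F0) + of_real t * (a * \<phi> (cls w))"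
    proof -
      have "cls v = a \<odot>\<^bsub>LP\<^esub> cls w" using w by (simp add: Lp_smult v_def)
      then have "\<phi> (cls v) = a * \<phi> (cls w)" using w by (simp add: func.linear_smult[OF l\<phi>])
      then show ?thesis
        using v E_closed[OF F0c] by (simp add: func.linear_add[OF l\<phi>] func.linear_smult[OF l\<phi>])
    qed
    also have "\<dots> = phase (\<phi> (E m F0)) * of_real (cmod (\<phi> (E m F0)) + t * cmod (\<phi> (cls w)))"
    proof -
      have "a * \<phi> (cls w) = phase (\<phi> (E m F0)) * (cnj (phase (\<phi> (cls w))) * \<phi> (cls w))"
        by (simp add: a_def mult_ac)
      also have "\<dots> = phase (\<phi> (E m F0)) * of_real (cmod (\<phi> (cls w)))" by (simp only: u)
      finally show ?thesis
        using u(2)[of "\<phi> (E m F0)"] by (simp add: distrib_left mult.left_commute)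
    qed
    finally have eq: "cmod (\<phi> (E m F0 \<oplus>\<^bsub>LP\<^esub> of_real t \<odot>\<^bsub>LP\<^esub> cls v))
        = cmod (\<phi> (E m F0)) + t * cmod (\<phi> (cls w))"
      using t by (simp only: norm_mult norm_of_real u) simp
    have bound: "cmod (\<phi> (E m F0 \<oplus>\<^bsub>LP\<^esub> of_real t \<odot>\<^bsub>LP\<^esub> cls v)) \<le> k * (1 + t * e' * (1 + 2 powr p))"
      using \<phi>_le[of "E m F0 \<oplus>\<^bsub>LP\<^esub> of_real t \<odot>\<^bsub>LP\<^esub> cls v"] mult_left_mono[OF nv k] v E_closed[OF F0c]
      by (meson Lp.a_closed Lp.smult_cl cls_in_carrier order_trans)
    have "t * cmod (\<phi> (cls w)) \<le> t * (e' * (2 + k * (1 + 2 powr p)))"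
      using eq bound y by (simp add: algebra_simps)
    then have "cmod (\<phi> (cls w)) \<le> e' * (2 + k * (1 + 2 powr p))" using t by simp
    also have "\<dots> = e" using den by (simp add: e'_def)
    finally show ?thesis by (simp add: Fw)
  qed
  then show ?thesis by blast
qed

end

section \<open>A strict inequality in two dimensions\<close>

text \<open>The mean value theorem on the two halves of the segment: both have the same length, and
  the derivative p z^(p-1) is strictly increasing.\<close>

lemma powr_midpoint_strict:
  fixes p a b :: real
  assumes p: "1 < p" and a: "0 \<le> a" and b: "0 \<le> b" and ab: "a \<noteq> b"
  shows "((a + b) / 2) powr p < (a powr p + b powr p) / 2"
proof -
  have less: "((a + b) / 2) powr p < (a powr p + b powr p) / 2" if a: "0 \<le> a" and ab: "a < b" for a b
  proof -
    define m where "m = (a + b) / 2"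
    have m: "a < m" "m < b" "b - m = m - a" using ab by (auto simp: m_def field_simps)
    have mvt: "\<exists>z. x < z \<and> z < y \<and> y powr p - x powr p = (y - x) * (p * z powr (p - 1))"
      if "0 \<le> x" "x < y" for x y
    proof -
      have cont: "continuous_on {x..y} (\<lambda>t. t powr p)"
        by (intro continuous_on_powr' continuous_on_id continuous_on_const ballI) (use that p in simp)
      have D: "((\<lambda>t. t powr p) has_real_derivative p * t powr (p - 1)) (at t)" if "x < t" for t
        using that \<open>0 \<le> x\<close> by (intro has_real_derivative_powr) simp
      have diff: "(\<lambda>t. t powr p) differentiable (at t)" if "x < t" for t
        using D[OF that] unfolding real_differentiable_def by blast
      obtain l z where z: "x < z" "z < y" "DERIV (\<lambda>t. t powr p) z :> l" "y powr p - x powr p = (y - x) * l"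
        using MVT[OF \<open>x < y\<close> cont diff] by auto
      have "l = p * z powr (p - 1)" by (rule DERIV_unique[OF z(3) D[OF z(1)]])
      with z show ?thesis by blast
    qed
    obtain y where y: "a < y" "y < m" "m powr p - a powr p = (m - a) * (p * y powr (p - 1))"
      using mvt[OF a m(1)] by blast
    obtain z where z: "m < z" "z < b" "b powr p - m powr p = (b - m) * (p * z powr (p - 1))"
      using mvt[of m b] a m by auto
    have "y powr (p - 1) < z powr (p - 1)" using y z a p by (intro powr_less_mono2) auto
    then have "(m - a) * (p * y powr (p - 1)) < (b - m) * (p * z powr (p - 1))"
      unfolding m(3) using m(1) p by simp
    then have lt: "m powr p - a powr p < b powr p - m powr p" by (simp only: y(3) z(3))
    have "u < (v + w) / 2" if "u - v < w - u" for u v w :: real using that by (simp add: field_simps)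
    from this[OF lt] show ?thesis by (simp only: m_def)
  qed
  show ?thesis
    using less[of a b] less[of b a] a b ab by (cases "a < b") (auto simp: add.commute)
qed

lemma powr_midpoint:
  fixes p a b :: real
  assumes "1 < p" "0 \<le> a" "0 \<le> b"
  shows "((a + b) / 2) powr p \<le> (a powr p + b powr p) / 2"
  using powr_midpoint_strict[OF assms] by (cases "a = b") (simp_all add: less_imp_le)

text \<open>Convexity gives \<open>J \<le> 1\<close>, and then, applied in each coordinate, that the
  left side divided by 2^p is at most the mean of 1 and J^p. It remains to exclude equality: it
  needs \<open>J = 1\<close>, which forces \<open>X0 = X1\<close>, and the coincidence of
  \<open>X0\<close> with \<open>J * W0\<close> and of \<open>X1\<close> with \<open>J * W1\<close>,
  which contradicts \<open>W0 \<noteq> W1\<close>.\<close>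

lemma two_dim_strict:
  fixes p X0 X1 W0 W1 J :: real
  assumes p: "1 < p" and W: "0 \<le> W0" "0 \<le> W1" "W0 powr p + W1 powr p = 1" "W0 \<noteq> W1"
    and X: "0 \<le> X0" "0 \<le> X1" "X0 powr p + X1 powr p = 1"
    and J: "J = 2 powr (1 / p - 1) * (X0 + X1)"
  shows "(X0 + J * W0) powr p + (X1 + J * W1) powr p < 2 powr p"
proof -
  have J0: "0 \<le> J" using J X by simp
  have "J = 2 powr (1 / p) * ((X0 + X1) / 2)" by (simp add: J powr_diff)
  then have "J powr p = (2 powr (1 / p)) powr p * ((X0 + X1) / 2) powr p" using X by (simp only: powr_mult)
  also have "(2 powr (1 / p)) powr p = 2" using p by (simp only: powr_powr) simp
  finally have Jp: "J powr p = 2 * ((X0 + X1) / 2) powr p" .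
  have J1: "J powr p \<le> 1"
    using powr_midpoint[OF p X(1,2)] unfolding X(3) Jp by simp
  have Jeq: "J powr p < 1" if "X0 \<noteq> X1"
    using powr_midpoint_strict[OF p X(1,2) that] unfolding X(3) Jp by simp
  have half: "((a + J * w) / 2) powr p = (a + J * w) powr p / 2 powr p" if "0 \<le> a" "0 \<le> w" for a w
    using that J0 by (simp add: powr_divide)
  have le: "((X0 + J * W0) / 2) powr p \<le> (X0 powr p + J powr p * W0 powr p) / 2"
      "((X1 + J * W1) / 2) powr p \<le> (X1 powr p + J powr p * W1 powr p) / 2"
    using powr_midpoint[OF p X(1), of "J * W0"] powr_midpoint[OF p X(2), of "J * W1"] J0 W by (simp_all add: powr_mult)
  have sum: "J powr p * W0 powr p + J powr p * W1 powr p = J powr p" using W(3) by (simp flip: distrib_left)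
  have combine: "a + b < 1"
    if "a \<le> (x + u) / 2" "b \<le> (y + v) / 2" "u + v = j" "x + y = 1"
      "j < 1 \<or> j \<le> 1 \<and> (a < (x + u) / 2 \<or> b < (y + v) / 2)" for a b x y u v j :: real
    using that by auto
  have "((X0 + J * W0) / 2) powr p + ((X1 + J * W1) / 2) powr p < 1"
  proof (cases "X0 = X1 \<and> J powr p = 1")
    case False
    then have "J powr p < 1" using Jeq J1 by auto
    then show ?thesis using combine[OF le sum X(3)] by blast
  next
    case True
    have "J = 1"
    proof (rule ccontr)
      assume "J \<noteq> 1"
      then have "J < 1 \<or> 1 < J" by auto
      then have "J powr p \<noteq> 1" using powr_less_mono2[of p J 1] powr_less_mono2[of p 1 J] J0 p by auto
      with True show False by simp
    qed
    note J_eq_1 = this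
    have "X0 \<noteq> J * W0 \<or> X1 \<noteq> J * W1" using True J_eq_1 W(4) by auto
    then have "((X0 + J * W0) / 2) powr p < (X0 powr p + J powr p * W0 powr p) / 2 \<or>
      ((X1 + J * W1) / 2) powr p < (X1 powr p + J powr p * W1 powr p) / 2"
      using powr_midpoint_strict[OF p X(1), of "J * W0"] powr_midpoint_strict[OF p X(2), of "J * W1"] J0 W
      by (auto simp: powr_mult)
    then show ?thesis using combine[OF le sum X(3)] J1 by blast
  qed
  then show ?thesis using half[OF X(1) W(1)] half[OF X(2) W(2)] by (simp flip: add_divide_distrib)
qed

text \<open>The nonnegative unit vectors are parametrised by the p-th power \<open>A\<close> of the
  first coordinate, which ranges over a compact interval; so the strict bound becomes uniform at a
  maximum of \<open>h\<close>. Homogeneity extends it to all vectors.\<close>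

lemma two_dim_bound:
  fixes p W0 W1 :: real
  assumes p: "1 < p" and W: "0 \<le> W0" "0 \<le> W1" "W0 powr p + W1 powr p = 1" "W0 \<noteq> W1"
  obtains B where "0 \<le> B" "B < 2" "\<And>X0 X1 J. 0 \<le> X0 \<Longrightarrow> 0 \<le> X1 \<Longrightarrow> J = 2 powr (1 / p - 1) * (X0 + X1) \<Longrightarrow>
      (X0 + J * W0) powr p + (X1 + J * W1) powr p \<le> B powr p * (X0 powr p + X1 powr p)"
proof -
  define J where "J A = 2 powr (1 / p - 1) * (A powr (1 / p) + (1 - A) powr (1 / p))" for A :: real
  have J0: "0 \<le> J A" for A by (simp add: J_def)
  define h where "h A = (A powr (1 / p) + J A * W0) powr p + ((1 - A) powr (1 / p) + J A * W1) powr p" for A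
  have root: "(A powr (1 / p)) powr p = A" if "0 \<le> A" for A using that p by (simp add: powr_powr)
  have roots: "continuous_on {0..1} (\<lambda>A::real. A powr (1 / p))" "continuous_on {0..1} (\<lambda>A::real. (1 - A) powr (1 / p))"
    using p by (intro continuous_on_powr' continuous_on_id continuous_on_const continuous_on_diff ballI; simp)+
  have "continuous_on {0..1} h"
    unfolding h_def using p W J0
    by (intro continuous_on_add continuous_on_powr' continuous_on_const continuous_on_mult roots
        roots[THEN continuous_on_add, THEN continuous_on_mult_left] ballI; simp add: J_def roots continuous_on_add continuous_on_mult_left)
  then obtain A0 where A0: "A0 \<in> {0..1}" "\<And>A. A \<in> {0..1} \<Longrightarrow> h A \<le> h A0"
    using continuous_attains_sup[of "{0..1::real}" h] by auto
  have lt: "h A0 < 2 powr p"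
    unfolding h_def by (rule two_dim_strict[OF p W]) (use A0(1) in \<open>auto simp: root J_def\<close>)
  have h0: "0 \<le> h A0" by (simp add: h_def)
  define B where "B = h A0 powr (1 / p)"
  have Bp: "B powr p = h A0" using h0 p by (simp add: B_def powr_powr)
  have "B < (2 powr p) powr (1 / p)" unfolding B_def using lt h0 p by (intro powr_less_mono2) auto
  then have B2: "B < 2" using p by (simp add: powr_powr)
  show ?thesis
  proof (rule that[OF _ B2])
    show "0 \<le> B" by (simp add: B_def)
    fix X0 X1 K :: real
    assume X: "0 \<le> X0" "0 \<le> X1" and K: "K = 2 powr (1 / p - 1) * (X0 + X1)"
    define T where "T = X0 powr p + X1 powr p"
    show "(X0 + K * W0) powr p + (X1 + K * W1) powr p \<le> B powr p * (X0 powr p + X1 powr p)"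
    proof (cases "T = 0")
      case True
      then have "X0 powr p = 0" "X1 powr p = 0"
        unfolding T_def using powr_ge_zero[of X0 p] powr_ge_zero[of X1 p] by linarith+
      then have "X0 = 0" "X1 = 0" by simp_all
      then show ?thesis using K by simp
    next
      case False
      then have T: "0 < T" unfolding T_def using powr_ge_zero[of X0 p] powr_ge_zero[of X1 p] by linarith
      define t where "t = T powr (1 / p)"
      have t: "0 < t" "t powr p = T" using T p by (auto simp: t_def powr_powr)
      define A where "A = X0 powr p / T"
      have A: "1 - A = X1 powr p / T" using T by (simp add: A_def T_def field_simps)
      have A01: "A \<in> {0..1}" using T by (auto simp: A_def T_def)
      have X0: "A powr (1 / p) = X0 / t" using X T p by (simp add: A_def t_def powr_divide powr_powr)
      have X1: "(1 - A) powr (1 / p) = X1 / t" using X T p unfolding A by (simp add: t_def powr_divide powr_powr)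
      have JA: "J A = K / t" by (simp add: J_def X0 X1 K flip: add_divide_distrib)
      have K0: "0 \<le> K" using K X by simp
      have "h A = ((X0 + K * W0) / t) powr p + ((X1 + K * W1) / t) powr p"
        by (simp add: h_def X0 X1 JA add_divide_distrib)
      also have "\<dots> = ((X0 + K * W0) powr p + (X1 + K * W1) powr p) / T"
        using X K0 W t by (simp add: powr_divide flip: add_divide_distrib)
      finally have "((X0 + K * W0) powr p + (X1 + K * W1) powr p) / T \<le> B powr p"
        using A0(2)[OF A01] by (simp add: Bp)
      then show ?thesis using T by (simp add: divide_le_eq T_def)
    qed
  qed
qed

section \<open>The algebra of compact operators\<close>

context Lp_unit_interval
begin

section \<open>Norm convergence of the products of a compact operator with the averages\<close>

lemma cell_cong:
  assumes "i < mesh m" "f \<in> LF" "g \<in> LF"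
    "AE x in unit_interval. f x = g x"
  shows "mesh.cell m i f = mesh.cell m i g"
  using mesh.E.\<phi>_cong[OF assms] mesh_pos[of m] by simp

text \<open>Any representative of \<open>T F\<close> serves, as integrals over cells depend on the
  class only. These functionals are the coordinates of the composite of an average with
  \<open>T\<close>.\<close>

definition cell_functional ::
    "nat \<Rightarrow> nat \<Rightarrow> ((real \<Rightarrow> complex) set \<Rightarrow> (real \<Rightarrow> complex) set) \<Rightarrow> (real \<Rightarrow> complex) set \<Rightarrow> complex" where
  "cell_functional m i T = (\<lambda>F\<in>carrier LP. mesh.cell m i (SOME f. f \<in> T F))"

lemma cell_functional_eq:
  assumes "i < mesh m" "F \<in> carrier LP" "T F = cls f" "f \<in> LF"
  shows "cell_functional m i T F = mesh.cell m i f"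
proof -
  have "(SOME g. g \<in> cls f) \<in> cls f" by (rule someI[of _ f]) (rule mem_cls[OF assms(4)])
  then have "mesh.cell m i (SOME g. g \<in> cls f) = mesh.cell m i f"
    by (intro cell_cong assms) (auto simp: in_cls_iff)
  then show ?thesis using assms by (simp add: cell_functional_def)
qed

lemma cell_functional_bounded:
  assumes i: "i < mesh m" and T: "T \<in> bounded_ops LP LP"
  shows "cell_functional m i T \<in> bounded_ops LP complex_space"
proof (rule func.bounded_opsI)
  note lT = bounded_ops_linear[OF T]
  have rep: "\<exists>f. f \<in> LF \<and> T F = cls f" if "F \<in> carrier LP" for F
    using Lp.op_closed[OF T that] by (rule carrier_Lp_cases) auto
  have cf: "cell_functional m i T F = mesh.cell m i f"
    if "F \<in> carrier LP" "T F = cls f" "f \<in> LF" for F f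
    using cell_functional_eq[of i m F T f] i that by simp
  show "cell_functional m i T \<in> linear_maps LP complex_space"
  proof (rule linear_mapsI)
    show "cell_functional m i T \<in> extensional (carrier LP)" by (simp add: cell_functional_def)
    fix F assume F: "F \<in> carrier LP"
    obtain f where f: "f \<in> LF" "T F = cls f" using rep[OF F] by blast
    show "cell_functional m i T (c \<odot>\<^bsub>LP\<^esub> F) = c \<odot>\<^bsub>complex_space\<^esub> cell_functional m i T F" for c
    proof -
      have "T (c \<odot>\<^bsub>LP\<^esub> F) = cls (\<lambda>x. c * f x)"
        using F f by (simp add: Lp.op.linear_smult[OF lT] Lp_smult)
      from cf[OF _ this] cf[OF F f(2,1)] show ?thesis
        using F f by (simp add: Lp_functions_smult mesh.cell_smult)
    qed
    fix G assume G: "G \<in> carrier LP"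
    obtain g where g: "g \<in> LF" "T G = cls g" using rep[OF G] by blast
    have "T (F \<oplus>\<^bsub>LP\<^esub> G) = cls (\<lambda>x. f x + g x)"
      using F G f g by (simp add: Lp.op.linear_add[OF lT] Lp_add)
    from cf[OF _ this] cf[OF F f(2,1)] cf[OF G g(2,1)]
    show "cell_functional m i T (F \<oplus>\<^bsub>LP\<^esub> G) = cell_functional m i T F \<oplus>\<^bsub>complex_space\<^esub> cell_functional m i T G"
      using F G f g i by (simp add: Lp_functions_add mesh.cell_add)
  qed simp
  fix F assume F: "F \<in> carrier LP"
  obtain f where f: "f \<in> LF" "T F = cls f" using rep[OF F] by blast
  have "cmod (mesh.cell m i f) \<le> nrm LP (T F)"
    using mesh.cell_abs_le[OF i f(1)] f by (simp add: Lp_nrm)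
  also have "\<dots> \<le> op_norm LP LP T * nrm LP F" by (rule Lp.op.nrm_op_le[OF T F])
  finally show "nrm complex_space (cell_functional m i T F) \<le> op_norm LP LP T * nrm LP F"
    by (simp add: cf[OF F f(2,1)])
qed

text \<open>Contractions that converge strongly converge uniformly on totally bounded sets, in
  particular on the image of the unit ball under \<open>T\<close>.\<close>

lemma E_compose_tendsto:
  assumes T: "T \<in> compact_ops LP" and e: "0 < e"
  shows "\<exists>N. \<forall>m\<ge>N. \<forall>F\<in>closed_unit_ball LP. nrm LP (E m (T F) \<ominus>\<^bsub>LP\<^esub> T F) \<le> e"
proof -
  have e3: "e / 3 > 0" using e by simp
  obtain H where H: "finite H" "H \<subseteq> carrier LP"
    "\<And>F. F \<in> closed_unit_ball LP \<Longrightarrow> \<exists>G\<in>H. nrm LP (T F \<ominus>\<^bsub>LP\<^esub> G) < e / 3"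
    by (rule Lp.compact_ops_net[OF T e3]) auto
  have "\<forall>G\<in>H. \<exists>N. \<forall>m\<ge>N. nrm LP (E m G \<ominus>\<^bsub>LP\<^esub> G) < e / 3"
    using H(2) E_tendsto[OF _ e3] by (intro ballI) (simp add: subset_iff)
  then obtain N where N: "\<And>G m. G \<in> H \<Longrightarrow> m \<ge> N G \<Longrightarrow> nrm LP (E m G \<ominus>\<^bsub>LP\<^esub> G) < e / 3"
    by metis
  define N' where "N' = Max (insert 0 (N ` H))"
  have N': "N G \<le> N'" if "G \<in> H" for G unfolding N'_def using H(1) that by (intro Max_ge) auto
  have "nrm LP (E m (T F) \<ominus>\<^bsub>LP\<^esub> T F) \<le> e" if m: "m \<ge> N'" and F: "F \<in> closed_unit_ball LP" for m F
  proof -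
    obtain G where G: "G \<in> H" "nrm LP (T F \<ominus>\<^bsub>LP\<^esub> G) < e / 3" using H(3)[OF F] by blast
    have c: "T F \<in> carrier LP" "G \<in> carrier LP" "E m G \<in> carrier LP" "E m (T F) \<in> carrier LP"
      using Lp.op_closed[OF Lp.compact_ops_bounded[OF T] closed_unit_ballD(1)[OF F]] G(1) H(2) E_closed by auto
    have "nrm LP (E m (T F) \<ominus>\<^bsub>LP\<^esub> E m G) \<le> nrm LP (T F \<ominus>\<^bsub>LP\<^esub> G)"
      using E_contractive[of "T F \<ominus>\<^bsub>LP\<^esub> G" m] c by (simp add: Lp.op.linear_minus[OF bounded_ops_linear[OF E_bounded]])
    moreover have "nrm LP (E m G \<ominus>\<^bsub>LP\<^esub> G) < e / 3" using N[OF G(1)] N'[OF G(1)] m by simp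
    ultimately show ?thesis
      using Lp.nrm_triangle_minus[OF c(4,3,1)] Lp.nrm_triangle_minus[OF c(3,2,1)] G(2) Lp.nrm_minus_commute[OF c(1,2)]
      by linarith
  qed
  then show ?thesis by blast
qed

text \<open>By \<open>E_compose_tendsto\<close>, \<open>T\<close> is nearly \<open>E k\<close> after
  \<open>T\<close> for a fixed \<open>k\<close>. That operator has finitely many coordinates, each a
  bounded functional, and every such functional becomes small on \<open>F \<ominus> E m F\<close> by
  \<open>functional_E_tendsto\<close>.\<close>

lemma compose_E_tendsto:
  assumes T: "T \<in> compact_ops LP" and e: "0 < e"
  shows "\<exists>N. \<forall>m\<ge>N. \<forall>F\<in>closed_unit_ball LP. nrm LP (T (E m F) \<ominus>\<^bsub>LP\<^esub> T F) \<le> e"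
proof -
  note bT = Lp.compact_ops_bounded[OF T] and lE = bounded_ops_linear[OF E_bounded]
  note lT = bounded_ops_linear[OF bT]
  have e6: "e / 6 > 0" using e by simp
  obtain k where k: "\<And>F. F \<in> closed_unit_ball LP \<Longrightarrow> nrm LP (E k (T F) \<ominus>\<^bsub>LP\<^esub> T F) \<le> e / 6"
    using E_compose_tendsto[OF T e6] by blast
  define n where "n = mesh k"
  have n: "0 < n" by (simp add: n_def mesh_pos)
  \<comment> \<open>Values of an average are \<open>n\<close> times integrals over cells, so
    integrals of size \<open>d\<close> give values of size \<open>e / 3\<close>; on a probability
    space this also bounds the norm.\<close>
  define d where "d = e / (3 * real n)"
  have d: "d > 0" using e n by (simp add: d_def)
  have "\<forall>i<n. \<exists>N. \<forall>m\<ge>N. \<forall>F\<in>closed_unit_ball LP. cmod (cell_functional k i T (F \<ominus>\<^bsub>LP\<^esub> E m F)) \<le> d"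
    using functional_E_tendsto[OF cell_functional_bounded[OF _ bT] d] by (simp add: n_def)
  then obtain N where N: "\<And>i m F. i < n \<Longrightarrow> m \<ge> N i \<Longrightarrow> F \<in> closed_unit_ball LP \<Longrightarrow>
      cmod (cell_functional k i T (F \<ominus>\<^bsub>LP\<^esub> E m F)) \<le> d"
    by metis
  define N' where "N' = Max (N ` {..<n})"
  have N': "N i \<le> N'" if "i < n" for i unfolding N'_def using that by (intro Max_ge) auto
  have "nrm LP (T (E m F) \<ominus>\<^bsub>LP\<^esub> T F) \<le> e" if m: "m \<ge> N'" and F: "F \<in> closed_unit_ball LP" for m F
  proof -
    have Fc: "F \<in> carrier LP" by (rule closed_unit_ballD(1)[OF F])
    have EF: "E m F \<in> closed_unit_ball LP"
      using E_closed[OF Fc] E_contractive[OF Fc, of m] closed_unit_ballD(2)[OF F] by (simp add: closed_unit_ball_def)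
    define W where "W = F \<ominus>\<^bsub>LP\<^esub> E m F"
    have W: "W \<in> carrier LP" using Fc E_closed[OF Fc] by (simp add: W_def)
    obtain g where g: "g \<in> LF" "T W = cls g"
      using Lp.op_closed[OF bT W] by (rule carrier_Lp_cases) auto
    have "cmod (of_nat n * mesh.cell k i g) \<le> e / 3" if i: "i < n" for i
    proof -
      have "cmod (mesh.cell k i g) \<le> d"
        using N[OF i order_trans[OF N'[OF i] m] F] cell_functional_eq[of i k W T g] W g i by (simp add: W_def n_def)
      then have "real n * cmod (mesh.cell k i g) \<le> real n * d" by (intro mult_left_mono) auto
      then show ?thesis using n by (simp add: norm_mult d_def)
    qed
    then have "cmod (mesh.avg k g x) \<le> e / 3" for x
      unfolding mesh.avg_def using e by (intro mesh.step_bound) (auto simp: n_def)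
    then have "snorm (mesh.avg k g) \<le> e / 3"
      using e by (intro Lp_seminorm_bounded Lp_functionsD(1)[OF mesh.avg_Lp]) auto
    then have EkTW: "nrm LP (E k (T W)) \<le> e / 3" using g by (simp add: E_cls Lp_nrm)
    have TW: "T W = T F \<ominus>\<^bsub>LP\<^esub> T (E m F)" unfolding W_def using Fc E_closed[OF Fc] by (simp add: Lp.op.linear_minus[OF lT])
    have c: "T F \<in> carrier LP" "T (E m F) \<in> carrier LP" "E k (T F) \<in> carrier LP" "E k (T (E m F)) \<in> carrier LP"
      using Lp.op_closed[OF bT] Fc E_closed by auto
    have EkTW': "nrm LP (E k (T F) \<ominus>\<^bsub>LP\<^esub> E k (T (E m F))) \<le> e / 3"
      using EkTW c unfolding TW by (simp add: Lp.op.linear_minus[OF lE])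
    have "nrm LP (T (E m F) \<ominus>\<^bsub>LP\<^esub> T F) \<le>
        nrm LP (T (E m F) \<ominus>\<^bsub>LP\<^esub> E k (T (E m F))) + nrm LP (E k (T (E m F)) \<ominus>\<^bsub>LP\<^esub> T F)"
      by (rule Lp.nrm_triangle_minus[OF c(2,4,1)])
    also have "nrm LP (E k (T (E m F)) \<ominus>\<^bsub>LP\<^esub> T F) \<le>
       nrm LP (E k (T (E m F)) \<ominus>\<^bsub>LP\<^esub> E k (T F)) + nrm LP (E k (T F) \<ominus>\<^bsub>LP\<^esub> T F)"
      by (rule Lp.nrm_triangle_minus[OF c(4,3,1)])
    finally show ?thesis
      using k[OF F] k[OF EF] EkTW' Lp.nrm_minus_commute[OF c(4,3)] Lp.nrm_minus_commute[OF c(2,4)] e by linarith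
  qed
  then show ?thesis by blast
qed

section \<open>The contractive approximate identity and the absence of a unit\<close>

abbreviation K where "K \<equiv> compact_op_algebra LP"

sublocale K: complex_banach_algebra K
  by (rule Lp.compact_op_algebra_banach)

lemma compose_compact: "S \<in> compact_ops LP \<Longrightarrow> T \<in> compact_ops LP \<Longrightarrow> compose (carrier LP) S T \<in> compact_ops LP"
  by (rule Lp.compose_bounded_compact[OF Lp.compact_ops_bounded])

lemma compact_norm_diff_le:
  assumes "S \<in> compact_ops LP" "T \<in> compact_ops LP"
    and "\<And>F. F \<in> closed_unit_ball LP \<Longrightarrow> nrm LP (S F \<ominus>\<^bsub>LP\<^esub> T F) \<le> e"
  shows "nrm K (S \<ominus>\<^bsub>K\<^esub> T) \<le> e"
  using Lp.compact_op_norm_diff_le[OF assms] by simp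

text \<open>\<open>approximately_unital\<close> indexes nets by the algebra itself, so the sequence
  \<open>E\<close> is encoded as the identity map along its image filter.\<close>

lemma E_cai: "cai K (\<lambda>T. T) (filtermap E sequentially)"
  unfolding cai_def
proof (intro conjI ballI)
  show "filtermap E sequentially \<noteq> bot" by (simp add: filtermap_bot_iff)
  show "\<forall>\<^sub>F T in filtermap E sequentially. T \<in> carrier K \<and> nrm K T \<le> 1"
    unfolding eventually_filtermap by (simp add: E_compact E_norm)
  fix T assume "T \<in> carrier K"
  then have T: "T \<in> compact_ops LP" by simp
  show "limitin (nrm_topology K) (\<lambda>S. S \<otimes>\<^bsub>K\<^esub> T) T (filtermap E sequentially)"
    unfolding K.limitin_nrm_iff eventually_filtermap
  proof (intro conjI allI impI)
    fix e :: real assume "e > 0"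
    then obtain N where N: "\<And>m F. m \<ge> N \<Longrightarrow> F \<in> closed_unit_ball LP \<Longrightarrow> nrm LP (E m (T F) \<ominus>\<^bsub>LP\<^esub> T F) \<le> e / 2"
      using E_compose_tendsto[OF T, of "e / 2"] by auto
    show "\<forall>\<^sub>F m in sequentially. E m \<otimes>\<^bsub>K\<^esub> T \<in> carrier K \<and> nrm K (E m \<otimes>\<^bsub>K\<^esub> T \<ominus>\<^bsub>K\<^esub> T) < e"
      unfolding eventually_sequentially
    proof (intro exI[of _ N] allI impI conjI)
      fix m assume m: "m \<ge> N"
      show "E m \<otimes>\<^bsub>K\<^esub> T \<in> carrier K" using compose_compact[OF E_compact T] by simp
      have "nrm K (compose (carrier LP) (E m) T \<ominus>\<^bsub>K\<^esub> T) \<le> e / 2"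
        using N[OF m] by (intro compact_norm_diff_le compose_compact E_compact T) (simp add: compose_def closed_unit_ballD(1))
      then show "nrm K (E m \<otimes>\<^bsub>K\<^esub> T \<ominus>\<^bsub>K\<^esub> T) < e" using \<open>e > 0\<close> by simp
    qed
  qed (use T in simp)
  show "limitin (nrm_topology K) (\<lambda>S. T \<otimes>\<^bsub>K\<^esub> S) T (filtermap E sequentially)"
    unfolding K.limitin_nrm_iff eventually_filtermap
  proof (intro conjI allI impI)
    fix e :: real assume "e > 0"
    then obtain N where N: "\<And>m F. m \<ge> N \<Longrightarrow> F \<in> closed_unit_ball LP \<Longrightarrow> nrm LP (T (E m F) \<ominus>\<^bsub>LP\<^esub> T F) \<le> e / 2"
      using compose_E_tendsto[OF T, of "e / 2"] by auto
    show "\<forall>\<^sub>F m in sequentially. T \<otimes>\<^bsub>K\<^esub> E m \<in> carrier K \<and> nrm K (T \<otimes>\<^bsub>K\<^esub> E m \<ominus>\<^bsub>K\<^esub> T) < e"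
      unfolding eventually_sequentially
    proof (intro exI[of _ N] allI impI conjI)
      fix m assume m: "m \<ge> N"
      show "T \<otimes>\<^bsub>K\<^esub> E m \<in> carrier K" using compose_compact[OF T E_compact] by simp
      have "nrm K (compose (carrier LP) T (E m) \<ominus>\<^bsub>K\<^esub> T) \<le> e / 2"
        using N[OF m] by (intro compact_norm_diff_le compose_compact E_compact T) (simp add: compose_def closed_unit_ballD(1))
      then show "nrm K (T \<otimes>\<^bsub>K\<^esub> E m \<ominus>\<^bsub>K\<^esub> T) < e" using \<open>e > 0\<close> by simp
    qed
  qed (use T in simp)
qed

lemma approximately_unital_K: "approximately_unital K"
  unfolding approximately_unital_def using E_cai K.complex_banach_algebra_axioms by blast

lemma Lp_operator_algebra_K: "Lp_operator_algebra TYPE(real) p K"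
  unfolding Lp_operator_algebra_def
proof (intro conjI exI)
  show "complex_banach_algebra K" by (rule K.complex_banach_algebra_axioms)
  show "norm_closed_subalgebra (compact_ops LP) (op_algebra LP)"
    by (rule Lp.compact_ops_subalgebra)
  show "isometrically_isomorphic K (op_algebra LP\<lparr>carrier := compact_ops LP\<rparr>)"
    using isometrically_isomorphic_refl[OF K.complex_banach_algebra_axioms] by (simp add: compact_op_algebra_def)
qed

text \<open>Such an operator would make the identity compact. But normalised indicators of different
  cells are unit vectors at mutual distance at least 1, and with more cells than net points two of
  them would lie within 1/2 of the same net point.\<close>

lemma no_left_unit:
  assumes e: "e \<in> compact_ops LP" and left: "\<And>F. F \<in> carrier LP \<Longrightarrow> e F = F"
  shows False
proof -
  obtain H where H: "finite H" "H \<subseteq> carrier LP"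
    "\<And>F. F \<in> closed_unit_ball LP \<Longrightarrow> \<exists>G\<in>H. nrm LP (e F \<ominus>\<^bsub>LP\<^esub> G) < 1 / 2"
    by (rule Lp.compact_ops_net[OF e, of "1 / 2"]) auto
  define m where "m = card H"
  define n where "n = mesh m"
  have n: "n > card H" "0 < n" by (auto simp: n_def m_def mesh_def)
  \<comment> \<open>The height n^(1/p) normalises the indicator of a cell of measure 1/n.\<close>
  define b where "b i = (\<lambda>j. if j = i then complex_of_real (real n powr (1 / p)) else 0)" for i :: nat
  have pow: "cmod (b i j) powr p = (if j = i then real n else 0)" for i j
    using p_gt_1 by (simp add: b_def powr_powr)
  have norm_step: "snorm (mesh.step m c) = ((\<Sum>i<n. cmod (c i) powr p) / real n) powr (1 / p)" for c
    unfolding Lp_seminorm_def n_def using p_gt_1 by (subst mesh.integral_step) auto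
  have unit: "cls (mesh.step m (b i)) \<in> closed_unit_ball LP" if "i < n" for i
    using that n by (simp add: closed_unit_ball_def Lp_nrm norm_step pow)
  have "\<forall>i\<in>{..<n}. \<exists>G\<in>H. nrm LP (cls (mesh.step m (b i)) \<ominus>\<^bsub>LP\<^esub> G) < 1 / 2"
    using H(3)[OF unit] left[OF closed_unit_ballD(1)[OF unit]] by simp
  then obtain G where G: "\<And>i. i < n \<Longrightarrow> G i \<in> H" "\<And>i. i < n \<Longrightarrow> nrm LP (cls (mesh.step m (b i)) \<ominus>\<^bsub>LP\<^esub> G i) < 1 / 2"
    by (metis lessThan_iff)
  have "card (G ` {..<n}) < card {..<n}" 
  proof -
    have "G ` {..<n} \<subseteq> H" using G(1) by auto
    then show ?thesis using card_mono[OF H(1), of "G ` {..<n}"] n by simp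
  qed
  then have "\<not> inj_on G {..<n}" by (rule pigeonhole)
  then obtain i j where ij: "i < n" "j < n" "i \<noteq> j" "G i = G j" by (auto simp: inj_on_def)
  have c: "cls (mesh.step m (b i)) \<in> carrier LP" "G i \<in> carrier LP"
    using G(1)[OF ij(1)] H(2) by auto
  have "nrm LP (cls (mesh.step m (b i)) \<ominus>\<^bsub>LP\<^esub> cls (mesh.step m (b j))) < 1"
    using Lp.nrm_triangle_minus[of "cls (mesh.step m (b i))" "G i" "cls (mesh.step m (b j))"] c
      G(2)[OF ij(1)] G(2)[OF ij(2)] Lp.nrm_minus_commute[of "G i" "cls (mesh.step m (b j))"] by (simp add: ij(4))
  moreover have "nrm LP (cls (mesh.step m (b i)) \<ominus>\<^bsub>LP\<^esub> cls (mesh.step m (b j))) \<ge> 1"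
  proof -
    have "(\<lambda>x. mesh.step m (b i) x - mesh.step m (b j) x) = mesh.step m (\<lambda>k. b i k - b j k)"
      unfolding mesh.step_def by (simp only: left_diff_distrib sum_subtractf)
    moreover have "real n \<le> (\<Sum>k<n. cmod (b i k - b j k) powr p)"
    proof -
      have "real n = cmod (b i i - b j i) powr p" using ij p_gt_1 by (simp add: b_def powr_powr)
      also have "\<dots> \<le> (\<Sum>k<n. cmod (b i k - b j k) powr p)"
        using ij(1) by (intro member_le_sum) auto
      finally show ?thesis .
    qed
    then have "1 \<le> ((\<Sum>k<n. cmod (b i k - b j k) powr p) / real n) powr (1 / p)"
      using n p_gt_1 by (intro ge_one_powr_ge_zero) (auto simp: le_divide_eq)
    ultimately show ?thesis by (simp add: Lp_minus Lp_nrm Lp_functions_diff norm_step)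
  qed
  ultimately show False by simp
qed

lemma integral_const_one: "(LINT x|unit_interval. 1) = (1 :: complex)"
  using prob_space by (simp add: scaleR_conv_of_real)

text \<open>A left unit fixes every \<open>rank_one f\<close>. Evaluating at the constant 1, which
  \<open>rank_one f\<close> maps to \<open>f\<close>, shows that it fixes every vector.\<close>

lemma not_unital_K: "\<not> unital K"
proof
  assume "unital K"
  then obtain e where e: "e \<in> compact_ops LP"
    and unit: "\<And>a. a \<in> compact_ops LP \<Longrightarrow> compose (carrier LP) e a = a"
    unfolding unital_def by auto
  have "e F = F" if "F \<in> carrier LP" for F
    using that
  proof (rule carrier_Lp_cases)
    fix f assume f: "f \<in> LF" "F = cls f"
    have "rank_one f (cls (\<lambda>_. 1)) = cls f"
      using rank_one_cls[OF f(1) Lp_functions_const[of 1], unfolded integral_const_one] by simp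
    moreover have "compose (carrier LP) e (rank_one f) (cls (\<lambda>_. 1)) = rank_one f (cls (\<lambda>_. 1))"
      by (simp only: unit[OF rank_one_compact[OF f(1)]])
    ultimately show "e F = F" using f Lp_functions_const[of 1] by (simp add: compose_def)
  qed
  then show False using no_left_unit[OF e] by blast
qed

end

section \<open>The multiplier unitization\<close>

lemma multiplier_unitization_simps [simp]:
  "carrier (multiplier_unitization A) = carrier A \<times> UNIV"
  "\<one>\<^bsub>multiplier_unitization A\<^esub> = (\<zero>\<^bsub>A\<^esub>, 1)"
  "((a, l) \<oplus>\<^bsub>multiplier_unitization A\<^esub> (b, m)) = (a \<oplus>\<^bsub>A\<^esub> b, l + m)"
  "c \<odot>\<^bsub>multiplier_unitization A\<^esub> (a, l) = (c \<odot>\<^bsub>A\<^esub> a, c * l)"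
  "nrm (multiplier_unitization A) (a, l) = (SUP c\<in>closed_unit_ball A. nrm A (a \<otimes>\<^bsub>A\<^esub> c \<oplus>\<^bsub>A\<^esub> l \<odot>\<^bsub>A\<^esub> c))"
  by (simp_all add: multiplier_unitization_def)

lemma sum_lessThan_double: "(\<Sum>j<2 * k. h j) = (\<Sum>i<k. h (2 * i) + h (Suc (2 * i)))"
  for h :: "nat \<Rightarrow> 'a :: comm_monoid_add"
  by (induction k) (simp_all add: add.assoc)

lemma sum_lessThan_if: "(\<Sum>i<k + j. if i < k then a else b) = real k * a + real j * b"
  for a b :: real
  by (induction j) (simp_all add: algebra_simps)

context Lp_unit_interval
begin

abbreviation U where "U \<equiv> multiplier_unitization K"

lemma one_Lp: "(\<lambda>_. 1) \<in> LF"
  by (rule Lp_functions_const)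

lemma one_unit_ball: "cls (\<lambda>_. 1) \<in> closed_unit_ball LP"
  using Lp_seminorm_bounded[of "\<lambda>_. 1" 1] by (simp add: closed_unit_ball_def Lp_nrm one_Lp)

lemma unitization_term_le:
  assumes T: "T \<in> compact_ops LP" and c: "c \<in> closed_unit_ball K" and B: "0 \<le> B"
    and le: "\<And>F. F \<in> carrier LP \<Longrightarrow> nrm LP (T F \<oplus>\<^bsub>LP\<^esub> l \<odot>\<^bsub>LP\<^esub> F) \<le> B * nrm LP F"
  shows "nrm K (T \<otimes>\<^bsub>K\<^esub> c \<oplus>\<^bsub>K\<^esub> l \<odot>\<^bsub>K\<^esub> c) \<le> B"
proof -
  have cK: "c \<in> bounded_ops LP LP" "op_norm LP LP c \<le> 1"
    using closed_unit_ballD[OF c] Lp.compact_ops_bounded by auto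
  have "op_norm LP LP (T \<otimes>\<^bsub>K\<^esub> c \<oplus>\<^bsub>K\<^esub> l \<odot>\<^bsub>K\<^esub> c) \<le> B"
  proof (rule Lp.op.op_norm_le)
    fix F assume F: "F \<in> closed_unit_ball LP"
    have Fc: "F \<in> carrier LP" by (rule closed_unit_ballD(1)[OF F])
    have cF: "c F \<in> carrier LP" by (rule Lp.op_closed[OF cK(1) Fc])
    have "nrm LP (c F) \<le> 1" using Lp.op.op_norm_upper[OF cK(1) F] cK(2) by linarith
    then have "B * nrm LP (c F) \<le> B * 1" by (rule mult_left_mono[OF _ B])
    then show "nrm LP ((T \<otimes>\<^bsub>K\<^esub> c \<oplus>\<^bsub>K\<^esub> l \<odot>\<^bsub>K\<^esub> c) F) \<le> B"
      using le[OF cF] Fc by (simp add: compose_def)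
  qed
  then show ?thesis by (simp only: compact_op_algebra_simps)
qed

lemma unitization_norm_le:
  assumes "T \<in> compact_ops LP" "0 \<le> B"
    and "\<And>F. F \<in> carrier LP \<Longrightarrow> nrm LP (T F \<oplus>\<^bsub>LP\<^esub> l \<odot>\<^bsub>LP\<^esub> F) \<le> B * nrm LP F"
  shows "nrm U (T, l) \<le> B"
  unfolding multiplier_unitization_simps
  using zero_in_unit_ball[OF K.complex_normed_space_axioms] unitization_term_le[OF assms(1) _ assms(2,3)]
  by (intro cSUP_least) auto

text \<open>Together with \<open>unitization_norm_le\<close> this identifies the norm of the
  unitization with the operator norm of T + l on L^p. The test element is the rank one contraction
  that sends the constant 1 to the normalised \<open>F\<close>; evaluating at 1 recovers the value
  at \<open>F\<close>.\<close>

lemma unitization_norm_upper: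
  assumes T: "T \<in> compact_ops LP" and F: "F \<in> carrier LP"
  shows "nrm LP (T F \<oplus>\<^bsub>LP\<^esub> l \<odot>\<^bsub>LP\<^esub> F) \<le> nrm U (T, l) * nrm LP F"
proof (cases "nrm LP F = 0")
  case True
  then have "F = \<zero>\<^bsub>LP\<^esub>" using Lp.nrm_eq_0_iff[OF F] by simp
  then show ?thesis
    using Lp.op.linear_zero[OF bounded_ops_linear[OF Lp.compact_ops_bounded[OF T]]] by simp
next
  case False
  note bT = Lp.compact_ops_bounded[OF T]
  have pos: "0 < nrm LP F" using False Lp.nrm_nonneg[OF F] by linarith
  obtain f where f: "f \<in> LF" "F = cls f" using F by (rule carrier_Lp_cases)
  define a where "a = complex_of_real (1 / nrm LP F)"
  have a: "cmod a = 1 / nrm LP F" using pos by (simp add: a_def norm_divide)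
  define f' where "f' = (\<lambda>x. a * f x)"
  have f': "f' \<in> LF" unfolding f'_def by (rule Lp_functions_smult[OF f(1)])
  have clsf': "cls f' = a \<odot>\<^bsub>LP\<^esub> F" using f by (simp add: f'_def Lp_smult)
  define c where "c = rank_one f'"
  have nf': "snorm f' = 1"
    using pos f by (simp add: f'_def Lp_seminorm_smult a) (simp add: Lp_nrm)
  have c: "c \<in> closed_unit_ball K"
    using rank_one_compact[OF f'] rank_one_norm_le[OF f'] nf' by (simp add: closed_unit_ball_def c_def)
  have c1: "c (cls (\<lambda>_. 1)) = cls f'"
    unfolding c_def using rank_one_cls[OF f' one_Lp, unfolded integral_const_one] by simp
  have S: "T \<otimes>\<^bsub>K\<^esub> c \<oplus>\<^bsub>K\<^esub> l \<odot>\<^bsub>K\<^esub> c \<in> carrier K"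
    using T closed_unit_ballD(1)[OF c] by (intro K.a_closed K.smult_cl K.mult_closed) auto
  then have bS: "T \<otimes>\<^bsub>K\<^esub> c \<oplus>\<^bsub>K\<^esub> l \<odot>\<^bsub>K\<^esub> c \<in> bounded_ops LP LP"
    using Lp.compact_ops_bounded by simp
  have TF: "T F \<in> carrier LP" by (rule Lp.op_closed[OF bT F])
  have "nrm LP (T F \<oplus>\<^bsub>LP\<^esub> l \<odot>\<^bsub>LP\<^esub> F) / nrm LP F
      = nrm LP (a \<odot>\<^bsub>LP\<^esub> (T F \<oplus>\<^bsub>LP\<^esub> l \<odot>\<^bsub>LP\<^esub> F))"
    using TF F by (simp add: Lp.nrm_smult a)
  also have "a \<odot>\<^bsub>LP\<^esub> (T F \<oplus>\<^bsub>LP\<^esub> l \<odot>\<^bsub>LP\<^esub> F) = T (cls f') \<oplus>\<^bsub>LP\<^esub> l \<odot>\<^bsub>LP\<^esub> cls f'"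
    using TF F by (simp add: clsf' Lp.smult_add_right Lp.op.linear_smult[OF bounded_ops_linear[OF bT]] mult.commute flip: Lp.smult_mult)
  also have "\<dots> = (T \<otimes>\<^bsub>K\<^esub> c \<oplus>\<^bsub>K\<^esub> l \<odot>\<^bsub>K\<^esub> c) (cls (\<lambda>_. 1))"
    using one_Lp by (simp add: compose_def c1)
  also have "nrm LP \<dots> \<le> nrm K (T \<otimes>\<^bsub>K\<^esub> c \<oplus>\<^bsub>K\<^esub> l \<odot>\<^bsub>K\<^esub> c)"
    using Lp.op.op_norm_upper[OF bS one_unit_ball] by (simp only: compact_op_algebra_simps)
  also have "\<dots> \<le> nrm U (T, l)"
    unfolding multiplier_unitization_simps
  proof (rule cSUP_upper[OF c])
    show "bdd_above ((\<lambda>c. nrm K (T \<otimes>\<^bsub>K\<^esub> c \<oplus>\<^bsub>K\<^esub> l \<odot>\<^bsub>K\<^esub> c)) ` closed_unit_ball K)"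
    proof (rule bdd_aboveI2, rule unitization_term_le[OF T])
      show "0 \<le> op_norm LP LP T + cmod l" using Lp.op.op_norm_nonneg[OF bT] by simp
      show "nrm LP (T F \<oplus>\<^bsub>LP\<^esub> l \<odot>\<^bsub>LP\<^esub> F) \<le> (op_norm LP LP T + cmod l) * nrm LP F"
        if F: "F \<in> carrier LP" for F
        using Lp.nrm_triangle[OF Lp.op_closed[OF bT F] Lp.smult_cl[OF F, of l]] Lp.op.nrm_op_le[OF bT F]
        by (simp add: Lp.nrm_smult[OF F] algebra_simps)
    qed
  qed
  finally show ?thesis using pos by (simp add: divide_le_eq)
qed

lemma unitization_norm_nonneg:
  assumes T: "T \<in> compact_ops LP" shows "0 \<le> nrm U (T, l)"
proof -
  have c: "cls (\<lambda>_. 1) \<in> carrier LP" using one_Lp by simp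
  have "0 \<le> nrm LP (T (cls (\<lambda>_. 1)) \<oplus>\<^bsub>LP\<^esub> l \<odot>\<^bsub>LP\<^esub> cls (\<lambda>_. 1))"
    using Lp.op_closed[OF Lp.compact_ops_bounded[OF T] c] c by (intro Lp.nrm_nonneg) simp
  also have "\<dots> \<le> nrm U (T, l) * nrm LP (cls (\<lambda>_. 1))" by (rule unitization_norm_upper[OF T c])
  finally show ?thesis
    using one_Lp prob_space by (simp add: Lp_nrm Lp_seminorm_def del: multiplier_unitization_simps)
qed

text \<open>The usual scaling argument, performed directly on \<open>U\<close>. With a positive
  bound \<open>B\<close> in place of the norm itself, division is always possible.\<close>

lemma unital_state_le:
  assumes \<omega>: "\<omega> \<in> unital_states U" and T: "T \<in> compact_ops LP" and B: "0 < B" "nrm U (T, l) \<le> B"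
  shows "cmod (\<omega> (T, l)) \<le> B"
proof -
  have b\<omega>: "\<omega> \<in> bounded_ops U complex_space" and n\<omega>: "op_norm U complex_space \<omega> = 1"
    using \<omega> by (auto simp: unital_states_def)
  obtain C where C: "\<And>x. x \<in> carrier U \<Longrightarrow> cmod (\<omega> x) \<le> C * nrm U x"
    using b\<omega> by (auto simp: bounded_ops_def simp del: multiplier_unitization_simps)
  have smult: "\<omega> (c \<odot>\<^bsub>U\<^esub> (T, l)) = c * \<omega> (T, l)" for c
    using b\<omega> T by (auto simp: bounded_ops_def linear_maps_def)
  have bdd: "bdd_above ((\<lambda>x. nrm complex_space (\<omega> x)) ` closed_unit_ball U)"
  proof (rule bdd_aboveI2)
    fix x assume x: "x \<in> closed_unit_ball U"
    obtain S k where S: "x = (S, k)" "S \<in> compact_ops LP" using closed_unit_ballD(1)[OF x] by (cases x) auto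
    have "cmod (\<omega> x) \<le> C * nrm U x" using C[OF closed_unit_ballD(1)[OF x]] .
    also have "\<dots> \<le> \<bar>C\<bar> * 1"
      using closed_unit_ballD(2)[OF x] unitization_norm_nonneg[OF S(2), of k] unfolding S(1) by (intro mult_mono) auto
    finally show "nrm complex_space (\<omega> x) \<le> \<bar>C\<bar>" by simp
  qed
  define a where "a = complex_of_real (1 / B)"
  have a: "cmod a = 1 / B" using B by (simp add: a_def norm_divide)
  have aT: "a \<odot>\<^bsub>K\<^esub> T \<in> compact_ops LP" using K.smult_cl[of T a] T by simp
  have "nrm U (a \<odot>\<^bsub>K\<^esub> T, a * l) \<le> 1"
  proof (rule unitization_norm_le[OF aT])
    fix F assume F: "F \<in> carrier LP"
    have TF: "T F \<in> carrier LP" by (rule Lp.op_closed[OF Lp.compact_ops_bounded[OF T] F])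
    have "(a \<odot>\<^bsub>K\<^esub> T) F \<oplus>\<^bsub>LP\<^esub> (a * l) \<odot>\<^bsub>LP\<^esub> F = a \<odot>\<^bsub>LP\<^esub> (T F \<oplus>\<^bsub>LP\<^esub> l \<odot>\<^bsub>LP\<^esub> F)"
      using F TF by (simp add: Lp.smult_add_right Lp.smult_mult)
    then have "nrm LP ((a \<odot>\<^bsub>K\<^esub> T) F \<oplus>\<^bsub>LP\<^esub> (a * l) \<odot>\<^bsub>LP\<^esub> F)
        = nrm LP (T F \<oplus>\<^bsub>LP\<^esub> l \<odot>\<^bsub>LP\<^esub> F) / B"
      using F TF by (simp add: Lp.nrm_smult a)
    also have "\<dots> \<le> B * nrm LP F / B"
      using unitization_norm_upper[OF T F, of l] mult_right_mono[OF B(2) Lp.nrm_nonneg[OF F]] B(1)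
      by (intro divide_right_mono) auto
    finally show "nrm LP ((a \<odot>\<^bsub>K\<^esub> T) F \<oplus>\<^bsub>LP\<^esub> (a * l) \<odot>\<^bsub>LP\<^esub> F) \<le> 1 * nrm LP F"
      using B(1) by simp
  qed simp
  then have "a \<odot>\<^bsub>U\<^esub> (T, l) \<in> closed_unit_ball U"
    unfolding closed_unit_ball_def multiplier_unitization_simps(4) using aT
    by (simp del: multiplier_unitization_simps(5) add: mem_Times_iff)
  then have "nrm complex_space (\<omega> (a \<odot>\<^bsub>U\<^esub> (T, l))) \<le> op_norm U complex_space \<omega>"
    unfolding op_norm_def by (rule cSUP_upper[OF _ bdd])
  then show ?thesis using B(1) unfolding smult n\<omega> by (simp add: norm_mult a divide_le_eq)
qed

end

section \<open>A state on the multiplier unitization\<close>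

context Lp_unit_interval
begin

text \<open>
  On the left half of the interval, \<open>osc m\<close> is 1; on the right half it alternates between 2 and 0 at a
  scale below \<open>mesh m\<close>. Up to normalisation, \<open>osc_dual m\<close> is the norming functional of \<open>osc m\<close>. The
  cell averages of \<open>osc m\<close> are 1 and those of \<open>osc_dual m\<close> are the values of \<open>weight\<close>, where
  \<open>2 powr (p - 2)\<close> is the mean of \<open>2 powr (p - 1)\<close> and 0. So \<open>psi\<close> is the weak limit of the vector
  states given by \<open>osc m\<close>.
\<close>

definition weight :: "nat \<Rightarrow> complex" where
  "weight i = (if i = 0 then 1 else of_real (2 powr (p - 2)))"

text \<open>The p-th power of the norm of every \<open>osc m\<close>, and also its pairing with
  \<open>osc_dual m\<close>: the left half contributes 1/2, the right half 1/2 times the mean of 2^p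
  and 0.\<close>

definition mass :: real where "mass = 1 / 2 + 2 powr (p - 2)"

definition psi :: "((real \<Rightarrow> complex) set \<Rightarrow> (real \<Rightarrow> complex) set) \<Rightarrow> complex" where
  "psi T = (\<Sum>i<mesh 0. weight i * cell_functional 0 i T (cls (\<lambda>_. 1))) / of_real mass"

definition osc_coeff :: "nat \<Rightarrow> nat \<Rightarrow> complex" where
  "osc_coeff m j = (if j < mesh m then 1 else if even j then 2 else 0)"

definition osc :: "nat \<Rightarrow> real \<Rightarrow> complex" where
  "osc m = mesh.step (Suc (2 * m)) (osc_coeff m)"

definition osc_dual :: "nat \<Rightarrow> real \<Rightarrow> complex" where
  "osc_dual m = mesh.step (Suc (2 * m)) (\<lambda>j. of_real (cmod (osc_coeff m j) powr (p - 1)))"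

lemma mass_pos: "0 < mass"
  by (simp add: mass_def add_pos_pos)

lemma mesh_double: "mesh (Suc (2 * m)) = 2 * mesh m"
  by (simp add: mesh_def)

lemma mesh_cell_split:
  "indicator (mesh_cell m i) x = (indicator (mesh_cell (Suc (2 * m)) (2 * i)) x + indicator (mesh_cell (Suc (2 * m)) (Suc (2 * i))) x :: complex)"
proof -
  define n where "n = real (mesh m)"
  have n: "0 < n" using mesh_pos by (simp add: n_def)
  have e: "real (2 * i) / real (mesh (Suc (2 * m))) = real i / n" "real (Suc (Suc (2 * i))) / real (mesh (Suc (2 * m))) = real (Suc i) / n"
    "real i / n \<le> real (Suc (2 * i)) / real (mesh (Suc (2 * m)))" "real (Suc (2 * i)) / real (mesh (Suc (2 * m))) \<le> real (Suc i) / n"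
    unfolding mesh_double using n by (simp_all add: n_def[symmetric] field_simps)
  show ?thesis
    unfolding mesh_cell_def e(1,2) n_def[symmetric] using e(3,4) by (auto simp: indicator_def)
qed

lemma cell_refine:
  assumes i: "i < mesh m" and f: "f \<in> LF"
  shows "mesh.cell m i f = mesh.cell (Suc (2 * m)) (2 * i) f + mesh.cell (Suc (2 * m)) (Suc (2 * i)) f"
proof -
  have lt: "2 * i < mesh (Suc (2 * m))" "Suc (2 * i) < mesh (Suc (2 * m))" using i unfolding mesh_double by auto
  show ?thesis
    unfolding mesh.cell_def mesh_cell_split[of m i] distrib_right
    by (rule Bochner_Integration.integral_add[OF mesh.indicator_mult_integrable[OF lt(1) Lp_integrable[OF f]]
          mesh.indicator_mult_integrable[OF lt(2) Lp_integrable[OF f]]])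
qed

lemma cell_step_refine:
  assumes i: "i < mesh m"
  shows "mesh.cell m i (mesh.step (Suc (2 * m)) d) = (d (2 * i) + d (Suc (2 * i))) / of_nat (2 * mesh m)"
proof -
  have lt: "2 * i < mesh (Suc (2 * m))" "Suc (2 * i) < mesh (Suc (2 * m))" using i unfolding mesh_double by auto
  show ?thesis
    unfolding cell_refine[OF i mesh.step_Lp] mesh.cell_step[OF lt(1)] mesh.cell_step[OF lt(2)]
    unfolding mesh_double add_divide_distrib ..
qed

lemma cell_const: "i < mesh m \<Longrightarrow> mesh.cell m i (\<lambda>_. a) = a / of_nat (mesh m)"
proof -
  assume i: "i < mesh m"
  have "mesh.cell m i (\<lambda>_. a) = mesh.cell m i (mesh.step m (\<lambda>_. a))"
    unfolding mesh.cell_def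
    by (intro Bochner_Integration.integral_cong refl) (auto simp: indicator_def mesh.step_in[OF i])
  then show ?thesis using mesh.cell_step[OF i] by simp
qed

lemma cell_coarse:
  assumes i: "i < mesh m"
  shows "mesh.cell m i (mesh.step 0 c) = c (if i < Suc m then 0 else 1) / of_nat (mesh m)"
proof -
  define k where "k = (if i < Suc m then 0 else 1 :: nat)"
  have k: "k < mesh 0" by (simp add: k_def mesh_def)
  have sub: "mesh_cell m i \<subseteq> mesh_cell 0 k"
  proof (cases "i < Suc m")
    case True
    then have "real (Suc i) \<le> real (Suc m)" by (simp only: of_nat_le_iff Suc_le_eq)
    then have "real (Suc i) / real (mesh m) \<le> 1 / 2" by (simp add: mesh_def field_simps)
    then show ?thesis using True by (auto simp: mesh_cell_def k_def mesh_def[of 0] intro: order_trans[OF _ ] less_le_trans)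
  next
    case False
    then have "real (Suc m) \<le> real i" by (simp only: of_nat_le_iff not_less)
    then have "1 / 2 \<le> real i / real (mesh m)" by (simp add: mesh_def field_simps)
    moreover have "real (Suc i) / real (mesh m) \<le> 1"
      using i by (simp add: divide_le_eq mesh_def del: of_nat_Suc)
    ultimately show ?thesis using False by (auto simp: mesh_cell_def k_def mesh_def[of 0])
  qed
  have "mesh.cell m i (mesh.step 0 c) = mesh.cell m i (\<lambda>_. c k)"
    unfolding mesh.cell_def
    by (intro Bochner_Integration.integral_cong refl) (use sub in \<open>auto simp: indicator_def mesh.step_in[OF k]\<close>)
  then show ?thesis using cell_const[OF i] by (simp add: k_def)
qed

lemma osc_coeff_even_odd:
  assumes "i < mesh m"
  shows "osc_coeff m (2 * i) = (if i < Suc m then 1 else 2)"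
    "osc_coeff m (Suc (2 * i)) = (if i < Suc m then 1 else 0)"
proof -
  have "2 * i < mesh m \<longleftrightarrow> i < Suc m" "Suc (2 * i) < mesh m \<longleftrightarrow> i < Suc m"
    by (auto simp: mesh_def)
  then show "osc_coeff m (2 * i) = (if i < Suc m then 1 else 2)"
    "osc_coeff m (Suc (2 * i)) = (if i < Suc m then 1 else 0)"
    by (simp_all add: osc_coeff_def)
qed

lemma cell_osc: "i < mesh m \<Longrightarrow> mesh.cell m i (osc m) = mesh.cell m i (\<lambda>_. 1)"
  unfolding osc_def by (simp add: cell_step_refine cell_const osc_coeff_even_odd)

lemma cell_osc_dual: "i < mesh m \<Longrightarrow> mesh.cell m i (osc_dual m) = mesh.cell m i (mesh.step 0 weight)"
proof -
  have "(2::real) powr (p - 1) = 2 * 2 powr (p - 2)"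
    using powr_add[of "2::real" 1 "p - 2"] by (simp add: algebra_simps)
  then show "i < mesh m \<Longrightarrow> mesh.cell m i (osc_dual m) = mesh.cell m i (mesh.step 0 weight)"
    unfolding osc_dual_def
    by (simp add: cell_step_refine cell_coarse osc_coeff_even_odd weight_def)
qed

text \<open>Each cell of \<open>mesh m\<close> splits into two and contributes 1 + 1 on the left
  half and 2^p + 0 on the right half.\<close>

lemma sum_osc_coeff: "(\<Sum>j<mesh (Suc (2 * m)). cmod (osc_coeff m j) powr p) = real (mesh (Suc (2 * m))) * mass"
proof -
  have "(\<Sum>j<mesh (Suc (2 * m)). cmod (osc_coeff m j) powr p)
    = (\<Sum>i<mesh m. cmod (osc_coeff m (2 * i)) powr p + cmod (osc_coeff m (Suc (2 * i))) powr p)"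
    unfolding mesh_double by (rule sum_lessThan_double)
  also have "\<dots> = (\<Sum>i<Suc m + Suc m. if i < Suc m then 2 else 2 powr p)"
  proof (rule sum.cong)
    show "{..<mesh m} = {..<Suc m + Suc m}" by (simp add: mesh_def)
    fix i assume "i \<in> {..<Suc m + Suc m}"
    then have "i < mesh m" by (simp add: mesh_def)
    then show "cmod (osc_coeff m (2 * i)) powr p + cmod (osc_coeff m (Suc (2 * i))) powr p = (if i < Suc m then 2 else 2 powr p)"
      using p_gt_1 by (simp add: osc_coeff_even_odd)
  qed
  also have "\<dots> = real (Suc m) * 2 + real (Suc m) * 2 powr p" by (rule sum_lessThan_if)
  also have "\<dots> = real (mesh (Suc (2 * m))) * mass"
    using powr_add[of "2::real" 2 "p - 2"] by (simp add: mesh_def mass_def algebra_simps)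
  finally show ?thesis .
qed

lemma osc_norm: "snorm (osc m) = mass powr (1 / p)"
  unfolding Lp_seminorm_def osc_def
  using p_gt_1 mesh_pos[of "Suc (2 * m)"] by (subst mesh.integral_step) (simp_all only: sum_osc_coeff, simp_all)

lemma osc_dual_norm: "Lp_seminorm (p / (p - 1)) unit_interval (osc_dual m) = mass powr (1 - 1 / p)"
proof -
  have "(\<Sum>j<mesh (Suc (2 * m)). cmod (of_real (cmod (osc_coeff m j) powr (p - 1)) :: complex) powr (p / (p - 1)))
    = (\<Sum>j<mesh (Suc (2 * m)). cmod (osc_coeff m j) powr p)"
    using p_gt_1 by (intro sum.cong refl) (simp add: powr_powr)
  then have "(LINT x|unit_interval. cmod (osc_dual m x) powr (p / (p - 1))) = mass"
    unfolding osc_dual_def using p_gt_1 mesh_pos[of "Suc (2 * m)"]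
    by (subst mesh.integral_step) (simp_all only: sum_osc_coeff, simp_all)
  then show ?thesis using p_gt_1 by (simp add: Lp_seminorm_def field_simps)
qed

lemma step_Lq: "mesh.step m c \<in> Lp_functions (p / (p - 1)) unit_interval"
proof -
  interpret Q: Lp_unit_interval "p / (p - 1)" by unfold_locales (rule conj_exponent)
  have "cmod (mesh.step m c x) \<le> (\<Sum>i<mesh m. cmod (c i))" for x
    by (intro mesh.step_bound member_le_sum sum_nonneg) auto
  then show ?thesis by (intro Q.Lp_functions_bounded[OF mesh.step_measurable]) auto
qed

lemma integral_osc_dual_osc: "(LINT x|unit_interval. osc_dual m x * osc m x) = of_real mass"
proof -
  have "(LINT x|unit_interval. osc_dual m x * osc m x)
     = (\<Sum>j<mesh (Suc (2 * m)). of_real (cmod (osc_coeff m j) powr (p - 1)) * mesh.cell (Suc (2 * m)) j (osc m))"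
    unfolding osc_dual_def by (rule mesh.integral_step_mult[OF Lp_integrable]) (simp add: osc_def)
  also have "\<dots> = (\<Sum>j<mesh (Suc (2 * m)). of_real (cmod (osc_coeff m j) powr p / real (mesh (Suc (2 * m)))))"
  proof (intro sum.cong refl)
    fix j assume j: "j \<in> {..<mesh (Suc (2 * m))}"
    have "osc_coeff m j = of_real (cmod (osc_coeff m j))" by (simp add: osc_coeff_def)
    moreover have "cmod (osc_coeff m j) powr (p - 1) * cmod (osc_coeff m j) = cmod (osc_coeff m j) powr p"
      by (cases "osc_coeff m j = 0") (simp_all add: powr_diff)
    ultimately have "of_real (cmod (osc_coeff m j) powr (p - 1)) * osc_coeff m j = of_real (cmod (osc_coeff m j) powr p)"
      by (metis of_real_mult)
    then show "of_real (cmod (osc_coeff m j) powr (p - 1)) * mesh.cell (Suc (2 * m)) j (osc m)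
        = of_real (cmod (osc_coeff m j) powr p / real (mesh (Suc (2 * m))))"
      using j by (simp add: osc_def mesh.cell_step)
  qed
  also have "\<dots> = of_real ((\<Sum>j<mesh (Suc (2 * m)). cmod (osc_coeff m j) powr p) / real (mesh (Suc (2 * m))))"
    by (simp only: sum_divide_distrib of_real_sum)
  also have "\<dots> = of_real mass" unfolding sum_osc_coeff using mesh_pos[of "Suc (2 * m)"] by simp
  finally show ?thesis .
qed

lemma psi_eq:
  assumes T: "T \<in> bounded_ops LP LP" and v: "v \<in> LF" "T (cls (\<lambda>_. 1)) = cls v"
  shows "psi T = (LINT x|unit_interval. mesh.step 0 weight x * v x) / of_real mass"
  unfolding psi_def mesh.integral_step_mult[OF Lp_integrable[OF v(1)]]
  using one_Lp v by (intro arg_cong2[where f = "(/)"] sum.cong refl) (simp add: cell_functional_eq)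

text \<open>The compression of \<open>T\<close> to step functions. It approximates \<open>T\<close>
  in norm and sees only integrals over the cells of \<open>mesh m\<close>, which the oscillation at
  a finer scale does not change.\<close>

definition sandwich :: "nat \<Rightarrow> ((real \<Rightarrow> complex) set \<Rightarrow> (real \<Rightarrow> complex) set) \<Rightarrow> (real \<Rightarrow> complex) set \<Rightarrow> (real \<Rightarrow> complex) set" where
  "sandwich m T = compose (carrier LP) (E m) (compose (carrier LP) T (E m))"

lemma sandwich_compact: "T \<in> compact_ops LP \<Longrightarrow> sandwich m T \<in> compact_ops LP"
  unfolding sandwich_def by (intro compose_compact E_compact)

lemma sandwich_apply: "F \<in> carrier LP \<Longrightarrow> sandwich m T F = E m (T (E m F))"
  by (simp add: sandwich_def compose_def)

lemma sandwich_tendsto: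
  assumes T: "T \<in> compact_ops LP" and e: "0 < e"
  shows "\<exists>m. nrm K (sandwich m T \<ominus>\<^bsub>K\<^esub> T) \<le> e"
proof -
  have e2: "e / 2 > 0" using e by simp
  obtain N1 where N1: "\<And>m F. m \<ge> N1 \<Longrightarrow> F \<in> closed_unit_ball LP \<Longrightarrow> nrm LP (E m (T F) \<ominus>\<^bsub>LP\<^esub> T F) \<le> e / 2"
    using E_compose_tendsto[OF T e2] by blast
  obtain N2 where N2: "\<And>m F. m \<ge> N2 \<Longrightarrow> F \<in> closed_unit_ball LP \<Longrightarrow> nrm LP (T (E m F) \<ominus>\<^bsub>LP\<^esub> T F) \<le> e / 2"
    using compose_E_tendsto[OF T e2] by blast
  define m where "m = max N1 N2"
  have "nrm K (sandwich m T \<ominus>\<^bsub>K\<^esub> T) \<le> e"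
  proof (rule compact_norm_diff_le[OF sandwich_compact[OF T] T])
    fix F assume F: "F \<in> closed_unit_ball LP"
    have Fc: "F \<in> carrier LP" by (rule closed_unit_ballD(1)[OF F])
    have c: "T F \<in> carrier LP" "T (E m F) \<in> carrier LP" "E m (T F) \<in> carrier LP" "E m (T (E m F)) \<in> carrier LP"
      using Lp.op_closed[OF Lp.compact_ops_bounded[OF T]] Fc E_closed by auto
    have "nrm LP (E m (T (E m F)) \<ominus>\<^bsub>LP\<^esub> E m (T F)) \<le> nrm LP (T (E m F) \<ominus>\<^bsub>LP\<^esub> T F)"
      using E_contractive[of "T (E m F) \<ominus>\<^bsub>LP\<^esub> T F" m] c
      by (simp add: Lp.op.linear_minus[OF bounded_ops_linear[OF E_bounded]])
    then show "nrm LP (sandwich m T F \<ominus>\<^bsub>LP\<^esub> T F) \<le> e"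
      using Lp.nrm_triangle_minus[OF c(4,3,1)] N1[OF _ F, of m] N2[OF _ F, of m]
      unfolding sandwich_apply[OF Fc] by (simp add: m_def)
  qed
  then show ?thesis by blast
qed

text \<open>The inner \<open>E m\<close> does not distinguish \<open>osc m\<close> from 1. The outer
  one produces a function that is constant on cells, against which \<open>osc_dual m\<close> and the
  step function of \<open>weight\<close> have the same integral. So on compressions
  \<open>psi\<close> is exactly the vector state of \<open>osc m\<close>, with no limit to be
  taken.\<close>

lemma psi_sandwich:
  assumes T: "T \<in> compact_ops LP"
  obtains h where "h \<in> LF" "sandwich m T (cls (osc m)) = cls h"
    "psi (sandwich m T) = (LINT x|unit_interval. osc_dual m x * h x) / of_real mass"
proof -
  have oscL: "osc m \<in> LF" by (simp add: osc_def)
  have "mesh.avg m (osc m) = mesh.avg m (\<lambda>_. 1)"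
    unfolding mesh.avg_def mesh.step_def by (intro ext sum.cong refl) (simp add: cell_osc)
  then have eq: "E m (cls (osc m)) = E m (cls (\<lambda>_. 1))" by (simp add: E_cls oscL one_Lp)
  have "T (E m (cls (\<lambda>_. 1))) \<in> carrier LP"
    using Lp.op_closed[OF Lp.compact_ops_bounded[OF T]] E_closed one_Lp by simp
  then obtain v where v: "v \<in> LF" "T (E m (cls (\<lambda>_. 1))) = cls v"
    by (rule carrier_Lp_cases)
  have S: "sandwich m T (cls (osc m)) = cls (mesh.avg m v)" "sandwich m T (cls (\<lambda>_. 1)) = cls (mesh.avg m v)"
    using v oscL one_Lp by (simp_all add: sandwich_apply eq E_cls)
  have avg_int: "(LINT x|unit_interval. w x * mesh.avg m v x) = (\<Sum>i<mesh m. (of_nat (mesh m) * mesh.cell m i v) * mesh.cell m i w)"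
    if "w \<in> LF" for w
    using mesh.integral_step_mult[OF Lp_integrable[OF that], of m "\<lambda>i. of_nat (mesh m) * mesh.cell m i v"]
    by (simp add: mesh.avg_def mult.commute)
  have L: "osc_dual m \<in> LF" by (simp add: osc_dual_def)
  have "(LINT x|unit_interval. osc_dual m x * mesh.avg m v x) = (LINT x|unit_interval. mesh.step 0 weight x * mesh.avg m v x)"
    unfolding avg_int[OF L] avg_int[OF mesh.step_Lp] by (intro sum.cong refl) (simp add: cell_osc_dual)
  then have "psi (sandwich m T) = (LINT x|unit_interval. osc_dual m x * mesh.avg m v x) / of_real mass"
    using psi_eq[OF Lp.compact_ops_bounded[OF sandwich_compact[OF T]] mesh.avg_Lp S(2)] by simp
  with that[OF mesh.avg_Lp S(1)] show ?thesis by blast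
qed

lemma psi_add_smult:
  assumes S: "S \<in> compact_ops LP" and T: "T \<in> compact_ops LP"
  shows "psi (S \<oplus>\<^bsub>K\<^esub> T) = psi S + psi T" "psi (c \<odot>\<^bsub>K\<^esub> T) = c * psi T"
proof -
  have c1: "cls (\<lambda>_. 1) \<in> carrier LP" using one_Lp by simp
  note bS = Lp.compact_ops_bounded[OF S] and bT = Lp.compact_ops_bounded[OF T]
  obtain v where v: "v \<in> LF" "S (cls (\<lambda>_. 1)) = cls v"
    using Lp.op_closed[OF bS c1] by (rule carrier_Lp_cases)
  obtain w where w: "w \<in> LF" "T (cls (\<lambda>_. 1)) = cls w"
    using Lp.op_closed[OF bT c1] by (rule carrier_Lp_cases)
  have cl: "S \<oplus>\<^bsub>K\<^esub> T \<in> bounded_ops LP LP" "c \<odot>\<^bsub>K\<^esub> T \<in> bounded_ops LP LP"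
    using K.a_closed[of S T] K.smult_cl[of T c] S T Lp.compact_ops_bounded by (simp_all del: compact_op_algebra_simps(4,5))
  have I: "integrable unit_interval (\<lambda>x. mesh.step 0 weight x * f x)" if "f \<in> LF" for f
  proof -
    have "cmod (mesh.step 0 weight x) \<le> (\<Sum>i<mesh 0. cmod (weight i))" for x
      by (intro mesh.step_bound member_le_sum sum_nonneg) auto
    then show ?thesis by (intro Lp_integrable Lp_functions_mult_bounded that mesh.step_measurable)
  qed
  have "(S \<oplus>\<^bsub>K\<^esub> T) (cls (\<lambda>_. 1)) = cls (\<lambda>x. v x + w x)" using c1 v w by (simp add: Lp_add)
  then show "psi (S \<oplus>\<^bsub>K\<^esub> T) = psi S + psi T"
    unfolding psi_eq[OF bS v] psi_eq[OF bT w] psi_eq[OF cl(1) Lp_functions_add[OF v(1) w(1)]]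
    using I[OF v(1)] I[OF w(1)] by (simp add: psi_eq[OF cl(1) Lp_functions_add[OF v(1) w(1)]] distrib_left add_divide_distrib del: compact_op_algebra_simps)
  have "(c \<odot>\<^bsub>K\<^esub> T) (cls (\<lambda>_. 1)) = cls (\<lambda>x. c * w x)" using c1 w by (simp add: Lp_smult)
  then show "psi (c \<odot>\<^bsub>K\<^esub> T) = c * psi T"
    unfolding psi_eq[OF bT w]
    by (simp add: psi_eq[OF cl(2) Lp_functions_smult[OF w(1)]] mult.left_commute del: compact_op_algebra_simps)
qed

end

section \<open>Failure of scaling\<close>

context Lp_unit_interval
begin

definition weight_norm :: real where
  "weight_norm = Lp_seminorm (p / (p - 1)) unit_interval (mesh.step 0 weight)"

lemma weight_norm_nonneg: "0 \<le> weight_norm"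
  by (simp add: weight_norm_def)

text \<open>Hoelder for \<open>weight\<close> and the image of the constant 1. The constant is
  sharp: it is attained at \<open>rank_one peak\<close>, with \<open>peak\<close> defined
  below.\<close>

lemma psi_le:
  assumes T: "T \<in> compact_ops LP"
  shows "cmod (psi T) \<le> weight_norm / mass * nrm K T"
proof -
  note bT = Lp.compact_ops_bounded[OF T]
  have c1: "cls (\<lambda>_. 1) \<in> carrier LP" using one_Lp by simp
  obtain v where v: "v \<in> LF" "T (cls (\<lambda>_. 1)) = cls v"
    using Lp.op_closed[OF bT c1] by (rule carrier_Lp_cases)
  have "cmod (LINT x|unit_interval. mesh.step 0 weight x * v x) \<le> (LINT x|unit_interval. cmod (mesh.step 0 weight x * v x))"
    by (rule integral_norm_bound)
  also have "\<dots> \<le> weight_norm * snorm v"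
    unfolding weight_norm_def using conj_exponent
    by (intro Hoelder_inequality(2)[OF conj_exponent(1) p_gt_1 _ step_Lq v(1)]) simp
  also have "\<dots> \<le> weight_norm * nrm K T"
    using Lp.op.op_norm_upper[OF bT one_unit_ball] v weight_norm_nonneg by (intro mult_left_mono) (simp_all add: Lp_nrm)
  finally show ?thesis
    unfolding psi_eq[OF bT v] using mass_pos by (simp add: norm_divide divide_right_mono)
qed

text \<open>\<open>osc_dual m\<close> is a norming functional of \<open>osc m\<close>: their norms
  \<open>mass powr (1 - 1 / p)\<close> and \<open>mass powr (1 / p)\<close> multiply to their
  pairing \<open>mass\<close>. Hence Hoelder loses nothing after division by
  \<open>mass\<close>.\<close>

lemma psi_sandwich_state:
  assumes T: "T \<in> compact_ops LP"
    and B: "nrm LP (sandwich m T (cls (osc m)) \<oplus>\<^bsub>LP\<^esub> l \<odot>\<^bsub>LP\<^esub> cls (osc m)) \<le> B * nrm LP (cls (osc m))"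
  shows "cmod (psi (sandwich m T) + l) \<le> B"
proof -
  obtain h where h: "h \<in> LF" "sandwich m T (cls (osc m)) = cls h"
    "psi (sandwich m T) = (LINT x|unit_interval. osc_dual m x * h x) / of_real mass"
    by (rule psi_sandwich[OF T])
  have oL: "osc m \<in> LF" by (simp add: osc_def)
  have kL: "osc_dual m \<in> Lp_functions (p / (p - 1)) unit_interval" unfolding osc_dual_def by (rule step_Lq)
  have pq: "1 / (p / (p - 1)) + 1 / p = 1" using conj_exponent(2) by simp
  note H = Hoelder_inequality[OF conj_exponent(1) p_gt_1 pq kL]
  define y where "y = (\<lambda>x. h x + l * osc m x)"
  have y: "y \<in> LF" unfolding y_def by (intro Lp_functions_add Lp_functions_smult h oL)
  have "snorm y \<le> B * mass powr (1 / p)"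
    using B h oL by (simp add: Lp_smult Lp_add Lp_functions_smult Lp_nrm Lp_functions_add osc_norm y_def)
  have "(LINT x|unit_interval. osc_dual m x * y x)
      = (LINT x|unit_interval. osc_dual m x * h x + l * (osc_dual m x * osc m x))"
    by (intro Bochner_Integration.integral_cong refl) (simp add: y_def algebra_simps)
  also have "\<dots> = (LINT x|unit_interval. osc_dual m x * h x) + l * of_real mass"
    using H(1)[OF h(1)] H(1)[OF oL] by (simp add: integral_osc_dual_osc)
  finally have eq: "psi (sandwich m T) + l = (LINT x|unit_interval. osc_dual m x * y x) / of_real mass"
    using mass_pos by (simp add: h(3) add_divide_distrib)
  have "cmod (LINT x|unit_interval. osc_dual m x * y x) \<le> (LINT x|unit_interval. cmod (osc_dual m x * y x))"
    by (rule integral_norm_bound)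
  also have "\<dots> \<le> mass powr (1 - 1 / p) * snorm y"
    using H(2)[OF y] by (simp add: osc_dual_norm)
  also have "\<dots> \<le> mass powr (1 - 1 / p) * (B * mass powr (1 / p))"
    by (intro mult_left_mono) (fact, simp)
  also have "\<dots> = B * mass"
    using mass_pos powr_add[of mass "1 - 1 / p" "1 / p"] by simp
  finally show ?thesis unfolding eq using mass_pos by (simp add: norm_divide divide_le_eq)
qed

lemma psi_state:
  assumes T: "T \<in> compact_ops LP"
  shows "cmod (psi T + l) \<le> nrm U (T, l)"
proof (rule field_le_epsilon)
  fix e :: real assume e: "0 < e"
  define C where "C = weight_norm / mass"
  have C: "0 \<le> C" using weight_norm_nonneg mass_pos by (simp add: C_def)
  \<comment> \<open>One \<open>d\<close> is lost in passing from the norm of the compression plus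
    \<open>l\<close> to that of \<open>T\<close> plus \<open>l\<close>, and \<open>C * d\<close> in
    comparing the values of \<open>psi\<close>.\<close>
  define d where "d = e / (1 + C)"
  have d: "0 < d" using e C by (simp add: d_def)
  obtain m where m: "nrm K (sandwich m T \<ominus>\<^bsub>K\<^esub> T) \<le> d" using sandwich_tendsto[OF T d] by blast
  define S where "S = sandwich m T"
  have S: "S \<in> compact_ops LP" unfolding S_def by (rule sandwich_compact[OF T])
  have D: "S \<ominus>\<^bsub>K\<^esub> T \<in> compact_ops LP" using K.minus_cl[of S T] S T by simp
  define F where "F = cls (osc m)"
  have F: "F \<in> carrier LP" by (simp add: F_def osc_def)
  have c: "S F \<in> carrier LP" "T F \<in> carrier LP" "l \<odot>\<^bsub>LP\<^esub> F \<in> carrier LP"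
    using Lp.op_closed[OF Lp.compact_ops_bounded[OF S] F] Lp.op_closed[OF Lp.compact_ops_bounded[OF T] F] F by auto
  have "(S F \<oplus>\<^bsub>LP\<^esub> l \<odot>\<^bsub>LP\<^esub> F) \<ominus>\<^bsub>LP\<^esub> (T F \<oplus>\<^bsub>LP\<^esub> l \<odot>\<^bsub>LP\<^esub> F) = S F \<ominus>\<^bsub>LP\<^esub> T F"
    using c Lp.minus_eq_zero_iff[OF c(3,3)] by (simp add: Lp.add_diff_add)
  then have "nrm LP (S F \<oplus>\<^bsub>LP\<^esub> l \<odot>\<^bsub>LP\<^esub> F)
     \<le> nrm LP (S F \<ominus>\<^bsub>LP\<^esub> T F) + nrm LP (T F \<oplus>\<^bsub>LP\<^esub> l \<odot>\<^bsub>LP\<^esub> F)"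
    using Lp.nrm_le_minus[of "S F \<oplus>\<^bsub>LP\<^esub> l \<odot>\<^bsub>LP\<^esub> F" "T F \<oplus>\<^bsub>LP\<^esub> l \<odot>\<^bsub>LP\<^esub> F"] c by simp
  also have "nrm LP (S F \<ominus>\<^bsub>LP\<^esub> T F) \<le> d * nrm LP F"
  proof -
    have "nrm LP (S F \<ominus>\<^bsub>LP\<^esub> T F) \<le> op_norm LP LP (S \<ominus>\<^bsub>K\<^esub> T) * nrm LP F"
      using Lp.op.nrm_op_le[OF Lp.compact_ops_bounded[OF D] F] by (simp only: Lp.compact_op_minus_apply[OF S T F])
    also have "\<dots> \<le> d * nrm LP F"
      using m F unfolding S_def[symmetric] compact_op_algebra_simps by (intro mult_right_mono) auto
    finally show ?thesis .
  qed
  also have "nrm LP (T F \<oplus>\<^bsub>LP\<^esub> l \<odot>\<^bsub>LP\<^esub> F) \<le> nrm U (T, l) * nrm LP F"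
    by (rule unitization_norm_upper[OF T F])
  finally have "nrm LP (S F \<oplus>\<^bsub>LP\<^esub> l \<odot>\<^bsub>LP\<^esub> F) \<le> (d + nrm U (T, l)) * nrm LP F"
    by (simp only: distrib_right)
  then have 1: "cmod (psi S + l) \<le> d + nrm U (T, l)"
    unfolding S_def F_def by (rule psi_sandwich_state[OF T])
  have "psi (S \<ominus>\<^bsub>K\<^esub> T) = psi S - psi T"
    using psi_add_smult(1)[OF S, of "(-1) \<odot>\<^bsub>K\<^esub> T"] psi_add_smult(2)[OF T T, of "-1"] K.smult_cl[of T "-1"] K.minus_eq_smult[of S T] S T
    by (simp del: compact_op_algebra_simps(4,5))
  then have "cmod (psi S - psi T) \<le> C * nrm K (S \<ominus>\<^bsub>K\<^esub> T)" using psi_le[OF D] by (simp add: C_def)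
  also have "\<dots> \<le> C * d" using m C unfolding S_def by (intro mult_left_mono)
  finally have 2: "cmod (psi S - psi T) \<le> C * d" .
  have "cmod (psi T + l) \<le> cmod (psi S + l) + cmod (psi S - psi T)"
    using norm_triangle_ineq4[of "psi S + l" "psi S - psi T"] by (simp add: add.commute)
  also have "\<dots> \<le> nrm U (T, l) + d * (1 + C)" using 1 2 by (simp add: algebra_simps)
  also have "d * (1 + C) = e" using C by (simp add: d_def)
  finally show "cmod (psi T + l) \<le> nrm U (T, l) + e" .
qed

definition psi_ext :: "((real \<Rightarrow> complex) set \<Rightarrow> (real \<Rightarrow> complex) set) \<times> complex \<Rightarrow> complex" where
  "psi_ext = (\<lambda>x\<in>carrier U. psi (fst x) + snd x)"

lemma psi_ext_state: "psi_ext \<in> unital_states U"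
proof -
  have zero: "\<zero>\<^bsub>K\<^esub> \<in> compact_ops LP" using K.zero_closed by simp
  have psi0: "psi \<zero>\<^bsub>K\<^esub> = 0"
    using psi_add_smult(2)[OF zero zero, of 0] K.zero_smult[of "\<zero>\<^bsub>K\<^esub>"] zero by (simp del: compact_op_algebra_simps(3,5))
  have ext: "psi_ext (T, l) = psi T + l" if "T \<in> compact_ops LP" for T l
    using that by (simp add: psi_ext_def)
  have lin: "psi_ext \<in> linear_maps U complex_space"
  proof (rule linear_mapsI)
    show "psi_ext \<in> extensional (carrier U)" by (simp add: psi_ext_def)
    fix x assume "x \<in> carrier U"
    then obtain S k where x: "x = (S, k)" "S \<in> compact_ops LP" by (cases x) auto
    show "psi_ext (c \<odot>\<^bsub>U\<^esub> x) = c \<odot>\<^bsub>complex_space\<^esub> psi_ext x" for c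
    proof -
      have "c \<odot>\<^bsub>K\<^esub> S \<in> compact_ops LP" using K.smult_cl[of S c] x by simp
      then show ?thesis
        using psi_add_smult(2)[OF x(2,2), of c] x
        by (simp only: x(1) multiplier_unitization_simps ext complex_space_simps distrib_left)
    qed
    fix y assume "y \<in> carrier U"
    then obtain T l where y: "y = (T, l)" "T \<in> compact_ops LP" by (cases y) auto
    have "S \<oplus>\<^bsub>K\<^esub> T \<in> compact_ops LP" using K.a_closed[of S T] x y by simp
    then show "psi_ext (x \<oplus>\<^bsub>U\<^esub> y) = psi_ext x \<oplus>\<^bsub>complex_space\<^esub> psi_ext y"
      using psi_add_smult(1)[OF x(2) y(2)] x y
      by (simp only: x(1) y(1) multiplier_unitization_simps ext complex_space_simps) simp
  qed simp
  have le: "cmod (psi_ext x) \<le> nrm U x" if "x \<in> carrier U" for x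
  proof -
    obtain S k where x: "x = (S, k)" "S \<in> compact_ops LP" using \<open>x \<in> carrier U\<close> by (cases x) auto
    show ?thesis using psi_state[OF x(2), of k] by (simp only: x(1) ext[OF x(2)])
  qed
  have bounded: "psi_ext \<in> bounded_ops U complex_space"
    unfolding bounded_ops_def using lin le by (auto intro!: exI[of _ 1] simp del: multiplier_unitization_simps)
  have one: "psi_ext \<one>\<^bsub>U\<^esub> = 1" by (simp only: multiplier_unitization_simps ext[OF zero] psi0) simp
  have ball: "\<one>\<^bsub>U\<^esub> \<in> closed_unit_ball U"
  proof -
    have "nrm U (\<zero>\<^bsub>K\<^esub>, 1) \<le> 1" by (rule unitization_norm_le[OF zero]) auto
    then show ?thesis
      unfolding closed_unit_ball_def multiplier_unitization_simps(1,2)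
      using zero by (simp del: multiplier_unitization_simps(5) compact_op_algebra_simps(3) add: mem_Times_iff)
  qed
  have le1: "nrm complex_space (psi_ext x) \<le> 1" if "x \<in> closed_unit_ball U" for x
    using le[OF closed_unit_ballD(1)[OF that]] closed_unit_ballD(2)[OF that] by simp
  have "op_norm U complex_space psi_ext = 1"
    unfolding op_norm_def
  proof (rule antisym)
    show "(SUP x\<in>closed_unit_ball U. nrm complex_space (psi_ext x)) \<le> 1"
      using ball le1 by (intro cSUP_least) blast+
    have "nrm complex_space (psi_ext \<one>\<^bsub>U\<^esub>) \<le> (SUP x\<in>closed_unit_ball U. nrm complex_space (psi_ext x))"
      by (intro cSUP_upper[OF ball] bdd_aboveI2[where M = 1] le1)
    then show "1 \<le> (SUP x\<in>closed_unit_ball U. nrm complex_space (psi_ext x))"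
      unfolding one by simp
  qed
  with bounded one show ?thesis by (simp add: unital_states_def del: multiplier_unitization_simps)
qed

text \<open>\<open>peak\<close> is the unit vector at which the functional given by \<open>weight\<close> attains its norm.\<close>

definition peak_ratio :: real where
  "peak_ratio = 2 powr ((p - 2) / (p - 1))"

text \<open>The mean of the p-th powers of 1 and \<open>peak_ratio\<close>. By the choice of the
  ratio it is also the mean of \<open>weight\<close> raised to the conjugate exponent.\<close>

definition peak_mass :: real where
  "peak_mass = (1 + peak_ratio powr p) / 2"

definition peak_coeff :: "nat \<Rightarrow> real" where
  "peak_coeff i = peak_mass powr (- 1 / p) * (if i = 0 then 1 else peak_ratio)"

definition peak :: "real \<Rightarrow> complex" where
  "peak = mesh.step 0 (\<lambda>i. of_real (peak_coeff i))"

lemma mesh0: "mesh 0 = 2"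
  by (simp add: mesh_def)

lemma sum_mesh0: "(\<Sum>i<mesh 0. h i) = h 0 + h (Suc 0)" "(\<Sum>i<2. h i) = h 0 + h (Suc 0)"
  for h :: "nat \<Rightarrow> 'c :: comm_monoid_add"
  by (simp_all add: mesh0 numeral_2_eq_2)

lemma peak_ratio_powr: "peak_ratio powr (p - 1) = 2 powr (p - 2)"
  using p_gt_1 by (simp add: peak_ratio_def powr_powr)

lemma peak_mass_pos: "0 < peak_mass"
  by (simp add: peak_mass_def add_pos_nonneg)

lemma peak_coeff_nonneg: "0 \<le> peak_coeff i"
  by (simp add: peak_coeff_def peak_ratio_def)

text \<open>As both halves have measure 1/2, this says that \<open>peak\<close> has norm 1.\<close>

lemma peak_coeff_powr: "peak_coeff 0 powr p + peak_coeff (Suc 0) powr p = 2"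
proof -
  have "(peak_mass powr (- 1 / p)) powr p = peak_mass powr (- 1)"
    using p_gt_1 by (simp only: powr_powr) simp
  also have "\<dots> = 1 / peak_mass" using peak_mass_pos by (simp add: powr_minus_divide)
  finally have "peak_coeff 0 powr p + peak_coeff (Suc 0) powr p = 1 / peak_mass * (1 + peak_ratio powr p)"
    unfolding peak_coeff_def by (simp add: powr_mult peak_ratio_def distrib_left)
  also have "1 + peak_ratio powr p = 2 * peak_mass" by (simp add: peak_mass_def)
  finally show ?thesis using peak_mass_pos by simp
qed

lemma peak_Lp: "peak \<in> LF"
  by (simp add: peak_def)

lemma weight_norm_eq: "weight_norm = peak_mass powr (1 - 1 / p)"
proof -
  have "(2 powr (p - 2)) powr (p / (p - 1)) = peak_ratio powr p"
    unfolding peak_ratio_powr[symmetric] using p_gt_1 by (simp add: powr_powr)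
  then have "(LINT x|unit_interval. cmod (mesh.step 0 weight x) powr (p / (p - 1))) = peak_mass"
    using p_gt_1 by (subst mesh.integral_step) (simp_all add: sum_mesh0 weight_def mesh0 peak_mass_def)
  then show ?thesis using p_gt_1 by (simp add: weight_norm_def Lp_seminorm_def field_simps)
qed

lemma cell_peak:
  assumes "i < 2" shows "mesh.cell 0 i peak = of_real (peak_coeff i) / 2"
proof -
  have i: "i < mesh 0" using assms by (simp add: mesh0)
  show ?thesis unfolding peak_def mesh.cell_step[OF i] by (simp add: mesh0)
qed

text \<open>The equality case of Hoelder, for a vector \<open>peak\<close> of norm 1.\<close>

lemma integral_weight_peak: "(LINT x|unit_interval. mesh.step 0 weight x * peak x) = of_real weight_norm"
proof -
  have r: "peak_ratio powr (p - 1) * peak_ratio = peak_ratio powr p"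
    by (simp add: powr_diff peak_ratio_def)
  have "(LINT x|unit_interval. mesh.step 0 weight x * peak x)
     = of_real (peak_coeff 0 / 2 + 2 powr (p - 2) * (peak_coeff (Suc 0) / 2))"
    unfolding mesh.integral_step_mult[OF Lp_integrable[OF peak_Lp]] sum_mesh0
    by (simp add: weight_def cell_peak)
  also have "peak_coeff 0 / 2 + 2 powr (p - 2) * (peak_coeff (Suc 0) / 2)
     = peak_mass powr (- 1 / p) * ((1 + peak_ratio powr (p - 1) * peak_ratio) / 2)"
    by (simp add: peak_coeff_def peak_ratio_powr field_simps)
  also have "\<dots> = peak_mass powr (- 1 / p) * peak_mass" by (simp only: r peak_mass_def)
  also have "\<dots> = weight_norm"
    using peak_mass_pos powr_add[of peak_mass "- 1 / p" 1] by (simp add: weight_norm_eq)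
  finally show ?thesis .
qed

text \<open>Split \<open>x\<close> into its two halves. The mean of \<open>x\<close> is close to its norm only if both halves have
  nearly the same norm, while \<open>x + mean x * peak\<close> has norm close to 2 only if the norms of the halves
  are nearly proportional to those of \<open>peak\<close>, which are distinct for \<open>p \<noteq> 2\<close>.\<close>

lemma rank_one_peak_bound:
  assumes p2: "p \<noteq> 2"
  obtains B where "0 \<le> B" "B < 2"
    "\<And>x. x \<in> LF \<Longrightarrow>
       snorm (\<lambda>t. x t + (LINT s|unit_interval. x s) * peak t) \<le> B * snorm x"
proof -
  \<comment> \<open>\<open>W i\<close> is the norm of \<open>peak\<close> on half \<open>i\<close>,
    and \<open>Z i\<close> below is that of \<open>x\<close>. These two pairs are the data of the
    two-dimensional inequality.\<close>
  define W where "W i = peak_coeff i * (1 / 2) powr (1 / p)" for i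
  have W0: "0 \<le> W i" for i by (simp add: W_def peak_coeff_nonneg)
  have half: "((1 / 2 :: real) powr (1 / p)) powr p = 1 / 2" using p_gt_1 by (simp only: powr_powr) simp
  have Wsum: "W 0 powr p + W (Suc 0) powr p = 1"
    using peak_coeff_powr unfolding W_def by (simp only: powr_mult peak_coeff_nonneg half flip: distrib_right)
  have "peak_ratio \<noteq> 1"
  proof
    assume "peak_ratio = 1"
    then have "(p - 2) / (p - 1) = 0" unfolding peak_ratio_def by simp
    then show False using p2 p_gt_1 by simp
  qed
  then have "W 0 \<noteq> W (Suc 0)" using peak_mass_pos by (simp add: W_def peak_coeff_def)
  then obtain B where B: "0 \<le> B" "B < 2" and bound: "\<And>X0 X1 J. 0 \<le> X0 \<Longrightarrow> 0 \<le> X1 \<Longrightarrow>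
      J = 2 powr (1 / p - 1) * (X0 + X1) \<Longrightarrow>
      (X0 + J * W 0) powr p + (X1 + J * W (Suc 0)) powr p \<le> B powr p * (X0 powr p + X1 powr p)"
    using two_dim_bound[OF p_gt_1 W0 W0 Wsum] by metis
  show ?thesis
  proof (rule that[OF B])
    fix x assume x: "x \<in> LF"
    define A where "A = mesh_cell 0"
    have A: "i < 2 \<Longrightarrow> A i \<in> sets unit_interval" "i < 2 \<Longrightarrow> measure unit_interval (A i) = 1 / 2" for i
      using mesh.A_sets[of i 0] mesh.A_measure[of i 0] by (simp_all add: A_def mesh0)
    define Z where "Z i = (LINT t|unit_interval. indicator (A i) t * cmod (x t) powr p) powr (1 / p)" for i
    have int_nn: "0 \<le> (LINT t|unit_interval. indicator (A i) t * cmod (y t) powr p)" for i y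
      by (intro integral_nonneg_AE) simp
    have Z: "0 \<le> Z i" "Z i powr p = (LINT t|unit_interval. indicator (A i) t * cmod (x t) powr p)" for i
      using int_nn[of i x] p_gt_1 by (simp_all add: Z_def powr_powr)
    have split: "snorm y powr p = (LINT t|unit_interval. indicator (A 0) t * cmod (y t) powr p)
        + (LINT t|unit_interval. indicator (A (Suc 0)) t * cmod (y t) powr p)" if "y \<in> LF" for y
      unfolding Lp_seminorm_powr mesh.integral_cells[OF Lp_functionsD(2)[OF that], of 0] sum_mesh0 A_def ..
    have ind: "snorm (\<lambda>t. indicator (A i) t * y t)
        = (LINT t|unit_interval. indicator (A i) t * cmod (y t) powr p) powr (1 / p)" for i and y :: "real \<Rightarrow> complex"
      unfolding Lp_seminorm_def using p_gt_1
      by (intro arg_cong[where f = "\<lambda>s. s powr (1 / p)"] Bochner_Integration.integral_cong refl) (auto simp: indicator_def)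
    define \<mu> where "\<mu> = (LINT s|unit_interval. x s)"
    \<comment> \<open>Hoelder on the two halves, each of measure 1/2, bounds the mean of
      \<open>x\<close> by this \<open>J\<close>; the factor is (1/2)^(1-1/p).\<close>
    define J where "J = 2 powr (1 / p - 1) * (Z 0 + Z (Suc 0))"
    have J0: "0 \<le> J" using Z by (simp add: J_def)
    have cell_le': "cmod (mesh.cell 0 i x) \<le> (1 / 2) powr (1 - 1 / p) * Z i" if i: "i < 2" for i
      using indicator_integral_le[OF x A(1)[OF i]] unfolding A(2)[OF i] by (simp only: mesh.cell_def Z_def A_def)
    have "cmod \<mu> \<le> cmod (mesh.cell 0 0 x) + cmod (mesh.cell 0 (Suc 0) x)"
      unfolding \<mu>_def mesh.integral_cells[OF Lp_integrable[OF x], of 0] sum_mesh0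
      unfolding mesh.cell_def by (rule norm_triangle_ineq)
    also have "\<dots> \<le> (1 / 2) powr (1 - 1 / p) * Z 0 + (1 / 2) powr (1 - 1 / p) * Z (Suc 0)"
      by (intro add_mono cell_le') simp_all
    also have "(1 / 2 :: real) powr (1 - 1 / p) = 2 powr (1 / p - 1)"
      by (simp add: powr_divide powr_diff)
    finally have \<mu>J: "cmod \<mu> \<le> J" by (simp add: J_def distrib_left)
    define y where "y = (\<lambda>t. x t + \<mu> * peak t)"
    have y: "y \<in> LF"
      unfolding y_def by (intro Lp_functions_add Lp_functions_smult x peak_Lp)
    \<comment> \<open>The triangle inequality on half \<open>i\<close>, where \<open>peak\<close> is
      constant, with the mean replaced by its bound \<open>J\<close>.\<close>
    have cell: "(LINT t|unit_interval. indicator (A i) t * cmod (y t) powr p) \<le> (Z i + J * W i) powr p" if i: "i < 2" for i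
    proof -
      have i': "i < mesh 0" using i by (simp add: mesh0)
      have eq: "(\<lambda>t. indicator (A i) t * y t) = (\<lambda>t. indicator (A i) t * x t + (\<mu> * of_real (peak_coeff i)) * indicator (A i) t)"
        unfolding y_def peak_def using mesh.step_in[OF i'] by (auto simp: indicator_def A_def fun_eq_iff)
      have iL: "(indicator (A i) :: real \<Rightarrow> complex) \<in> LF"
        using Lp_functions_indicator[OF one_Lp A(1)[OF i]] by simp
      have iN: "snorm (indicator (A i)) = (1 / 2) powr (1 / p)"
      proof -
        have "A i \<inter> {0..1} = A i"
          using sets.sets_into_space[OF A(1)[OF i]] by (auto simp: space_restrict_space)
        then show ?thesis using ind[of i "\<lambda>_. 1"] A(2)[OF i] by simp
      qed
      have "(LINT t|unit_interval. indicator (A i) t * cmod (y t) powr p) powr (1 / p)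
          \<le> snorm (\<lambda>t. indicator (A i) t * x t)
            + snorm (\<lambda>t. (\<mu> * of_real (peak_coeff i)) * indicator (A i) t)"
        unfolding ind[symmetric] eq
        by (intro Lp_seminorm_triangle Lp_functions_indicator x A(1)[OF i] Lp_functions_smult iL)
      also have "\<dots> = Z i + cmod \<mu> * W i"
        by (simp add: ind Z_def Lp_seminorm_smult iN W_def norm_mult peak_coeff_nonneg)
      also have "\<dots> \<le> Z i + J * W i" using \<mu>J W0 by (intro add_left_mono mult_right_mono)
      finally have "((LINT t|unit_interval. indicator (A i) t * cmod (y t) powr p) powr (1 / p)) powr p \<le> (Z i + J * W i) powr p"
        using p_gt_1 by (intro powr_mono2) auto
      then show ?thesis using int_nn[of i y] p_gt_1 by (simp add: powr_powr)
    qed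
    have "snorm y powr p \<le> (Z 0 + J * W 0) powr p + (Z (Suc 0) + J * W (Suc 0)) powr p"
      unfolding split[OF y] by (intro add_mono cell) auto
    also have "\<dots> \<le> B powr p * (Z 0 powr p + Z (Suc 0) powr p)" by (rule bound[OF Z(1) Z(1) J_def])
    also have "Z 0 powr p + Z (Suc 0) powr p = snorm x powr p" unfolding split[OF x] Z(2) ..
    also have "B powr p * snorm x powr p = (B * snorm x) powr p"
      using B by (simp add: powr_mult)
    finally have "(LINT t|unit_interval. cmod (y t) powr p) \<le> (B * snorm x) powr p"
      by (simp only: Lp_seminorm_powr)
    then have "snorm y \<le> B * snorm x"
      by (rule Lp_seminorm_leI) (simp add: B(1))
    then show "snorm (\<lambda>t. x t + (LINT s|unit_interval. x s) * peak t) \<le> B * snorm x"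
      by (simp only: y_def \<mu>_def)
  qed
qed

lemma not_scaled_K:
  assumes p2: "p \<noteq> 2"
  shows "\<not> scaled K"
proof
  assume "scaled K"
  define \<rho> where "\<rho> = (\<lambda>a\<in>carrier K. psi_ext (a, 0))"
  have \<rho>: "\<rho> a = psi a" if "a \<in> compact_ops LP" for a
    using that by (simp add: \<rho>_def psi_ext_def)
  have "\<rho> \<in> unitization_state_restrictions K"
    unfolding unitization_state_restrictions_def \<rho>_def using psi_ext_state by (rule imageI)
  with \<open>scaled K\<close> have "\<rho> \<in> quasistates K" by (simp add: scaled_def)
  then obtain t \<phi> where t: "0 \<le> t" "t \<le> 1" and \<phi>: "\<phi> \<in> states K" and \<rho>\<phi>: "\<rho> = (\<lambda>a\<in>carrier K. of_real t * \<phi> a)"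
    unfolding quasistates_def by blast
  define R where "R = rank_one peak"
  have R: "R \<in> compact_ops LP" unfolding R_def by (rule rank_one_compact[OF peak_Lp])
  have R1: "R (cls (\<lambda>_. 1)) = cls peak"
    unfolding R_def using rank_one_cls[OF peak_Lp one_Lp, unfolded integral_const_one] by simp
  have psiR: "psi R = of_real (weight_norm / mass)"
    using psi_eq[OF Lp.compact_ops_bounded[OF R] peak_Lp R1] by (simp add: integral_weight_peak)
  have wpos: "0 < weight_norm" using peak_mass_pos by (simp add: weight_norm_eq)
  have t\<phi>: "of_real t * \<phi> a = psi a" if "a \<in> compact_ops LP" for a
    using \<rho>[OF that] that by (simp add: \<rho>\<phi>)
  have "t \<noteq> 0" using t\<phi>[OF R] wpos mass_pos by (auto simp: psiR)
  with t have tpos: "0 < t" by simp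
  \<comment> \<open>\<open>\<kappa>\<close> is at once the value of \<open>\<phi>\<close> at
    \<open>R\<close> and, by \<open>psi_le\<close>, a bound for the norm of \<open>\<phi>\<close>.
    Since a state has norm 1, \<open>\<kappa>\<close> is at least 1, without any computation of
    \<open>t\<close>.\<close>
  define \<kappa> where "\<kappa> = weight_norm / mass / t"
  have \<phi>_eq: "\<phi> a = psi a / of_real t" if "a \<in> compact_ops LP" for a
    using t\<phi>[OF that] tpos by (simp add: field_simps)
  have "op_norm K complex_space \<phi> \<le> \<kappa>"
  proof -
    interpret \<phi>: normed_space_pair K complex_space
      by (simp add: normed_space_pair_def K.complex_normed_space_axioms complex_normed_space_complex)
    show ?thesis
    proof (rule \<phi>.op_norm_le)
      fix a assume a: "a \<in> closed_unit_ball K"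
      have aK: "a \<in> compact_ops LP" "nrm K a \<le> 1" using closed_unit_ballD[OF a] by auto
      have "cmod (psi a) \<le> weight_norm / mass * 1"
        using psi_le[OF aK(1)] mult_left_mono[OF aK(2), of "weight_norm / mass"] wpos mass_pos by simp
      then have "cmod (psi a) / t \<le> weight_norm / mass / t" using tpos by (intro divide_right_mono) auto
      then show "nrm complex_space (\<phi> a) \<le> \<kappa>"
        using tpos unfolding \<phi>_eq[OF aK(1)] \<kappa>_def by (simp only: complex_space_simps norm_divide norm_of_real abs_of_pos)
    qed
  qed
  moreover have "op_norm K complex_space \<phi> = 1" using \<phi> by (simp add: states_def)
  ultimately have \<kappa>: "1 \<le> \<kappa>" by simp
  have \<phi>R: "\<phi> R = of_real \<kappa>" by (simp add: \<phi>_eq[OF R] psiR \<kappa>_def)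
  obtain \<omega> where \<omega>: "\<omega> \<in> unital_states U" "\<phi> = (\<lambda>a\<in>carrier K. \<omega> (a, 0))"
    using \<phi> unfolding states_def unitization_state_restrictions_def by blast
  have zero: "\<zero>\<^bsub>K\<^esub> \<in> carrier K" by (rule K.zero_closed)
  have "(R, 1) = (R, 0) \<oplus>\<^bsub>U\<^esub> \<one>\<^bsub>U\<^esub>"
    using K.r_zero[of R] R by (simp del: compact_op_algebra_simps(3,4))
  moreover have "\<omega> ((R, 0) \<oplus>\<^bsub>U\<^esub> \<one>\<^bsub>U\<^esub>) = \<omega> (R, 0) + \<omega> \<one>\<^bsub>U\<^esub>"
  proof -
    have "\<omega> \<in> linear_maps U complex_space"
      using \<omega>(1) bounded_ops_linear unfolding unital_states_def by blast
    then have add: "\<And>x y. x \<in> carrier U \<Longrightarrow> y \<in> carrier U \<Longrightarrow> \<omega> (x \<oplus>\<^bsub>U\<^esub> y) = \<omega> x + \<omega> y"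
      unfolding linear_maps_def complex_space_simps by blast
    show ?thesis
      by (rule add) (use R zero in \<open>simp_all only: multiplier_unitization_simps mem_Times_iff fst_conv snd_conv UNIV_I compact_op_algebra_simps(1)\<close>)
  qed
  moreover have "\<omega> \<one>\<^bsub>U\<^esub> = 1" using \<omega>(1) by (simp add: unital_states_def)
  moreover have "\<omega> (R, 0) = of_real \<kappa>" using \<phi>R R by (simp add: \<omega>(2))
  ultimately have val: "\<omega> (R, 1) = of_real (\<kappa> + 1)" by simp
  obtain B where B: "0 \<le> B" "B < 2" and bound: "\<And>x. x \<in> LF \<Longrightarrow>
       snorm (\<lambda>t. x t + (LINT s|unit_interval. x s) * peak t) \<le> B * snorm x"
    using rank_one_peak_bound[OF p2] by blast
  have "nrm U (R, 1) \<le> B"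
  proof (rule unitization_norm_le[OF R B(1)])
    fix F assume "F \<in> carrier LP"
    then obtain f where f: "f \<in> LF" "F = cls f" by (rule carrier_Lp_cases)
    have "R F \<oplus>\<^bsub>LP\<^esub> 1 \<odot>\<^bsub>LP\<^esub> F = cls (\<lambda>t. f t + (LINT s|unit_interval. f s) * peak t)"
      using f peak_Lp by (simp add: R_def rank_one_cls Lp_add Lp_functions_smult add.commute)
    then show "nrm LP (R F \<oplus>\<^bsub>LP\<^esub> 1 \<odot>\<^bsub>LP\<^esub> F) \<le> B * nrm LP F"
      using bound[OF f(1)] f peak_Lp by (simp add: Lp_nrm Lp_functions_add Lp_functions_smult)
  qed
  \<comment> \<open>The value \<open>\<kappa> + 1\<close> is at least 2, while the norm is at most
    \<open>B < 2\<close>. The maximum with 1 provides the positive bound that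
    \<open>unital_state_le\<close> asks for.\<close>
  then have "cmod (\<omega> (R, 1)) \<le> max B 1" by (intro unital_state_le[OF \<omega>(1) R]) auto
  then show False unfolding val norm_of_real using \<kappa> B(2) by simp
qed

end

theorem corollary6p5:
  fixes p :: real
  defines "K \<equiv> compact_op_algebra (Lp p (lebesgue_on {0..1::real}))"
  assumes "1 < p" and "p \<noteq> 2"
  shows "approximately_unital K \<and> Lp_operator_algebra TYPE(real) p K \<and> \<not> unital K \<and> \<not> scaled K"
proof -
  interpret Lp_unit_interval p by unfold_locales fact
  show ?thesis
    unfolding K_def using approximately_unital_K Lp_operator_algebra_K not_unital_K not_scaled_K[OF \<open>p \<noteq> 2\<close>] by blast
qed

end
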